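(* Let $X$ be a compact topological space homeomorphic to a subspace of a manifold, and let $\Phi$ be a $C^0$ flow on $X$. Then $(X,\Phi)$ is linearizable by a $C^0$ embedding if and only if $\Phi$ is a $1$-parameter subgroup of a $C^0$ torus action on $X$ with finitely many orbit types.
   Context: Manifolds are, as usual, finite-dimensional, Hausdorff, second countable and without boundary. $C^0$ means continuous. A flow on $X$ is a group action $\Phi\colon \mathbb{R}\times X\to X$, $(t,x)\mapsto \Phi^t(x)$, of $(\mathbb{R},+)$ on $X$; it is $C^0$ if $\Phi$ is continuous. A map $F\colon X\to\mathbb{R}^n$ is linearizing (for $\Phi$) if there is a matrix $B\in\mathbb{R}^{n\times n}$ such that $F\circ\Phi^t=e^{Bt}\circ F$ for all $t\in\mathbb{R}$. A $C^0$ embedding is a homeomorphism onto its image (with the subspace topology). $(X,\Phi)$ is linearizable by a $C^0$ embedding if for some $n\in\mathbb{N}$ there is a linearizing $C^0$ embedding $F\colon X\to\mathbb{R}^n$. A $C^0$ torus action on $X$ is a continuous group action $\Theta\colon H\times X\to X$, $(h,x)\mapsto\Theta^h(x)$, of a torus $H=T^\ell=\mathbb{R}^\ell/\mathbb{Z}^\ell$ (for some $\ell\in\mathbb{N}$). It has finitely many orbit types if only finitely many subgroups of $H$ are of the form $\{g\in H\colon \Theta^g(x)=x\}$ for some $x\in X$. $\Phi$ is a $1$-parameter subgroup of $\Theta$ if there is $\boldsymbol\omega\in\mathbb{R}^\ell$ such that $\Phi^t=\Theta^{(\boldsymbol\omega t \bmod 1)}$ for all $t\in\mathbb{R}$, where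 "$\bmod\ 1$" is applied entrywise. *)

theory Defs
  imports
    "HOL-Analysis.Analysis"
    "HOL-Algebra.Group_Action"
    "Jordan_Normal_Form.Matrix"
begin

hide_const (open) Finite_Cartesian_Product.vec Finite_Cartesian_Product.mat


subsection \<open>Topological manifolds\<close>

definition second_countable_space :: "'a topology \<Rightarrow> bool" where
  "second_countable_space M \<longleftrightarrow>
    (\<exists>\<B>. countable \<B> \<and> (\<forall>V\<in>\<B>. openin M V) \<and>
      (\<forall>U x. openin M U \<and> x \<in> U \<longrightarrow> (\<exists>V\<in>\<B>. x \<in> V \<and> V \<subseteq> U)))"

definition locally_Euclidean_space :: "nat \<Rightarrow> 'a topology \<Rightarrow> bool" where
  "locally_Euclidean_space d M \<longleftrightarrow>
    (\<forall>x\<in>topspace M. \<exists>U V. openin M U \<and> x \<in> U \<and> openin (Euclidean_space d) V \<and>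
      subtopology M U homeomorphic_space subtopology (Euclidean_space d) V)"

definition topological_manifold :: "'a topology \<Rightarrow> bool" where
  "topological_manifold M \<longleftrightarrow>
    Hausdorff_space M \<and> second_countable_space M \<and> (\<exists>d. locally_Euclidean_space d M)"


subsection \<open>Continuous actions and flows\<close>

text \<open>
  The library's group actions map into \<^const>\<open>BijGroup\<close>, hence each \<open>\<phi> g\<close> is extensional
  (\<^term>\<open>undefined\<close> outside \<^term>\<open>topspace X\<close>). So an equality \<open>\<phi> g = \<psi> h\<close> between maps of two
  actions on the same space says exactly that they agree on the points of the space.
\<close>

definition continuous_action ::
    "('g, 'm) monoid_scheme \<Rightarrow> 'g topology \<Rightarrow> 'a topology \<Rightarrow> ('g \<Rightarrow> 'a \<Rightarrow> 'a) \<Rightarrow> bool" where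
  "continuous_action G T X \<phi> \<longleftrightarrow>
    group_action G (topspace X) \<phi> \<and>
    continuous_map (prod_topology T X) X (\<lambda>(g, x). \<phi> g x)"

definition real_group :: "real monoid" where
  "real_group = \<lparr>carrier = UNIV, mult = (+), one = 0\<rparr>"

definition C0_flow :: "'a topology \<Rightarrow> (real \<Rightarrow> 'a \<Rightarrow> 'a) \<Rightarrow> bool" where
  "C0_flow X \<Phi> \<longleftrightarrow> continuous_action real_group euclideanreal X \<Phi>"


subsection \<open>Tori\<close>

text \<open>
  Following \<^const>\<open>Euclidean_space\<close>, an element of \<open>\<real>\<^sup>l\<close> is a function on the naturals
  that vanishes at all indices \<open>i \<ge> l\<close>.
\<close>

definition real_vec_group :: "nat \<Rightarrow> (nat \<Rightarrow> real) monoid" where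
  "real_vec_group l =
    \<lparr>carrier = topspace (Euclidean_space l), mult = (\<lambda>x y i. x i + y i), one = (\<lambda>i. 0)\<rparr>"

definition int_lattice :: "nat \<Rightarrow> (nat \<Rightarrow> real) set" where
  "int_lattice l = {x \<in> topspace (Euclidean_space l). \<forall>i. x i \<in> \<int>}"

definition torus :: "nat \<Rightarrow> (nat \<Rightarrow> real) set monoid" where
  "torus l = real_vec_group l Mod int_lattice l"

definition torus_proj :: "nat \<Rightarrow> (nat \<Rightarrow> real) \<Rightarrow> (nat \<Rightarrow> real) set" where
  "torus_proj l x = int_lattice l #>\<^bsub>real_vec_group l\<^esub> x"

text \<open>The quotient topology; see \<open>quotient_map_torus_proj\<close> below.\<close>

definition torus_topology :: "nat \<Rightarrow> (nat \<Rightarrow> real) set topology" where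
  "torus_topology l = topology (\<lambda>U. U \<subseteq> carrier (torus l) \<and>
    openin (Euclidean_space l) {x \<in> topspace (Euclidean_space l). torus_proj l x \<in> U})"

definition C0_torus_action ::
    "nat \<Rightarrow> 'a topology \<Rightarrow> ((nat \<Rightarrow> real) set \<Rightarrow> 'a \<Rightarrow> 'a) \<Rightarrow> bool" where
  "C0_torus_action l X \<Theta> \<longleftrightarrow> continuous_action (torus l) (torus_topology l) X \<Theta>"

definition finitely_many_orbit_types ::
    "nat \<Rightarrow> 'a topology \<Rightarrow> ((nat \<Rightarrow> real) set \<Rightarrow> 'a \<Rightarrow> 'a) \<Rightarrow> bool" where
  "finitely_many_orbit_types l X \<Theta> \<longleftrightarrow> finite {stabilizer (torus l) \<Theta> x | x. x \<in> topspace X}"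

definition one_parameter_subgroup ::
    "(real \<Rightarrow> 'a \<Rightarrow> 'a) \<Rightarrow> nat \<Rightarrow> ((nat \<Rightarrow> real) set \<Rightarrow> 'a \<Rightarrow> 'a) \<Rightarrow> bool" where
  "one_parameter_subgroup \<Phi> l \<Theta> \<longleftrightarrow>
    (\<exists>\<omega>\<in>topspace (Euclidean_space l). \<forall>t. \<Phi> t = \<Theta> (torus_proj l (\<lambda>i. \<omega> i * t)))"


subsection \<open>Linearizing embeddings\<close>

text \<open>The power series converges for every square matrix; see \<open>summable_mat_exp\<close> below.\<close>

definition mat_exp :: "real mat \<Rightarrow> real mat" where
  "mat_exp A = Matrix.mat (dim_row A) (dim_row A) (\<lambda>(i, j). \<Sum>k. (A ^\<^sub>m k) $$ (i, j) / fact k)"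

text \<open>The term \<^term>\<open>Matrix.vec n (F x)\<close> only converts the point \<open>F x\<close> of
  \<^term>\<open>Euclidean_space n\<close> to a vector of dimension \<open>n\<close>.\<close>

definition linearizing ::
    "'a topology \<Rightarrow> (real \<Rightarrow> 'a \<Rightarrow> 'a) \<Rightarrow> nat \<Rightarrow> ('a \<Rightarrow> nat \<Rightarrow> real) \<Rightarrow> bool" where
  "linearizing X \<Phi> n F \<longleftrightarrow>
    F \<in> topspace X \<rightarrow> topspace (Euclidean_space n) \<and>
    (\<exists>B\<in>carrier_mat n n. \<forall>t. \<forall>x\<in>topspace X.
      Matrix.vec n (F (\<Phi> t x)) = mat_exp (t \<cdot>\<^sub>m B) *\<^sub>v Matrix.vec n (F x))"

definition linearizable_by_C0_embedding :: "'a topology \<Rightarrow> (real \<Rightarrow> 'a \<Rightarrow> 'a) \<Rightarrow> bool" where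
  "linearizable_by_C0_embedding X \<Phi> \<longleftrightarrow>
    (\<exists>n F. linearizing X \<Phi> n F \<and> embedding_map X (Euclidean_space n) F)"


subsection \<open>Well-definedness\<close>

lemma comm_group_real_group: "comm_group real_group"
  unfolding real_group_def
  by (rule comm_groupI) (auto intro: exI[of _ "- _"])

lemma comm_group_real_vec_group: "comm_group (real_vec_group l)"
  unfolding real_vec_group_def topspace_Euclidean_space
proof (rule comm_groupI, goal_cases)
  case (6 x)
  then show ?case by (auto intro!: exI[of _ "\<lambda>i. - x i"])
qed (auto simp: algebra_simps)

lemma normal_int_lattice: "int_lattice l \<lhd> real_vec_group l"
proof -
  interpret comm_group "real_vec_group l" by (rule comm_group_real_vec_group)
  have "inv\<^bsub>real_vec_group l\<^esub> x = (\<lambda>i. - x i)" if "x \<in> topspace (Euclidean_space l)" for x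
    using that by (intro inv_equality) (auto simp: real_vec_group_def topspace_Euclidean_space)
  then have "subgroup (int_lattice l) (real_vec_group l)"
    by (intro subgroupI)
       (auto simp: int_lattice_def real_vec_group_def topspace_Euclidean_space
             intro!: exI[of _ "\<lambda>_. 0"])
  then show ?thesis by (rule subgroup_imp_normal)
qed

lemma group_torus: "group (torus l)"
  unfolding torus_def by (rule normal.factorgroup_is_group[OF normal_int_lattice])

lemma carrier_torus: "carrier (torus l) = torus_proj l ` topspace (Euclidean_space l)"
  by (auto simp: torus_def FactGroup_def RCOSETS_def torus_proj_def real_vec_group_def)

lemma torus_proj_eq_iff:
  assumes "x \<in> topspace (Euclidean_space l)" "y \<in> topspace (Euclidean_space l)"
  shows "torus_proj l x = torus_proj l y \<longleftrightarrow> (\<forall>i. x i - y i \<in> \<int>)"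
proof
  assume eq: "torus_proj l x = torus_proj l y"
  have "x \<in> torus_proj l x"
    unfolding torus_proj_def r_coset_def real_vec_group_def
    by (auto simp: int_lattice_def topspace_Euclidean_space intro!: bexI[of _ "\<lambda>_. 0"])
  then have "x \<in> torus_proj l y" using eq by simp
  then show "\<forall>i. x i - y i \<in> \<int>"
    by (auto simp: torus_proj_def r_coset_def real_vec_group_def int_lattice_def)
next
  have sub: "torus_proj l x \<subseteq> torus_proj l y"
    if "\<forall>i. x i - y i \<in> \<int>" "x \<in> topspace (Euclidean_space l)" "y \<in> topspace (Euclidean_space l)"
    for x y :: "nat \<Rightarrow> real"
  proof
    fix z assume "z \<in> torus_proj l x"
    then obtain h where h: "h \<in> int_lattice l" "z = (\<lambda>i. h i + x i)"
      by (auto simp: torus_proj_def r_coset_def real_vec_group_def)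
    have "(\<lambda>i. h i + (x i - y i)) \<in> int_lattice l"
      using h that by (auto simp: int_lattice_def topspace_Euclidean_space)
    moreover have "z = (\<lambda>i. (h i + (x i - y i)) + y i)" using h by simp
    ultimately show "z \<in> torus_proj l y"
      unfolding torus_proj_def r_coset_def real_vec_group_def by fastforce
  qed
  assume int: "\<forall>i. x i - y i \<in> \<int>"
  then have "\<forall>i. y i - x i \<in> \<int>" by (metis Ints_minus minus_diff_eq)
  then show "torus_proj l x = torus_proj l y"
    using int sub assms by blast
qed

lemma openin_torus_topology:
  "openin (torus_topology l) U \<longleftrightarrow> U \<subseteq> carrier (torus l) \<and>
    openin (Euclidean_space l) {x \<in> topspace (Euclidean_space l). torus_proj l x \<in> U}"
proof -
  let ?P = "\<lambda>U. {x \<in> topspace (Euclidean_space l). torus_proj l x \<in> U}"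
  have "istopology (\<lambda>U. U \<subseteq> carrier (torus l) \<and> openin (Euclidean_space l) (?P U))"
    unfolding istopology_def
  proof (intro conjI allI impI)
    fix S T assume "S \<subseteq> carrier (torus l) \<and> openin (Euclidean_space l) (?P S)"
      and "T \<subseteq> carrier (torus l) \<and> openin (Euclidean_space l) (?P T)"
    moreover have "?P (S \<inter> T) = ?P S \<inter> ?P T" by auto
    ultimately show "openin (Euclidean_space l) (?P (S \<inter> T))" by auto
  next
    fix \<K> assume "\<forall>K\<in>\<K>. K \<subseteq> carrier (torus l) \<and> openin (Euclidean_space l) (?P K)"
    moreover have "?P (\<Union>\<K>) = (\<Union>K\<in>\<K>. ?P K)" by auto
    ultimately show "openin (Euclidean_space l) (?P (\<Union>\<K>))" by auto
  qed auto
  then show ?thesis by (simp add: torus_topology_def topology_inverse')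
qed

lemma topspace_torus_topology: "topspace (torus_topology l) = carrier (torus l)"
proof -
  have "{x \<in> topspace (Euclidean_space l). torus_proj l x \<in> carrier (torus l)}
      = topspace (Euclidean_space l)"
    by (auto simp: carrier_torus)
  then have "openin (torus_topology l) (carrier (torus l))"
    by (simp add: openin_torus_topology)
  then show ?thesis
    by (meson openin_subset openin_topspace openin_torus_topology subset_antisym)
qed

lemma quotient_map_torus_proj:
  "quotient_map (Euclidean_space l) (torus_topology l) (torus_proj l)"
  by (auto simp: quotient_map_def topspace_torus_topology carrier_torus openin_torus_topology)

lemma summable_mat_exp:
  assumes A: "A \<in> carrier_mat n n" and "i < n" "j < n"
  shows "summable (\<lambda>k. (A ^\<^sub>m k) $$ (i, j) / fact k :: real)"
proof -
  define c where "c = (\<Sum>i<n. \<Sum>j<n. \<bar>A $$ (i, j)\<bar>)"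
  have le_c: "\<bar>A $$ (i, j)\<bar> \<le> c" if "i < n" "j < n" for i j
  proof -
    have "\<bar>A $$ (i, j)\<bar> \<le> (\<Sum>j<n. \<bar>A $$ (i, j)\<bar>)"
      using that by (intro member_le_sum) auto
    also have "\<dots> \<le> c" unfolding c_def
      using that by (intro member_le_sum[of i _ "\<lambda>i. \<Sum>j<n. \<bar>A $$ (i, j)\<bar>"]) (auto intro: sum_nonneg)
    finally show ?thesis .
  qed
  have c0: "0 \<le> c" unfolding c_def by (intro sum_nonneg) auto
  have bound: "\<bar>(A ^\<^sub>m k) $$ (i, j)\<bar> \<le> (n * c) ^ k" if "i < n" "j < n" for i j k
    using that
  proof (induction k arbitrary: i j)
    case 0
    then show ?case using A by (simp add: one_mat_def)
  next
    case (Suc k)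
    have P: "A ^\<^sub>m k \<in> carrier_mat n n" using A by simp
    have "(A ^\<^sub>m Suc k) $$ (i, j) = (\<Sum>m<n. (A ^\<^sub>m k) $$ (i, m) * A $$ (m, j))"
      using A P Suc.prems by (auto simp: scalar_prod_def lessThan_atLeast0)
    then have "\<bar>(A ^\<^sub>m Suc k) $$ (i, j)\<bar> \<le> (\<Sum>m<n. \<bar>(A ^\<^sub>m k) $$ (i, m) * A $$ (m, j)\<bar>)"
      by (simp only: sum_abs)
    also have "\<dots> \<le> (\<Sum>m<n. (n * c) ^ k * c)"
      unfolding abs_mult using Suc le_c c0 by (intro sum_mono mult_mono) auto
    finally show ?case by (simp add: algebra_simps)
  qed
  have "summable (\<lambda>k. inverse (fact k) * (n * c) ^ k)" by (rule summable_exp)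
  then show ?thesis
    by (rule summable_comparison_test'[where N = 0])
       (use bound[OF assms(2,3)] in \<open>auto simp: divide_simps\<close>)
qed

end

theory Submission
  imports Defs "Jordan_Normal_Form.Jordan_Normal_Form_Existence"
begin

text \<open>
  Linearizable implies torus action: in Jordan coordinates of the generator the orbits of the compact
  image are bounded in both time directions, so only purely imaginary eigenvalues and no nilpotent
  parts are visible, and the flow rotates finitely many complex coordinates. Writing the frequencies as
  integer combinations of independent ones, Kronecker's theorem shows that the torus of all the
  corresponding rotations preserves the (closed) image. The stabilizer of a point depends only on the
  set of its nonzero coordinates.

  Torus action implies linearizable: it suffices to find finitely many continuous functions that are
  multiplied by characters under the action and together separate points. Weight functions in
  abundance come from averaging, but finitely many must do. On the stratum of points with stabilizer
  \<open>K\<close>, a tuple of nonvanishing weight functions for a basis of the characters that are trivial on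
  \<open>K\<close> defines a slice, and the Euclidean coordinates of the slice point are invariant functions that
  separate orbits. So the stratum has to be covered by finitely many sets carrying such a tuple.
  Locally this is possible; the number of sets is bounded, independently of the shape of the stratum,
  because slices embed in a Euclidean space and hence have covers of bounded order. A stratum is a
  union of compact shells, and functions on every other shell can be added up with decaying
  coefficients.
\<close>

section \<open>Fourier coefficients on the circle\<close>

text \<open>Since \<open>X\<close> is just a compact set, its strata can be arbitrarily wild. Near
  points where the stabilizer jumps, a tuple of weight functions without zeros lives only on smaller
  and smaller sets, so a finite family cannot come from finitely many local constructions. What can
  be bounded is the number of colours of a cover, and the dimension of a Euclidean space containing
  \<open>X\<close> provides this bound; the manifold serves to produce such an embedding.

  New weight functions arise by one device: a function of the right weight on a closed invariant set
  is extended by Tietze and projected back to its weight by integrals over the circle factors.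
  Completeness of the characters of one circle therefore suffices as analytic input. It also shows
  that a stabilizer is cut out by the characters trivial on it, because a vector that moves a point
  is detected by some weight function.

  Torus elements are represented by vectors on which the integer lattice acts trivially, so
  subgroups, characters and orbits are handled in coordinates.\<close>

definition e2 :: "real \<Rightarrow> complex" where
  "e2 t = cis (2 * pi * t)"

lemma e2_add: "e2 (s + t) = e2 s * e2 t"
  by (simp add: e2_def cis_mult ring_distribs)

lemma e2_0 [simp]: "e2 0 = 1"
  by (simp add: e2_def)

lemma norm_e2 [simp]: "norm (e2 t) = 1"
  by (simp add: e2_def)

lemma e2_nonzero [simp]: "e2 t \<noteq> 0"
  by (simp add: e2_def)

lemma e2_minus: "e2 (- t) * e2 t = 1" "e2 t * e2 (- t) = 1"
  by (simp_all flip: e2_add)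

lemma e2_eq_1_iff: "e2 t = 1 \<longleftrightarrow> t \<in> \<int>"
proof
  assume "e2 t = 1"
  then have "cos (2 * pi * t) = 1" by (simp add: e2_def complex_eq_iff)
  then obtain n :: int where "2 * pi * t = of_int n * 2 * pi"
    by (auto simp: cos_one_2pi_int)
  then have "t = of_int n" by simp
  then show "t \<in> \<int>" by simp
next
  assume "t \<in> \<int>"
  then obtain n where "t = of_int n" by (auto elim: Ints_cases)
  then show "e2 t = 1" by (simp add: e2_def complex_eq_iff cos_one_2pi_int)
qed

lemma e2_int: "t \<in> \<int> \<Longrightarrow> e2 t = 1"
  by (simp add: e2_eq_1_iff)

lemma continuous_on_e2 [continuous_intros]:
  "continuous_on A f \<Longrightarrow> continuous_on A (\<lambda>x. e2 (f x))"
  unfolding e2_def cis_conv_exp by (intro continuous_intros)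

lemma e2_eq_iff: "e2 s = e2 t \<longleftrightarrow> s - t \<in> \<int>"
proof -
  have "e2 s = e2 (s - t) * e2 t" by (simp flip: e2_add)
  then show ?thesis by (simp flip: e2_eq_1_iff)
qed

lemma e2_surj: assumes "norm z = 1" obtains t where "z = e2 t"
proof -
  have "z = cis (Arg z)" using assms by (metis cis_Arg norm_zero sgn_div_norm
        scaleR_one div_by_1 inverse_1 zero_neq_one)
  then have "z = e2 (Arg z / (2 * pi))" by (simp add: e2_def)
  then show ?thesis using that by blast
qed

text \<open>A closed part of the compact \<open>Q\<close> has compact, hence closed, image, so
  \<open>p\<close> is a quotient map onto its image. This passes continuity from group parameters to
  orbits and slices, where a parameter cannot in general be chosen continuously.\<close>

lemma compact_quotient_continuous:
  fixes p :: "'a::topological_space \<Rightarrow> 'b::t2_space" and g :: "'b \<Rightarrow> 'c::topological_space"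
  assumes "compact Q" "continuous_on Q p" "continuous_on Q (\<lambda>t. g (p t))"
  shows "continuous_on (p ` Q) g"
  unfolding continuous_on_closed_invariant
proof (intro allI impI)
  fix B :: "'c set" assume "closed B"
  then obtain C where C: "closed C" "C \<inter> Q = (\<lambda>t. g (p t)) -` B \<inter> Q"
    using assms(3) unfolding continuous_on_closed_invariant by blast
  have "compact (C \<inter> Q)" using closed_Int_compact[OF C(1) assms(1)] .
  then have "compact (p ` (C \<inter> Q))"
    by (intro compact_continuous_image continuous_on_subset[OF assms(2)]) auto
  moreover have "p ` (C \<inter> Q) \<inter> p ` Q = g -` B \<inter> p ` Q"
    using C by auto
  ultimately show "\<exists>A. closed A \<and> A \<inter> p ` Q = g -` B \<inter> p ` Q"
    using compact_imp_closed by blast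
qed

section \<open>Trigonometric polynomials and vanishing Fourier coefficients\<close>

inductive trig_poly :: "(real \<Rightarrow> complex) \<Rightarrow> bool" where
  base: "trig_poly (\<lambda>s. c * e2 (of_int m * s))"
| add: "trig_poly f \<Longrightarrow> trig_poly g \<Longrightarrow> trig_poly (\<lambda>s. f s + g s)"

lemma trig_poly_mult_base: "trig_poly f \<Longrightarrow> trig_poly (\<lambda>s. f s * (c * e2 (of_int m * s)))"
proof (induction rule: trig_poly.induct)
  case (base d n)
  have "(\<lambda>s. d * e2 (of_int n * s) * (c * e2 (of_int m * s)))
      = (\<lambda>s. (d * c) * e2 (of_int (n + m) * s))"
    by (simp add: e2_add ring_distribs mult_ac)
  then show ?case by (metis trig_poly.base)
qed (auto simp: ring_distribs intro: trig_poly.add)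

lemma trig_poly_mult:
  assumes "trig_poly f" "trig_poly g"
  shows "trig_poly (\<lambda>s. f s * g s)"
  using assms(2)
proof (induction rule: trig_poly.induct)
  case (base c m)
  then show ?case by (rule trig_poly_mult_base[OF assms(1)])
qed (auto simp: ring_distribs intro: trig_poly.add)

lemma trig_poly_const: "trig_poly (\<lambda>s. c)"
  using trig_poly.base[of c 0] by simp

text \<open>Sums and products being covered, real-linear forms remain. Such a form is a combination
  of \<open>Re\<close> and \<open>Im\<close>, which on the circle are combinations of
  \<open>e2 s\<close> and \<open>e2 (- s)\<close>.\<close>

lemma trig_poly_real_polynomial:
  fixes p :: "complex \<Rightarrow> real"
  assumes "real_polynomial_function p"
  shows "trig_poly (\<lambda>s. of_real (p (e2 s)))"
  using assms
proof (induction rule: real_polynomial_function.induct)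
  case (linear f)
  then interpret bounded_linear f .
  have f: "f z = Re z * f 1 + Im z * f \<i>" for z
  proof -
    have "z = Re z *\<^sub>R 1 + Im z *\<^sub>R \<i>" by (simp add: complex_eq_iff)
    then show ?thesis using add[of "Re z *\<^sub>R 1" "Im z *\<^sub>R \<i>"] scale by (metis real_scaleR_def)
  qed
  have "(\<lambda>s. of_real (f (e2 s)) :: complex) =
     (\<lambda>s. ((f 1 - \<i> * f \<i>) / 2) * e2 (of_int 1 * s) + ((f 1 + \<i> * f \<i>) / 2) * e2 (of_int (-1) * s))"
    by (rule ext, subst f) (simp add: e2_def complex_eq_iff field_simps)
  then show ?case by (metis trig_poly.base trig_poly.add)
qed (auto intro: trig_poly.add trig_poly_mult trig_poly_const)

lemma continuous_UNIV_imp_integrable: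
  fixes f :: "real \<Rightarrow> 'a::banach"
  shows "continuous_on UNIV f \<Longrightarrow> f integrable_on {a..b}"
  by (rule integrable_continuous_interval) (erule continuous_on_subset, simp)

text \<open>Continuity is carried along because the induction splits the integral of a sum, for
  which both terms must be integrable.\<close>

lemma trig_poly_orthogonal:
  assumes "trig_poly h" "continuous_on UNIV g"
    and "\<And>m::int. integral {0..1} (\<lambda>s. e2 (of_int m * s) * g s) = 0"
  shows "continuous_on UNIV h \<and> integral {0..1} (\<lambda>s. h s * g s) = 0"
  using assms(1)
proof (induction rule: trig_poly.induct)
  case (base c m)
  have "integral {0..1} (\<lambda>s. c * (e2 (of_int m * s) * g s)) = 0"
    by (subst integral_mult_right) (simp add: assms(3))
  then show ?case by (auto intro!: continuous_intros simp: mult.assoc)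
next
  case (add f h)
  have "(\<lambda>s. f s * g s) integrable_on {0..1}" "(\<lambda>s. h s * g s) integrable_on {0..1}"
    using add.IH assms(2)
    by (auto intro!: continuous_UNIV_imp_integrable continuous_on_mult)
  then show ?case using add by (auto simp: ring_distribs Henstock_Kurzweil_Integration.integral_add intro!: continuous_intros)
qed

lemma periodic_int:
  fixes g :: "real \<Rightarrow> 'a"
  assumes "\<And>s. g (s + 1) = g s"
  shows "g (s + of_int m) = g s"
proof (induction m rule: int_induct[where k = 0])
  case (step1 i)
  then show ?case using assms[of "s + of_int i"] by (simp add: add_ac)
next
  case (step2 i)
  then show ?case using assms[of "s + of_int (i - 1)"] by (simp add: algebra_simps)
qed auto

lemma periodic_cong:
  fixes g :: "real \<Rightarrow> 'a"
  assumes "\<And>s. g (s + 1) = g s" "s - t \<in> \<int>"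
  shows "g s = g t"
proof -
  obtain m where "s = t + of_int m" using assms(2) by (auto elim!: Ints_cases simp: algebra_simps)
  then show ?thesis using periodic_int[of g t m] assms(1) by simp
qed

text \<open>A periodic function descends to a function \<open>q\<close> on the circle, a compact
  quotient of the unit interval. Stone-Weierstrass approximates \<open>q\<close> by a real
  polynomial in the plane, whose values on the circle form a trigonometric polynomial.\<close>

lemma trig_poly_approx:
  fixes u :: "real \<Rightarrow> real"
  assumes "continuous_on UNIV u" "\<And>s. u (s + 1) = u s" "0 < e"
  obtains h where "trig_poly h" "\<And>s. s \<in> {0..1} \<Longrightarrow> norm (of_real (u s) - h s) < e"
proof -
  \<comment> \<open>The choice may return the other end point of the interval; periodicity of
    \<open>u\<close> makes the value the same.\<close>
  define q where "q z = u (SOME s. s \<in> {0..1} \<and> e2 s = z)" for z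
  have q: "q (e2 s) = u s" if "s \<in> {0..1}" for s
  proof -
    have "(SOME t. t \<in> {0..1} \<and> e2 t = e2 s) \<in> {0..1} \<and> e2 (SOME t. t \<in> {0..1} \<and> e2 t = e2 s) = e2 s"
      by (rule someI[of _ s]) (use that in simp)
    then have "(SOME t. t \<in> {0..1} \<and> e2 t = e2 s) - s \<in> \<int>"
      using e2_eq_iff by blast
    then show ?thesis unfolding q_def by (rule periodic_cong[of u, OF assms(2)])
  qed
  have "continuous_on (e2 ` {0..1}) q"
  proof (rule compact_quotient_continuous)
    show "continuous_on {0..1} (\<lambda>t. q (e2 t))"
      by (rule continuous_on_cong[THEN iffD1, rotated -1, OF continuous_on_subset[OF assms(1)]])
        (auto simp: q)
  qed (auto intro!: continuous_intros)
  moreover have "compact (e2 ` {0..1})"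
    by (intro compact_continuous_image continuous_intros) auto
  ultimately obtain p where p: "real_polynomial_function p" "\<And>z. z \<in> e2 ` {0..1} \<Longrightarrow> \<bar>q z - p z\<bar> < e"
    using Stone_Weierstrass_real_polynomial_function[of "e2 ` {0..1}" q e] assms(3) by blast
  show ?thesis
  proof
    show "trig_poly (\<lambda>s. of_real (p (e2 s)))" by (rule trig_poly_real_polynomial[OF p(1)])
    show "norm (of_real (u s) - of_real (p (e2 s)) :: complex) < e" if "s \<in> {0..1}" for s
      using p(2)[of "e2 s"] that q[OF that] by (simp flip: of_real_diff)
  qed
qed

text \<open>Replacing \<open>u\<close> by a trigonometric polynomial changes the integral by at most
  the approximation error times a bound of \<open>g\<close>, and the trigonometric polynomial
  contributes zero.\<close>

lemma orthogonal_real_periodic: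
  fixes u :: "real \<Rightarrow> real"
  assumes "continuous_on UNIV u" "\<And>s. u (s + 1) = u s" "continuous_on UNIV g"
    and orth: "\<And>m::int. integral {0..1} (\<lambda>s. e2 (of_int m * s) * g s) = 0"
  shows "integral {0..1} (\<lambda>s. of_real (u s) * g s) = 0"
proof -
  have "compact (g ` {0..1})"
    by (intro compact_continuous_image continuous_on_subset[OF assms(3)]) auto
  then obtain B where B: "\<And>s. s \<in> {0..1} \<Longrightarrow> norm (g s) \<le> B" "B > 0"
    using compact_imp_bounded bounded_pos by (metis image_eqI)
  have "norm (integral {0..1} (\<lambda>s. of_real (u s) * g s)) \<le> e" if "e > 0" for e
  proof -
    have "0 < e / B" using that B(2) by simp
    then obtain h where h: "trig_poly h" "\<And>s. s \<in> {0..1} \<Longrightarrow> norm (of_real (u s) - h s) < e / B"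
      by (rule trig_poly_approx[OF assms(1,2)]) blast
    note h0 = trig_poly_orthogonal[OF h(1) assms(3) orth]
    have int: "(\<lambda>s. h s * g s) integrable_on {0..1}" "(\<lambda>s. of_real (u s) * g s) integrable_on {0..1}"
      using h0 assms by (auto intro!: continuous_UNIV_imp_integrable continuous_on_mult continuous_on_of_real)
    have "integral {0..1} (\<lambda>s. of_real (u s) * g s) = integral {0..1} (\<lambda>s. of_real (u s) * g s - h s * g s)"
      using int h0 by (simp add: Henstock_Kurzweil_Integration.integral_diff)
    also have "norm \<dots> \<le> e * (1 - 0)"
    proof (rule integral_bound)
      show "continuous_on {0..1} (\<lambda>s. of_real (u s) * g s - h s * g s)"
        by (rule continuous_on_subset[of UNIV])
          (use h0 assms in \<open>auto intro!: continuous_on_mult continuous_on_of_real continuous_on_diff\<close>)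
      show "norm (of_real (u s) * g s - h s * g s) \<le> e" if "s \<in> {0..1}" for s
      proof -
        have "norm (of_real (u s) * g s - h s * g s) = norm (of_real (u s) - h s) * norm (g s)"
          by (simp flip: norm_mult add: ring_distribs)
        also have "\<dots> \<le> e / B * B"
          using h(2)[OF that] B(1)[OF that] \<open>0 < e / B\<close> by (intro mult_mono) auto
        finally show ?thesis using B by simp
      qed
    qed auto
    finally show ?thesis by simp
  qed
  from this[of "norm (integral {0..1} (\<lambda>s. of_real (u s) * g s)) / 2"]
  show ?thesis by (cases "integral {0..1} (\<lambda>s. of_real (u s) * g s) = 0") auto
qed

text \<open>The real and the imaginary part of \<open>g\<close> are themselves admissible test
  functions. Testing \<open>g\<close> against its real part and taking real parts shows that the
  integral of the square of \<open>Re g\<close> is zero; likewise for \<open>Im g\<close>.\<close>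

lemma fourier_uniqueness:
  fixes g :: "real \<Rightarrow> complex"
  assumes "continuous_on UNIV g" "\<And>s. g (s + 1) = g s"
    and orth: "\<And>m::int. integral {0..1} (\<lambda>s. e2 (of_int m * s) * g s) = 0"
    and s: "s \<in> {0..1}"
  shows "g s = 0"
proof -
  have cont: "continuous_on {0..1} g" using assms(1) continuous_on_subset by blast
  have "integral {0..1} (\<lambda>s. of_real (Re (g s)) * g s) = 0"
    by (rule orthogonal_real_periodic[OF _ _ assms(1) orth])
      (simp_all only: assms(2) continuous_on_Re[OF assms(1)] continuous_on_Im[OF assms(1)])
  moreover have "(\<lambda>s. of_real (Re (g s)) * g s) integrable_on {0..1}"
    by (intro integrable_continuous_interval continuous_intros cont)
  ultimately have "((\<lambda>s. of_real (Re (g s)) * g s) has_integral 0) {0..1}"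
    by (simp add: has_integral_integral)
  from has_integral_Re[OF this] have "((\<lambda>s. (Re (g s))\<^sup>2) has_integral 0) {0..1}"
    by (simp add: power2_eq_square)
  moreover have "continuous_on {0..1} (\<lambda>s. (Re (g s))\<^sup>2)"
    by (intro continuous_intros cont)
  ultimately have "(Re (g s))\<^sup>2 = 0"
    using has_integral_0_cbox_imp_0[of 0 1 "\<lambda>s. (Re (g s))\<^sup>2" s] s by auto
  have "integral {0..1} (\<lambda>s. of_real (Im (g s)) * g s) = 0"
    by (rule orthogonal_real_periodic[OF _ _ assms(1) orth])
      (simp_all only: assms(2) continuous_on_Re[OF assms(1)] continuous_on_Im[OF assms(1)])
  moreover have "(\<lambda>s. of_real (Im (g s)) * g s) integrable_on {0..1}"
    by (intro integrable_continuous_interval continuous_intros cont)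
  ultimately have "((\<lambda>s. of_real (Im (g s)) * g s) has_integral 0) {0..1}"
    by (simp add: has_integral_integral)
  from has_integral_Im[OF this] have "((\<lambda>s. (Im (g s))\<^sup>2) has_integral 0) {0..1}"
    by (simp add: power2_eq_square)
  moreover have "continuous_on {0..1} (\<lambda>s. (Im (g s))\<^sup>2)"
    by (intro continuous_intros cont)
  ultimately have "(Im (g s))\<^sup>2 = 0"
    using has_integral_0_cbox_imp_0[of 0 1 "\<lambda>s. (Im (g s))\<^sup>2" s] s by auto
  with \<open>(Re (g s))\<^sup>2 = 0\<close> show ?thesis by (simp add: complex_eq_iff)
qed

text \<open>Only the fractional part \<open>r\<close> of \<open>t\<close> matters; the piece of the
  window \<open>{r..1 + r}\<close> beyond 1 is moved back by one period.\<close>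

lemma integral_periodic_shift:
  fixes P :: "real \<Rightarrow> complex"
  assumes "continuous_on UNIV P" "\<And>s. P (s + 1) = P s"
  shows "integral {0..1} (\<lambda>s. P (s + t)) = integral {0..1} P"
proof -
  define r where "r = frac t"
  have r: "0 \<le> r" "r \<le> 1" by (auto simp: r_def frac_lt_1 less_imp_le)
  have int: "P integrable_on {a..b}" for a b
    by (rule continuous_UNIV_imp_integrable[OF assms(1)])
  have shift: "integral {a..b} (\<lambda>s. P (s + c)) = integral {a + c..b + c} P" for a b c
    using integral_shift_Icc_real[of a b P c] by (simp add: o_def add.commute)
  have "(\<lambda>s. P (s + t)) = (\<lambda>s. P (s + r))"
    by (rule ext, rule periodic_cong[of P, OF assms(2)]) (simp add: r_def frac_def)
  then have "integral {0..1} (\<lambda>s. P (s + t)) = integral {r..1 + r} P"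
    using shift[of 0 1 r] by simp
  also have "\<dots> = integral {r..1} P + integral {1..1 + r} P"
    by (rule Henstock_Kurzweil_Integration.integral_combine[symmetric]) (use r int in auto)
  also have "integral {1..1 + r} P = integral {0..r} (\<lambda>s. P (s + 1))"
    using shift[of 0 r 1] by (simp add: add.commute)
  also have "\<dots> = integral {0..r} P" by (simp add: assms(2))
  also have "integral {r..1} P + integral {0..r} P = integral {0..1} P"
    using Henstock_Kurzweil_Integration.integral_combine[of 0 r 1 P] r int by (simp add: add.commute)
  finally show ?thesis .
qed

section \<open>Weight functions of a torus action\<close>

type_synonym pt = "nat \<Rightarrow> real"

section \<open>Vectors, integral characters and the fundamental cube\<close>

definition rvec :: "nat \<Rightarrow> pt set" where
  "rvec l = {v. \<forall>i\<ge>l. v i = 0}"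

definition axis_vec :: "nat \<Rightarrow> real \<Rightarrow> pt" where
  "axis_vec i s = (\<lambda>j. if j = i then s else 0)"

text \<open>\<open>e2 (ipair l k v)\<close> is the value at \<open>v\<close> of the torus character
  with exponent vector \<open>k\<close>. Entries of \<open>k\<close> from index \<open>l\<close> on
  are ignored, so a character does not determine its exponent vector.\<close>

definition ipair :: "nat \<Rightarrow> (nat \<Rightarrow> int) \<Rightarrow> pt \<Rightarrow> real" where
  "ipair l k v = (\<Sum>i<l. of_int (k i) * v i)"

text \<open>A compact set of representatives modulo the lattice.\<close>

definition cube :: "nat \<Rightarrow> pt set" where
  "cube l = {v \<in> rvec l. \<forall>i<l. v i \<in> {0..1}}"

lemma rvec_add: "u \<in> rvec l \<Longrightarrow> v \<in> rvec l \<Longrightarrow> (\<lambda>i. u i + v i) \<in> rvec l"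
  and rvec_diff: "u \<in> rvec l \<Longrightarrow> v \<in> rvec l \<Longrightarrow> (\<lambda>i. u i - v i) \<in> rvec l"
  and rvec_uminus: "u \<in> rvec l \<Longrightarrow> (\<lambda>i. - u i) \<in> rvec l"
  and rvec_0: "(\<lambda>i. 0) \<in> rvec l"
  and rvec_axis: "i < l \<Longrightarrow> axis_vec i s \<in> rvec l"
  by (auto simp: rvec_def axis_vec_def)

lemma ipair_add: "ipair l k (\<lambda>i. u i + v i) = ipair l k u + ipair l k v"
  and ipair_diff: "ipair l k (\<lambda>i. u i - v i) = ipair l k u - ipair l k v"
  and ipair_0: "ipair l k (\<lambda>i. 0) = 0"
  by (simp_all add: ipair_def algebra_simps sum.distrib sum_subtractf)

lemma ipair_diff_left: "ipair l (\<lambda>i. k i - k' i) v = ipair l k v - ipair l k' v"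
  by (simp add: ipair_def algebra_simps sum_subtractf)

lemma ipair_zero_left: "ipair l (\<lambda>i. 0) v = 0"
  by (simp add: ipair_def)

lemma ipair_int: "(\<And>i. v i \<in> \<int>) \<Longrightarrow> ipair l k v \<in> \<int>"
  by (auto simp: ipair_def)

lemma ipair_cong: "(\<And>i. i < l \<Longrightarrow> k i = k' i) \<Longrightarrow> ipair l k v = ipair l k' v"
  by (simp add: ipair_def)

lemma continuous_on_ipair [continuous_intros]:
  "continuous_on A f \<Longrightarrow> continuous_on A (\<lambda>x. ipair l k (f x))"
  unfolding ipair_def
  by (intro continuous_on_sum continuous_on_mult continuous_on_const) (rule continuous_on_product_then_coordinatewise)

lemma continuous_on_axis_vec [continuous_intros]:
  "continuous_on A f \<Longrightarrow> continuous_on A (\<lambda>x. axis_vec i (f x))"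
  unfolding axis_vec_def
proof (rule continuous_on_coordinatewise_then_product)
  show "continuous_on A (\<lambda>x. if j = i then f x else 0)" if "continuous_on A f" for j
    using that by (cases "j = i") auto
qed

lemma compact_box_fun:
  fixes B :: "nat \<Rightarrow> real set"
  assumes "\<And>i. compact (B i)"
  shows "compact {v. \<forall>i. v i \<in> B i}"
proof -
  have "compactin (product_topology (\<lambda>i. euclidean) UNIV) (PiE UNIV B)"
    using assms by (subst compactin_PiE) auto
  then have "compact (PiE UNIV B)" by (simp add: euclidean_product_topology)
  moreover have "PiE UNIV B = {v. \<forall>i. v i \<in> B i}" by auto
  ultimately show ?thesis by simp
qed

lemma compact_cube: "compact (cube l)"
proof -
  have "cube l = {v. \<forall>i. v i \<in> (if i < l then {0..1} else {0})}"
    by (auto simp: cube_def rvec_def not_less split: if_splits)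
  then show ?thesis by (simp only:) (rule compact_box_fun, auto)
qed

lemma cube_subset: "cube l \<subseteq> rvec l" by (auto simp: cube_def)

lemma cube_reduce:
  assumes "v \<in> rvec l"
  obtains u w where "u \<in> cube l" "w \<in> rvec l" "\<And>i. w i \<in> \<int>" "v = (\<lambda>i. u i + w i)"
proof
  show "(\<lambda>i. frac (v i)) \<in> cube l" "(\<lambda>i. of_int \<lfloor>v i\<rfloor>) \<in> rvec l"
    using assms by (auto simp: cube_def rvec_def frac_lt_1 less_imp_le)
qed (auto simp: frac_def)

text \<open>A torus action lifted to the vector group and transported to a compact subset of an
  \<open>N\<close>-dimensional Euclidean space. The number \<open>N\<close> later bounds the order
  of covers.\<close>

locale lattice_action =
  fixes l N :: nat and S :: "pt set" and \<theta> :: "pt \<Rightarrow> pt \<Rightarrow> pt"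
  assumes compact_S: "compact S"
    and S_sub: "S \<subseteq> {x. \<forall>j\<ge>N. x j = 0}"
    and act_closed: "v \<in> rvec l \<Longrightarrow> x \<in> S \<Longrightarrow> \<theta> v x \<in> S"
    and act_add: "u \<in> rvec l \<Longrightarrow> v \<in> rvec l \<Longrightarrow> x \<in> S \<Longrightarrow> \<theta> (\<lambda>i. u i + v i) x = \<theta> u (\<theta> v x)"
    and act_int: "v \<in> rvec l \<Longrightarrow> (\<And>i. v i \<in> \<int>) \<Longrightarrow> x \<in> S \<Longrightarrow> \<theta> v x = x"
    and act_cont: "continuous_on (rvec l \<times> S) (\<lambda>(v, x). \<theta> v x)"
begin

definition inv_set :: "pt set \<Rightarrow> bool" where
  "inv_set A \<longleftrightarrow> A \<subseteq> S \<and> (\<forall>v\<in>rvec l. \<forall>x\<in>A. \<theta> v x \<in> A)"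

definition weight :: "(nat \<Rightarrow> int) \<Rightarrow> pt set \<Rightarrow> (pt \<Rightarrow> complex) \<Rightarrow> bool" where
  "weight k A f \<longleftrightarrow> continuous_on A f \<and> (\<forall>v\<in>rvec l. \<forall>x\<in>A. f (\<theta> v x) = e2 (ipair l k v) * f x)"

text \<open>The preimage of the torus stabilizer under the projection; for points of
  \<open>S\<close> it contains all integer vectors.\<close>

definition stab :: "pt \<Rightarrow> pt set" where
  "stab x = {v \<in> rvec l. \<theta> v x = x}"

definition orbit_of :: "pt \<Rightarrow> pt set" where
  "orbit_of x = (\<lambda>v. \<theta> v x) ` rvec l"

lemma act_0: "x \<in> S \<Longrightarrow> \<theta> (\<lambda>i. 0) x = x"
  by (rule act_int) (auto simp: rvec_0)

lemma inv_set_S: "inv_set S"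
  by (auto simp: inv_set_def act_closed)

lemma inv_setD: "inv_set A \<Longrightarrow> v \<in> rvec l \<Longrightarrow> x \<in> A \<Longrightarrow> \<theta> v x \<in> A"
  and inv_set_sub: "inv_set A \<Longrightarrow> A \<subseteq> S"
  by (auto simp: inv_set_def)

lemma act_commute:
  assumes "u \<in> rvec l" "v \<in> rvec l" "x \<in> S"
  shows "\<theta> u (\<theta> v x) = \<theta> v (\<theta> u x)"
  using act_add[OF assms] act_add[OF assms(2,1,3)] by (simp add: add.commute)

lemma act_cancel:
  assumes "v \<in> rvec l" "x \<in> S"
  shows "\<theta> (\<lambda>i. - v i) (\<theta> v x) = x" "\<theta> v (\<theta> (\<lambda>i. - v i) x) = x"
  using act_add[OF rvec_uminus[OF assms(1)] assms] act_add[OF assms(1) rvec_uminus[OF assms(1)] assms(2)]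
    act_0[OF assms(2)] by simp_all

lemma act_eq_iff:
  assumes "u \<in> rvec l" "v \<in> rvec l" "x \<in> S"
  shows "\<theta> u x = \<theta> v x \<longleftrightarrow> (\<lambda>i. u i - v i) \<in> stab x"
proof -
  have eq: "\<theta> (\<lambda>i. u i - v i) x = \<theta> (\<lambda>i. - v i) (\<theta> u x)"
    using act_add[OF rvec_uminus[OF assms(2)] assms(1,3)] by (simp add: add.commute)
  show ?thesis
  proof
    assume "\<theta> u x = \<theta> v x"
    then show "(\<lambda>i. u i - v i) \<in> stab x"
      using eq act_cancel[OF assms(2,3)] assms by (simp add: stab_def rvec_diff)
  next
    assume "(\<lambda>i. u i - v i) \<in> stab x"
    then have "\<theta> (\<lambda>i. - v i) (\<theta> u x) = x" using eq by (simp add: stab_def)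
    then show "\<theta> u x = \<theta> v x"
      using act_cancel(2)[OF assms(2) act_closed[OF assms(1,3)]] by simp
  qed
qed

lemma act_compose_cont:
  assumes "continuous_on T g" "continuous_on T h" "g ` T \<subseteq> rvec l" "h ` T \<subseteq> S"
  shows "continuous_on T (\<lambda>t. \<theta> (g t) (h t))"
proof -
  have "continuous_on T ((\<lambda>(v, x). \<theta> v x) \<circ> (\<lambda>t. (g t, h t)))"
    by (intro continuous_on_compose continuous_on_subset[OF act_cont] continuous_intros assms)
      (use assms in auto)
  then show ?thesis by (simp add: o_def)
qed

lemma act_axis_add:
  assumes "i < l" "x \<in> S"
  shows "\<theta> (axis_vec i s) (\<theta> (axis_vec i t) x) = \<theta> (axis_vec i (s + t)) x"
proof -
  have "axis_vec i (s + t) = (\<lambda>j. axis_vec i s j + axis_vec i t j)"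
    by (auto simp: axis_vec_def)
  then show ?thesis using assms by (simp add: act_add rvec_axis)
qed

lemma act_axis_int: "i < l \<Longrightarrow> x \<in> S \<Longrightarrow> s \<in> \<int> \<Longrightarrow> \<theta> (axis_vec i s) x = x"
  by (rule act_int) (simp_all add: rvec_axis, simp add: axis_vec_def)

section \<open>Projection to weight functions by averaging over circle factors\<close>

definition avg :: "nat \<Rightarrow> int \<Rightarrow> (pt \<Rightarrow> complex) \<Rightarrow> pt \<Rightarrow> complex" where
  "avg i m f x = integral {0..1} (\<lambda>s. e2 (- (of_int m * s)) * f (\<theta> (axis_vec i s) x))"

lemma cont_along_axis:
  assumes "i < l" "inv_set A" "continuous_on A f" "x \<in> A"
  shows "continuous_on UNIV (\<lambda>s. f (\<theta> (axis_vec i s) x))"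
proof -
  have "continuous_on UNIV (\<lambda>s. \<theta> (axis_vec i s) x)"
    by (rule act_compose_cont) (use assms in \<open>auto simp: rvec_axis inv_set_def intro!: continuous_intros\<close>)
  then show ?thesis
    by (rule continuous_on_compose2[OF assms(3)]) (use assms in \<open>auto simp: inv_set_def rvec_axis\<close>)
qed

lemma avg_cont:
  assumes "i < l" "inv_set A" "continuous_on A f"
  shows "continuous_on A (avg i m f)"
proof -
  have "continuous_on (A \<times> cbox 0 1) (\<lambda>p. \<theta> (axis_vec i (snd p)) (fst p))"
    by (rule act_compose_cont)
      (use assms in \<open>auto simp: rvec_axis inv_set_def
        intro!: continuous_on_axis_vec continuous_on_fst continuous_on_snd continuous_on_id\<close>)
  then have "continuous_on (A \<times> cbox 0 1) (\<lambda>p. f (\<theta> (axis_vec i (snd p)) (fst p)))"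
    by (rule continuous_on_compose2[OF assms(3)]) (use assms in \<open>auto simp: inv_set_def rvec_axis\<close>)
  then have "continuous_on (A \<times> cbox 0 1) (\<lambda>(x, s). e2 (- (of_int m * s)) * f (\<theta> (axis_vec i s) x))"
    unfolding split_def by (intro continuous_intros)
  from integral_continuous_on_param[OF this] show ?thesis
    by (simp add: avg_def[abs_def])
qed

text \<open>\<open>avg i m f x\<close> is the \<open>m\<close>-th Fourier coefficient of
  \<open>f\<close> along the \<open>i\<close>-th circle through \<open>x\<close>. Moving
  \<open>x\<close> along this circle translates the integrand \<open>P\<close> up to a phase, and
  triviality of the lattice action makes \<open>P\<close> periodic, so its integral is translation
  invariant.\<close>

lemma avg_shift:
  assumes "i < l" "inv_set A" "continuous_on A f" "x \<in> A"
  shows "avg i m f (\<theta> (axis_vec i t) x) = e2 (of_int m * t) * avg i m f x"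
proof -
  define P where "P = (\<lambda>s. e2 (- (of_int m * s)) * f (\<theta> (axis_vec i s) x))"
  have xS: "x \<in> S" using assms by (auto simp: inv_set_def)
  have "continuous_on UNIV P"
    unfolding P_def by (intro continuous_intros cont_along_axis[OF assms])
  moreover have "P (s + 1) = P s" for s
  proof -
    have "\<theta> (axis_vec i (s + 1)) x = \<theta> (axis_vec i s) x"
      using act_axis_add[OF assms(1) xS, of s 1] act_axis_int[OF assms(1) xS, of 1] by simp
    moreover have "e2 (- (of_int m * (s + 1))) = e2 (- (of_int m * s))"
      by (simp add: e2_eq_iff algebra_simps)
    ultimately show ?thesis by (simp add: P_def)
  qed
  ultimately have *: "integral {0..1} (\<lambda>s. P (s + t)) = integral {0..1} P"
    by (rule integral_periodic_shift)
  have "e2 (- (of_int m * s)) * f (\<theta> (axis_vec i s) (\<theta> (axis_vec i t) x)) = e2 (of_int m * t) * P (s + t)" for s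
  proof -
    have "e2 (of_int m * t) * e2 (- (of_int m * (s + t))) = e2 (- (of_int m * s))"
      by (simp flip: e2_add add: algebra_simps)
    then show ?thesis
      by (simp add: P_def act_axis_add[OF assms(1) xS] flip: mult.assoc)
  qed
  then have "avg i m f (\<theta> (axis_vec i t) x) = integral {0..1} (\<lambda>s. e2 (of_int m * t) * P (s + t))"
    unfolding avg_def by simp
  also have "\<dots> = e2 (of_int m * t) * integral {0..1} P"
    by (simp add: *)
  finally show ?thesis by (simp add: avg_def P_def)
qed

text \<open>The torus is commutative, so averaging along one circle keeps equivariance that is
  already present. In \<open>Avg_props\<close> this preserves the weights obtained from the earlier
  circles.\<close>

lemma avg_equivariant:
  assumes "i < l" "inv_set A" "u \<in> rvec l" "\<And>y. y \<in> A \<Longrightarrow> f (\<theta> u y) = c * f y" "x \<in> A"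
  shows "avg i m f (\<theta> u x) = c * avg i m f x"
proof -
  have "f (\<theta> (axis_vec i s) (\<theta> u x)) = c * f (\<theta> (axis_vec i s) x)" for s
    using assms by (subst act_commute) (auto simp: rvec_axis inv_set_def)
  then show ?thesis
    unfolding avg_def by (simp add: mult.left_commute)
qed

lemma avg_fixed:
  assumes "\<And>s. f (\<theta> (axis_vec i s) x) = e2 (of_int m * s) * f x"
  shows "avg i m f x = f x"
  unfolding avg_def assms by (simp add: e2_minus flip: mult.assoc)

text \<open>The projection to weight \<open>k\<close> as an iteration of one-dimensional integrals;
  the step for axis \<open>i\<close> imposes the weight \<open>k i\<close> on that circle.\<close>

primrec Avg :: "nat \<Rightarrow> (nat \<Rightarrow> int) \<Rightarrow> (pt \<Rightarrow> complex) \<Rightarrow> pt \<Rightarrow> complex" where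
  "Avg 0 k f = f"
| "Avg (Suc n) k f = avg n (k n) (Avg n k f)"

lemma Avg_cong: "(\<And>i. i < n \<Longrightarrow> k i = k' i) \<Longrightarrow> Avg n k f = Avg n k' f"
  by (induction n) auto

lemma Avg_props:
  assumes "inv_set A" "continuous_on A f" "n \<le> l"
  shows "continuous_on A (Avg n k f) \<and>
    (\<forall>j<n. \<forall>t. \<forall>x\<in>A. Avg n k f (\<theta> (axis_vec j t) x) = e2 (of_int (k j) * t) * Avg n k f x)"
  using assms(3)
proof (induction n)
  case 0
  then show ?case using assms by simp
next
  case (Suc n)
  then have IH: "continuous_on A (Avg n k f)"
    "\<And>j t x. j < n \<Longrightarrow> x \<in> A \<Longrightarrow> Avg n k f (\<theta> (axis_vec j t) x) = e2 (of_int (k j) * t) * Avg n k f x"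
    by auto
  have n: "n < l" using Suc.prems by simp
  have "Avg (Suc n) k f (\<theta> (axis_vec j t) x) = e2 (of_int (k j) * t) * Avg (Suc n) k f x"
    if "j < Suc n" "x \<in> A" for j t x
  proof (cases "j = n")
    case True
    then show ?thesis using avg_shift[OF n assms(1) IH(1) that(2)] by simp
  next
    case False
    then have "j < n" using that by simp
    then show ?thesis
      using avg_equivariant[OF n assms(1), of "axis_vec j t" "Avg n k f" "e2 (of_int (k j) * t)" x]
        IH(2) that(2) n by (simp add: rvec_axis)
  qed
  then show ?case using avg_cont[OF n assms(1) IH(1)] by simp
qed

lemma weightI_axes:
  assumes "inv_set A" "continuous_on A f"
    and ax: "\<And>j t x. j < l \<Longrightarrow> x \<in> A \<Longrightarrow> f (\<theta> (axis_vec j t) x) = e2 (of_int (k j) * t) * f x"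
  shows "weight k A f"
  unfolding weight_def
proof (intro conjI ballI)
  fix v x assume v: "v \<in> rvec l" and x: "x \<in> A"
  \<comment> \<open>Truncations of \<open>v\<close>: each differs from the previous one by an axis
    vector, so the phases of the axes multiply up to the full character.\<close>
  define tr where "tr n = (\<lambda>i. if i < n then v i else 0)" for n
  have "f (\<theta> (tr n) x) = e2 (ipair n k v) * f x" if "n \<le> l" for n
    using that
  proof (induction n)
    case 0
    then show ?case using x assms(1) by (auto simp: tr_def ipair_def act_0 inv_set_def)
  next
    case (Suc n)
    have t: "tr n \<in> rvec l" using Suc.prems by (auto simp: tr_def rvec_def)
    have "tr (Suc n) = (\<lambda>i. axis_vec n (v n) i + tr n i)"
      by (rule ext) (auto simp: tr_def axis_vec_def less_Suc_eq)
    then have "\<theta> (tr (Suc n)) x = \<theta> (axis_vec n (v n)) (\<theta> (tr n) x)"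
      using act_add[OF rvec_axis t] Suc.prems x assms(1) by (auto simp: inv_set_def)
    then have "f (\<theta> (tr (Suc n)) x) = e2 (of_int (k n) * v n) * f (\<theta> (tr n) x)"
      using ax[of n] inv_setD[OF assms(1) t x] Suc.prems by simp
    then show ?case using Suc by (simp add: ipair_def e2_add)
  qed
  moreover have "tr l = v" using v by (auto simp: tr_def rvec_def)
  ultimately show "f (\<theta> v x) = e2 (ipair l k v) * f x" by (metis order_refl)
qed (use assms in auto)

lemma weight_Avg:
  assumes "inv_set A" "continuous_on A f"
  shows "weight k A (Avg l k f)"
  using Avg_props[OF assms order_refl] by (intro weightI_axes assms) auto

lemma ipair_axis: "i < l \<Longrightarrow> ipair l k (axis_vec i s) = of_int (k i) * s"
  by (simp add: ipair_def axis_vec_def if_distrib sum.delta cong: if_cong)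

text \<open>At points of the invariant set \<open>A\<close> the averages see only points of
  \<open>A\<close>, and there \<open>g\<close> already has the weight that is projected to.
  Agreement on \<open>A\<close> alone is what a Tietze extension offers.\<close>

lemma Avg_fixed:
  assumes "inv_set A" "x \<in> A" "weight k A f" "n \<le> l" "\<And>y. y \<in> A \<Longrightarrow> g y = f y"
  shows "Avg n k g x = f x"
  using assms(2,4)
proof (induction n arbitrary: x)
  case 0
  then show ?case using assms by simp
next
  case (Suc n)
  have IH: "Avg n k g y = f y" if "y \<in> A" for y using Suc that by simp
  have A: "\<theta> (axis_vec n s) x \<in> A" for s
    using Suc assms(1) by (simp add: inv_setD rvec_axis)
  have "avg n (k n) (Avg n k g) x = Avg n k g x"
    by (rule avg_fixed) (use IH A Suc assms(3) in \<open>simp add: weight_def rvec_axis ipair_axis\<close>)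
  then show ?case using IH Suc by simp
qed

text \<open>An equivariant Tietze theorem: averaging turns an arbitrary continuous extension into a
  weight function and, by \<open>Avg_fixed\<close>, leaves its values on \<open>A\<close>
  alone.\<close>

lemma weight_extend:
  assumes "inv_set A" "closed A" "weight k A f"
  obtains g where "weight k S g" "\<And>x. x \<in> A \<Longrightarrow> g x = f x"
proof -
  have "closedin (top_of_set S) A"
    using assms by (simp add: closed_subset inv_set_def)
  moreover have "continuous_on A f" using assms(3) by (simp add: weight_def)
  ultimately obtain h where h: "continuous_on S h" "\<And>x. x \<in> A \<Longrightarrow> h x = f x"
    using Tietze_unbounded by metis
  show ?thesis
    by (rule that[OF weight_Avg[OF inv_set_S h(1), of k] Avg_fixed[OF assms(1) _ assms(3) order_refl h(2)]])
qed

text \<open>The averages over all exponents of one axis are the Fourier coefficients of a function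
  on that circle. If they agree at \<open>x\<close> and \<open>y\<close>, the difference function
  \<open>g\<close> has zero coefficients, and \<open>g 0 = 0\<close> removes one level of
  averaging.\<close>

lemma Avg_separates:
  assumes "continuous_on S f" "x \<in> S" "y \<in> S" "n \<le> l" "\<And>k. Avg n k f x = Avg n k f y"
  shows "f x = f y"
  using assms(4,5)
proof (induction n)
  case 0
  then show ?case by simp
next
  case (Suc n)
  have n: "n < l" "n \<le> l" using Suc.prems by auto
  have "Avg n k f x = Avg n k f y" for k
  proof -
    let ?h = "Avg n k f"
    have hc: "continuous_on S ?h" using Avg_props[OF inv_set_S assms(1) n(2)] by simp
    define g where "g s = ?h (\<theta> (axis_vec n s) x) - ?h (\<theta> (axis_vec n s) y)" for s
    note cx = cont_along_axis[OF n(1) inv_set_S hc assms(2)]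
      and cy = cont_along_axis[OF n(1) inv_set_S hc assms(3)]
    have "g 0 = 0"
    proof (rule fourier_uniqueness)
      show "continuous_on UNIV g" unfolding g_def by (intro continuous_intros cx cy)
      have "\<theta> (axis_vec n (s + 1)) z = \<theta> (axis_vec n s) z" if "z \<in> S" for s z
        using act_axis_add[OF n(1) that, of s 1] act_axis_int[OF n(1) that, of 1] by simp
      then show "g (s + 1) = g s" for s using assms by (simp add: g_def)
      show "integral {0..1} (\<lambda>s. e2 (of_int m * s) * g s) = 0" for m
      proof -
        have int: "(\<lambda>s. e2 (of_int m * s) * ?h (\<theta> (axis_vec n s) z)) integrable_on {0..1}" if "z \<in> S" for z
          by (intro continuous_UNIV_imp_integrable continuous_intros cont_along_axis[OF n(1) inv_set_S hc that])
        \<comment> \<open>The sign is reversed because \<open>avg\<close> integrates against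
          \<open>e2 (- (m * s))\<close>, whereas \<open>fourier_uniqueness\<close> tests with
          \<open>e2 (m * s)\<close>. The lower averages do not depend on entry \<open>n\<close> of
          \<open>k\<close>.\<close>
        have "Avg (Suc n) (fun_upd k n (- m)) f z = avg n (- m) ?h z" for z
          using Avg_cong[of n "fun_upd k n (- m)" k f] by simp
        then have "avg n (- m) ?h x = avg n (- m) ?h y" using Suc.prems by metis
        then have "integral {0..1} (\<lambda>s. e2 (of_int m * s) * ?h (\<theta> (axis_vec n s) x)) =
            integral {0..1} (\<lambda>s. e2 (of_int m * s) * ?h (\<theta> (axis_vec n s) y))"
          by (simp add: avg_def)
        then show ?thesis
          using int assms by (simp add: g_def ring_distribs Henstock_Kurzweil_Integration.integral_diff)
      qed
    qed auto
    then show ?thesis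
      using act_axis_int[OF n(1), of _ 0] assms by (simp add: g_def)
  qed
  then show ?case using Suc.IH n by blast
qed

text \<open>If a coordinate function differs at the two points, so does one of its averages.\<close>

lemma weight_separates:
  assumes "x \<in> S" "y \<in> S" "x \<noteq> y"
  obtains k f where "weight k S f" "f x \<noteq> f y"
proof -
  obtain j where j: "x j \<noteq> y j" using assms(3) by auto
  let ?c = "\<lambda>x. of_real (x j) :: complex"
  have c: "continuous_on S ?c"
    by (rule continuous_on_of_real[OF continuous_on_product_then_coordinatewise[OF continuous_on_id]])
  have "\<exists>k. Avg l k ?c x \<noteq> Avg l k ?c y"
  proof (rule ccontr)
    assume "\<not> ?thesis"
    then have "?c x = ?c y" by (intro Avg_separates[OF c assms(1,2) order_refl]) simp
    then show False using j by simp
  qed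
  then show ?thesis using that weight_Avg[OF inv_set_S c] by blast
qed

end

section \<open>Bases of character groups and slices\<close>

definition int_module :: "(nat \<Rightarrow> int) set \<Rightarrow> bool" where
  "int_module P \<longleftrightarrow> (\<lambda>i. 0) \<in> P \<and> (\<forall>k\<in>P. \<forall>k'\<in>P. (\<lambda>i. k i - k' i) \<in> P)"

lemma int_module_diff: "int_module P \<Longrightarrow> k \<in> P \<Longrightarrow> k' \<in> P \<Longrightarrow> (\<lambda>i. k i - k' i) \<in> P"
  by (simp add: int_module_def)

lemma int_module_add:
  assumes "int_module P" "k \<in> P" "k' \<in> P"
  shows "(\<lambda>i. k i + k' i) \<in> P"
proof -
  have "(\<lambda>i. 0 - k' i) \<in> P" using assms int_module_diff[of P "\<lambda>i. 0" k'] by (simp add: int_module_def)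
  from int_module_diff[OF assms(1,2) this] show ?thesis by simp
qed

lemma int_module_mult:
  assumes "int_module P" "k \<in> P"
  shows "(\<lambda>i. q * k i) \<in> P"
proof (induction q rule: int_induct[where k = 0])
  case base
  then show ?case using assms by (simp add: int_module_def)
next
  case (step1 q)
  from int_module_add[OF assms(1) step1(2) assms(2)] show ?case by (simp add: algebra_simps)
next
  case (step2 q)
  from int_module_diff[OF assms(1) step2(2) assms(2)] show ?case by (simp add: algebra_simps)
qed

text \<open>The generators are found in echelon form, which is what makes them jointly solvable.\<close>

lemma int_module_basis:
  assumes "int_module L" "\<And>k i. k \<in> L \<Longrightarrow> i \<ge> l \<Longrightarrow> k i = 0"
  shows "\<exists>G. finite G \<and> G \<subseteq> L \<and> (\<forall>P. int_module P \<longrightarrow> G \<subseteq> P \<longrightarrow> L \<subseteq> P) \<and>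
    (\<forall>\<alpha>::(nat \<Rightarrow> int) \<Rightarrow> real. \<exists>v\<in>rvec l. \<forall>k\<in>G. ipair l k v = \<alpha> k)"
  using assms
proof (induction l arbitrary: L)
  case 0
  have "k \<in> L \<Longrightarrow> k = (\<lambda>i. 0)" for k using 0(2) by auto
  then show ?case by (intro exI[of _ "{}"]) (auto simp: int_module_def rvec_def)
next
  case (Suc l)
  define L' where "L' = {k \<in> L. k l = 0}"
  have "int_module L'" using Suc.prems(1) by (auto simp: int_module_def L'_def)
  moreover have "k i = 0" if "k \<in> L'" "i \<ge> l" for k i
    using that Suc.prems(2)[of k i] by (cases "i = l") (auto simp: L'_def)
  ultimately obtain G' where G': "finite G'" "G' \<subseteq> L'" "\<And>P. int_module P \<Longrightarrow> G' \<subseteq> P \<Longrightarrow> L' \<subseteq> P"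
     "\<And>\<alpha>::(nat \<Rightarrow> int) \<Rightarrow> real. \<exists>v\<in>rvec l. \<forall>k\<in>G'. ipair l k v = \<alpha> k"
    using Suc.IH[of L'] by blast
  have ip: "ipair (Suc l) k v = ipair l k v + of_int (k l) * v l" for k and v :: "nat \<Rightarrow> real"
    by (simp add: ipair_def)
  show ?case
  proof (cases "L' = L")
    case True
    have "\<exists>v\<in>rvec (Suc l). \<forall>k\<in>G'. ipair (Suc l) k v = \<alpha> k" for \<alpha>
    proof -
      obtain v where "v \<in> rvec l" "\<forall>k\<in>G'. ipair l k v = \<alpha> k" using G'(4) by blast
      then show ?thesis
        using G'(2) by (intro bexI[of _ v]) (auto simp: ip L'_def rvec_def)
    qed
    then show ?thesis using G' True by (intro exI[of _ G']) auto
  next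
    case False
    then obtain k1 where k1: "k1 \<in> L" "k1 l \<noteq> 0" by (auto simp: L'_def)
    have "\<exists>n>0. \<exists>k\<in>L. k l = int n"
    proof (cases "k1 l > 0")
      case True
      then show ?thesis using k1 by (intro exI[of _ "nat (k1 l)"]) auto
    next
      case False
      from int_module_mult[OF Suc.prems(1) k1(1), of "-1"] False k1(2)
      show ?thesis by (intro exI[of _ "nat (- k1 l)"]) auto
    qed
    then have ex: "\<exists>n. n > 0 \<and> (\<exists>k\<in>L. k l = int n)" by blast
    \<comment> \<open>The last entries of members of \<open>L\<close> form a subgroup of the
      integers. Its least positive element \<open>d\<close> divides all of them, so subtracting a
      multiple of \<open>k0\<close> lands in \<open>L'\<close>.\<close>
    define d where "d = (LEAST n. n > 0 \<and> (\<exists>k\<in>L. k l = int n))"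
    from LeastI_ex[OF ex] obtain k0 where d: "d > 0" and k0: "k0 \<in> L" "k0 l = int d"
      by (auto simp: d_def)
    have dmin: "\<not> (n > 0 \<and> (\<exists>k\<in>L. k l = int n))" if "n < d" for n
      using not_less_Least[of n "\<lambda>n. n > 0 \<and> (\<exists>k\<in>L. k l = int n)"] that by (simp add: d_def)
    have rem: "(\<lambda>i. k i - (k l div int d) * k0 i) \<in> L'" if "k \<in> L" for k
    proof -
      let ?r = "\<lambda>i. k i - (k l div int d) * k0 i"
      have rL: "?r \<in> L"
        by (rule int_module_diff[OF Suc.prems(1) that int_module_mult[OF Suc.prems(1) k0(1)]])
      have rl: "?r l = k l mod int d" by (simp add: k0 minus_div_mult_eq_mod)
      have "k l mod int d = int (nat (k l mod int d))" "nat (k l mod int d) < d"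
        using d by (auto simp: nat_less_iff)
      then have "nat (k l mod int d) = 0" using dmin[of "nat (k l mod int d)"] rL rl by auto
      then show ?thesis using rL rl d by (simp add: L'_def order_antisym)
    qed
    have gen: "L \<subseteq> P" if P: "int_module P" "insert k0 G' \<subseteq> P" for P
    proof
      fix k assume k: "k \<in> L"
      have "(\<lambda>i. k i - (k l div int d) * k0 i) \<in> P" using rem[OF k] G'(3)[OF P(1)] P(2) by blast
      moreover have "(\<lambda>i. (k l div int d) * k0 i) \<in> P" using int_module_mult[OF P(1)] P(2) by simp
      ultimately have "(\<lambda>i. (k i - (k l div int d) * k0 i) + (k l div int d) * k0 i) \<in> P"
        by (rule int_module_add[OF P(1)])
      then show "k \<in> P" by simp
    qed
    have "\<exists>v\<in>rvec (Suc l). \<forall>k\<in>insert k0 G'. ipair (Suc l) k v = \<alpha> k" for \<alpha>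
    proof -
      obtain v where v: "v \<in> rvec l" "\<forall>k\<in>G'. ipair l k v = \<alpha> k" using G'(4) by blast
      \<comment> \<open>The echelon form at work: members of \<open>G'\<close> have last entry 0 and
        do not see the new coordinate, which is thus free to solve the equation of
        \<open>k0\<close>, whose last entry is \<open>d\<close>.\<close>
      define w where "w = fun_upd v l ((\<alpha> k0 - ipair l k0 v) / real d)"
      have "ipair l k w = ipair l k v" for k by (simp add: ipair_def w_def)
      moreover have "w \<in> rvec (Suc l)" using v by (auto simp: w_def rvec_def)
      ultimately show ?thesis
        using v G'(2) k0 d by (intro bexI[of _ w]) (auto simp: ip L'_def w_def)
    qed
    moreover have "insert k0 G' \<subseteq> L" using G'(2) k0 by (auto simp: L'_def)
    ultimately show ?thesis using G'(1) gen by (intro exI[of _ "insert k0 G'"]) auto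
  qed
qed

section \<open>Bases of the characters trivial on a stabilizer\<close>

context lattice_action
begin

text \<open>The characters in \<open>G\<close> are coordinates on the quotient torus by \<open>K\<close>.\<close>

definition basis_for :: "pt set \<Rightarrow> (nat \<Rightarrow> int) set \<Rightarrow> bool" where
  "basis_for K G \<longleftrightarrow> finite G \<and> (\<forall>k\<in>G. \<forall>v\<in>K. ipair l k v \<in> \<int>) \<and>
    (\<forall>v\<in>rvec l. (\<forall>k\<in>G. ipair l k v \<in> \<int>) \<longrightarrow> v \<in> K) \<and>
    (\<forall>\<alpha>::(nat \<Rightarrow> int) \<Rightarrow> real. \<exists>v\<in>rvec l. \<forall>k\<in>G. ipair l k v = \<alpha> k)"

lemma stab_weight:
  assumes "weight k A f" "x \<in> A" "f x \<noteq> 0" "v \<in> stab x"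
  shows "ipair l k v \<in> \<int>"
  using assms by (auto simp: weight_def stab_def e2_eq_1_iff) (metis mult_cancel_right1 e2_eq_1_iff)

text \<open>\<open>L\<close> is the annihilator of the stabilizer, and the point is that it has no
  further common zeros. A vector \<open>v\<close> that moves \<open>x\<close> is detected by a
  weight function with different values at \<open>x\<close> and \<open>\<theta> v x\<close>; this
  function is nonzero at \<open>x\<close>, so its character lies in \<open>L\<close>, yet it is
  nontrivial at \<open>v\<close>.\<close>

lemma basis_for_exists:
  assumes x: "x \<in> S"
  obtains G where "basis_for (stab x) G"
proof -
  define L where "L = {k. (\<forall>i\<ge>l. k i = 0) \<and> (\<forall>v\<in>stab x. ipair l k v \<in> \<int>)}"
  have "int_module L"
    by (auto simp: int_module_def L_def ipair_diff_left ipair_zero_left)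
  moreover have "k i = 0" if "k \<in> L" "i \<ge> l" for k i using that by (simp add: L_def)
  ultimately obtain G where G: "finite G" "G \<subseteq> L" "\<And>P. int_module P \<Longrightarrow> G \<subseteq> P \<Longrightarrow> L \<subseteq> P"
     "\<And>\<alpha>::(nat \<Rightarrow> int) \<Rightarrow> real. \<exists>v\<in>rvec l. \<forall>k\<in>G. ipair l k v = \<alpha> k"
    using int_module_basis[of L l] by blast
  have "v \<in> stab x" if v: "v \<in> rvec l" "\<forall>k\<in>G. ipair l k v \<in> \<int>" for v
  proof (rule ccontr)
    assume "v \<notin> stab x"
    then have "\<theta> v x \<noteq> x" using v by (simp add: stab_def)
    then obtain k f where f: "weight k S f" "f (\<theta> v x) \<noteq> f x"
      using weight_separates[OF act_closed[OF v(1) x] x] by metis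
    then have e: "e2 (ipair l k v) * f x \<noteq> f x" using x v by (auto simp: weight_def)
    \<comment> \<open>Members of \<open>L\<close> have to vanish from index \<open>l\<close> on;
      truncating \<open>k\<close> does not change the pairing.\<close>
    define k' where "k' i = (if i < l then k i else 0)" for i
    have k': "ipair l k' = ipair l k" by (auto simp: ipair_def k'_def)
    have "f x \<noteq> 0" using e by auto
    then have "k' \<in> L" using stab_weight[OF f(1) x] by (auto simp: L_def k') (auto simp: k'_def)
    moreover have "int_module {k. ipair l k v \<in> \<int>}"
      by (auto simp: int_module_def ipair_diff_left ipair_zero_left)
    then have "L \<subseteq> {k. ipair l k v \<in> \<int>}" using G(3) v(2) by blast
    ultimately have "ipair l k v \<in> \<int>" by (auto simp: k')
    then show False using e by (simp add: e2_int)
  qed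
  moreover have "\<forall>k\<in>G. \<forall>v\<in>stab x. ipair l k v \<in> \<int>" using G(2) by (auto simp: L_def)
  ultimately have "basis_for (stab x) G" using G(1,4) by (auto simp: basis_for_def)
  then show ?thesis by (rule that)
qed

lemma stab_act: "u \<in> rvec l \<Longrightarrow> x \<in> S \<Longrightarrow> stab (\<theta> u x) = stab x"
  unfolding stab_def using act_commute act_cancel(1) act_closed by (metis (no_types, lifting))

lemma orbit_of_cube: "x \<in> S \<Longrightarrow> orbit_of x = (\<lambda>v. \<theta> v x) ` cube l"
proof (intro equalityI subsetI)
  fix y assume x: "x \<in> S" and "y \<in> orbit_of x"
  then obtain v where v: "v \<in> rvec l" "y = \<theta> v x" by (auto simp: orbit_of_def)
  obtain u w where uw: "u \<in> cube l" "w \<in> rvec l" "\<And>i. w i \<in> \<int>" "v = (\<lambda>i. u i + w i)"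
    using cube_reduce[OF v(1)] by metis
  then have "y = \<theta> u x" using v x cube_subset[of l] by (simp add: act_add act_int subset_iff)
  then show "y \<in> (\<lambda>v. \<theta> v x) ` cube l" using uw by blast
qed (use cube_subset in \<open>auto simp: orbit_of_def\<close>)

lemma inv_set_orbit: "x \<in> S \<Longrightarrow> inv_set (orbit_of x)"
  by (auto simp: inv_set_def orbit_of_def act_closed simp flip: act_add intro!: rvec_add)

lemma compact_orbit: "x \<in> S \<Longrightarrow> compact (orbit_of x)"
  unfolding orbit_of_cube
  by (intro compact_continuous_image compact_cube act_compose_cont)
     (use cube_subset in \<open>auto intro: continuous_intros\<close>)

text \<open>A character trivial on the stabilizer descends to a function on the orbit. The orbit is
  a compact quotient of \<open>cube l\<close>, so the function is continuous, and being a weight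
  function on a closed invariant set it extends to \<open>S\<close>.\<close>

lemma weight_nonzero_exists:
  assumes x: "x \<in> S" and k: "\<And>v. v \<in> stab x \<Longrightarrow> ipair l k v \<in> \<int>"
  obtains f where "weight k S f" "f x \<noteq> 0"
proof -
  define f where "f y = e2 (ipair l k (SOME v. v \<in> rvec l \<and> \<theta> v x = y))" for y
  have f: "f (\<theta> v x) = e2 (ipair l k v)" if "v \<in> rvec l" for v
  proof -
    define w where "w = (SOME w. w \<in> rvec l \<and> \<theta> w x = \<theta> v x)"
    have "w \<in> rvec l \<and> \<theta> w x = \<theta> v x" unfolding w_def by (rule someI[of _ v]) (use that in simp)
    then have "(\<lambda>i. w i - v i) \<in> stab x" using act_eq_iff that x by blast
    then have "e2 (ipair l k w) = e2 (ipair l k v)"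
      using k[of "\<lambda>i. w i - v i"] by (simp add: e2_eq_iff ipair_diff)
    then show ?thesis by (simp add: f_def w_def)
  qed
  have "continuous_on ((\<lambda>v. \<theta> v x) ` cube l) f"
  proof (rule compact_quotient_continuous)
    show "continuous_on (cube l) (\<lambda>v. \<theta> v x)"
      by (rule act_compose_cont) (use x cube_subset in \<open>auto intro: continuous_intros\<close>)
    show "continuous_on (cube l) (\<lambda>v. f (\<theta> v x))"
      by (rule continuous_on_cong[THEN iffD1, rotated -1, of _ "\<lambda>v. e2 (ipair l k v)"])
        (use f cube_subset[THEN subsetD] in \<open>auto intro!: continuous_on_e2 continuous_on_ipair continuous_on_id\<close>)
  qed (rule compact_cube)
  then have "weight k (orbit_of x) f"
    unfolding weight_def
    by (auto simp: orbit_of_cube[OF x, symmetric])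
       (auto simp: orbit_of_def f ipair_add e2_add rvec_add x simp flip: act_add)
  then obtain g where g: "weight k S g" "\<And>y. y \<in> orbit_of x \<Longrightarrow> g y = f y"
    using weight_extend[OF inv_set_orbit[OF x] compact_imp_closed[OF compact_orbit[OF x]]] by metis
  have "x \<in> orbit_of x" using act_0[OF x] rvec_0 by (force simp: orbit_of_def)
  then have "g x \<noteq> 0" using g(2) by (simp add: f_def)
  then show ?thesis using that g by blast
qed

text \<open>For weight functions the left side is the value of \<open>f k\<close> at
  \<open>\<theta> v x\<close>: the shift by \<open>v\<close> makes all these values real and
  nonnegative.\<close>

definition slice_shift :: "(nat \<Rightarrow> int) set \<Rightarrow> ((nat \<Rightarrow> int) \<Rightarrow> pt \<Rightarrow> complex) \<Rightarrow> pt \<Rightarrow> pt \<Rightarrow> bool" where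
  "slice_shift G f x v \<longleftrightarrow> (\<forall>k\<in>G. e2 (ipair l k v) * f k x = of_real (norm (f k x)))"

text \<open>The unique point of the orbit of \<open>x\<close> at which all functions \<open>f k\<close> take positive values.\<close>

definition slice :: "(nat \<Rightarrow> int) set \<Rightarrow> ((nat \<Rightarrow> int) \<Rightarrow> pt \<Rightarrow> complex) \<Rightarrow> pt \<Rightarrow> pt" where
  "slice G f x = \<theta> (SOME v. v \<in> rvec l \<and> slice_shift G f x v) x"

text \<open>Each \<open>k\<close> in \<open>G\<close> prescribes a phase for
  \<open>e2 (ipair l k v)\<close>. The joint solvability contained in \<open>basis_for\<close>
  realises all these phases by one vector.\<close>

lemma slice_shift_exists:
  assumes "basis_for K G" "\<And>k. k \<in> G \<Longrightarrow> f k x \<noteq> 0"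
  obtains v where "v \<in> rvec l" "slice_shift G f x v"
proof -
  have "\<exists>t. k \<in> G \<longrightarrow> of_real (norm (f k x)) / f k x = e2 t" for k
  proof (cases "k \<in> G")
    case True
    then have "norm (of_real (norm (f k x)) / f k x) = 1" using assms(2) by (simp add: norm_divide)
    then show ?thesis using e2_surj by metis
  qed auto
  then obtain \<alpha> where \<alpha>: "\<And>k. k \<in> G \<Longrightarrow> of_real (norm (f k x)) / f k x = e2 (\<alpha> k)" by metis
  obtain v where "v \<in> rvec l" "\<forall>k\<in>G. ipair l k v = \<alpha> k"
    using assms(1) unfolding basis_for_def by blast
  then show ?thesis using \<alpha> assms(2) by (intro that[of v]) (auto simp: slice_shift_def divide_simps)
qed

text \<open>Two shifts differ by a vector whose pairings with \<open>G\<close> are integers; for a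
  basis this means that the difference fixes \<open>x\<close>. Hence the choice in
  \<open>slice\<close> does not matter.\<close>

lemma slice_unique:
  assumes "basis_for (stab x) G" "x \<in> S" "\<And>k. k \<in> G \<Longrightarrow> f k x \<noteq> 0" "v \<in> rvec l" "slice_shift G f x v"
  shows "slice G f x = \<theta> v x"
proof -
  define w where "w = (SOME w. w \<in> rvec l \<and> slice_shift G f x w)"
  have w: "w \<in> rvec l" "slice_shift G f x w"
    using someI[of "\<lambda>w. w \<in> rvec l \<and> slice_shift G f x w" v] assms by (auto simp: w_def)
  have "ipair l k (\<lambda>i. w i - v i) \<in> \<int>" if "k \<in> G" for k
  proof -
    have "e2 (ipair l k w) * f k x = e2 (ipair l k v) * f k x"
      using w(2) assms(5) that by (simp add: slice_shift_def)
    then show ?thesis using assms(3)[OF that] by (simp add: e2_eq_iff ipair_diff)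
  qed
  then have "(\<lambda>i. w i - v i) \<in> stab x"
    using assms(1,4) w(1) rvec_diff unfolding basis_for_def by blast
  then show ?thesis using act_eq_iff[OF w(1) assms(4,2)] by (simp add: slice_def w_def)
qed

lemma slice_in_orbit:
  assumes "basis_for (stab x) G" "x \<in> S" "\<And>k. k \<in> G \<Longrightarrow> f k x \<noteq> 0"
  shows "slice G f x \<in> orbit_of x"
proof -
  obtain v where v: "v \<in> rvec l" "slice_shift G f x v" using slice_shift_exists assms by metis
  then have "slice G f x = \<theta> v x" by (intro slice_unique assms)
  then show ?thesis using v by (auto simp: orbit_of_def)
qed

text \<open>A shift \<open>v\<close> for \<open>\<theta> u x\<close> gives the shift
  \<open>v + u\<close> for \<open>x\<close>, and both lead to the same point.\<close>

lemma slice_inv: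
  assumes "basis_for (stab x) G" "x \<in> S" "\<And>k. k \<in> G \<Longrightarrow> f k x \<noteq> 0" "u \<in> rvec l"
    and eq: "\<And>k. k \<in> G \<Longrightarrow> f k (\<theta> u x) = e2 (ipair l k u) * f k x"
  shows "slice G f (\<theta> u x) = slice G f x"
proof -
  have nz: "f k (\<theta> u x) \<noteq> 0" if "k \<in> G" for k using assms(3) eq that by simp
  obtain v where v: "v \<in> rvec l" "slice_shift G f (\<theta> u x) v"
    using slice_shift_exists[of "stab x" G f "\<theta> u x"] assms(1) nz by metis
  have "slice_shift G f x (\<lambda>i. v i + u i)"
    using v(2) eq by (auto simp: slice_shift_def ipair_add e2_add norm_mult mult.assoc)
  then have "slice G f x = \<theta> (\<lambda>i. v i + u i) x"
    by (intro slice_unique assms rvec_add v)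
  moreover have "slice G f (\<theta> u x) = \<theta> v (\<theta> u x)"
    using assms by (intro slice_unique v nz) (auto simp: stab_act act_closed)
  ultimately show ?thesis using v assms by (simp add: act_add)
qed

text \<open>The shift itself need not depend continuously on \<open>x\<close>. But the set
  \<open>Q\<close> of all pairs of a shift in the cube and a point is compact and projects onto
  \<open>D\<close>, and on \<open>Q\<close> the slice point is \<open>\<theta> v x\<close>, which is
  continuous; \<open>compact_quotient_continuous\<close> brings this down to
  \<open>D\<close>.\<close>

lemma slice_cont:
  assumes G: "basis_for K G" and D: "compact D" "D \<subseteq> S" "\<And>x. x \<in> D \<Longrightarrow> stab x = K"
    and f: "\<And>k. k \<in> G \<Longrightarrow> continuous_on D (f k)" "\<And>k x. k \<in> G \<Longrightarrow> x \<in> D \<Longrightarrow> f k x \<noteq> 0"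
  shows "continuous_on D (slice G f)"
proof -
  define h where "h k p = e2 (ipair l k (fst p)) * f k (snd p) - of_real (norm (f k (snd p)))" for k p
  define Q where "Q = (cube l \<times> D) \<inter> (\<Inter>k\<in>G. {p \<in> cube l \<times> D. h k p = 0})"
  have cl: "closed (cube l \<times> D)" "compact (cube l \<times> D)"
    using compact_cube D by (auto intro: compact_Times compact_imp_closed)
  have "continuous_on (cube l \<times> D) (h k)" if "k \<in> G" for k
  proof -
    have "continuous_on (cube l \<times> D) (\<lambda>p. f k (snd p))"
      by (rule continuous_on_compose2[OF f(1)[OF that] continuous_on_snd[OF continuous_on_id]]) auto
    then show ?thesis unfolding h_def
      by (intro continuous_on_diff continuous_on_mult continuous_on_e2 continuous_on_ipair
        continuous_on_of_real continuous_on_norm continuous_on_fst continuous_on_id)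
  qed
  then have "closed {p \<in> cube l \<times> D. h k p = 0}" if "k \<in> G" for k
    using that by (intro continuous_closed_preimage_constant cl(1))
  then have "compact Q" unfolding Q_def by (intro compact_Int_closed closed_INT cl(2)) auto
  have Q: "(v, x) \<in> Q \<longleftrightarrow> v \<in> cube l \<and> x \<in> D \<and> slice_shift G f x v" for v x
    by (auto simp: Q_def h_def slice_shift_def)
  have "snd ` Q = D"
  proof (intro equalityI subsetI)
    fix x assume x: "x \<in> D"
    obtain v where v: "v \<in> rvec l" "slice_shift G f x v"
      by (rule slice_shift_exists[OF G, of f x]) (use f(2) x in auto)
    obtain u w where uw: "u \<in> cube l" "w \<in> rvec l" "\<And>i. w i \<in> \<int>" "v = (\<lambda>i. u i + w i)"
      using cube_reduce[OF v(1)] by metis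
    have "e2 (ipair l k v) = e2 (ipair l k u)" for k
      by (simp add: uw(4) ipair_add e2_eq_iff ipair_int uw(3))
    then have "(u, x) \<in> Q" using uw(1) v(2) x by (simp add: Q slice_shift_def)
    then show "x \<in> snd ` Q" by force
  qed (auto simp: Q_def)
  moreover have "continuous_on (snd ` Q) (slice G f)"
  proof (rule compact_quotient_continuous[OF \<open>compact Q\<close>])
    have "slice G f (snd p) = \<theta> (fst p) (snd p)" if "p \<in> Q" for p
    proof -
      have p: "fst p \<in> cube l" "snd p \<in> D" "slice_shift G f (snd p) (fst p)"
        using that Q[of "fst p" "snd p"] by auto
      show ?thesis
        by (rule slice_unique) (use p G D f(2) cube_subset[THEN subsetD] in auto)
    qed
    moreover have "continuous_on Q (\<lambda>p. \<theta> (fst p) (snd p))"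
      by (rule act_compose_cont)
        (use Q cube_subset[THEN subsetD] D in \<open>auto intro: continuous_on_fst continuous_on_snd continuous_on_id\<close>)
    ultimately show "continuous_on Q (\<lambda>p. slice G f (snd p))"
      by (simp cong: continuous_on_cong)
  qed (intro continuous_on_snd continuous_on_id)
  ultimately show ?thesis by simp
qed

end

section \<open>Refinements of bounded order\<close>

text \<open>The metric adds truncated coordinate distances with weights \<open>(1/2)^n\<close>, and
  these weights sum to 2.\<close>

lemma dist_fun_le:
  fixes x y :: pt
  assumes "\<And>j. \<bar>x j - y j\<bar> \<le> e"
  shows "dist x y \<le> 2 * e"
proof -
  have e: "0 \<le> e" using assms[of 0] by linarith
  have "dist x y = (\<Sum>n. (1/2)^n * min (dist (x (from_nat n)) (y (from_nat n))) 1)"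
    by (rule dist_fun_def)
  also have "\<dots> \<le> (\<Sum>n. e * (1/2)^n)"
  proof (rule suminf_le)
    show "summable (\<lambda>n. e * (1/2::real)^n)" by (intro summable_mult summable_geometric) simp
    show le: "(1/2)^n * min (dist (x (from_nat n)) (y (from_nat n))) 1 \<le> e * (1/2)^n" for n
    proof -
      have "min (dist (x (from_nat n)) (y (from_nat n))) 1 \<le> e"
        using assms[of "from_nat n"] by (simp add: dist_real_def min.coboundedI1)
      then show ?thesis by simp
    qed
    show "summable (\<lambda>n. (1/2)^n * min (dist (x (from_nat n)) (y (from_nat n))) 1)"
      by (rule summable_comparison_test'[OF \<open>summable (\<lambda>n. e * (1/2::real)^n)\<close>, of 0])
        (use le in auto)
  qed
  also have "\<dots> = e * 2"
    by (subst suminf_mult) (auto simp: suminf_geometric intro: summable_geometric)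
  finally show ?thesis by simp
qed

lemma compact_positive_bound:
  fixes g :: "'a::topological_space \<Rightarrow> real"
  assumes "compact T" "continuous_on T g" "\<And>x. x \<in> T \<Longrightarrow> g x > 0"
  obtains c where "c > 0" "\<And>x. x \<in> T \<Longrightarrow> c \<le> g x"
proof (cases "T = {}")
  case True
  then show ?thesis using that[of 1] by auto
next
  case False
  then obtain x where "x \<in> T" "\<And>y. y \<in> T \<Longrightarrow> g x \<le> g y"
    using continuous_attains_inf[OF assms(1) False assms(2)] by blast
  then show ?thesis using that[of "g x"] assms(3) by blast
qed

lemma compact_family_positive_bound:
  fixes \<phi> :: "'i \<Rightarrow> 'a::topological_space \<Rightarrow> real"
  assumes "compact T" "finite I" "\<And>b. b \<in> I \<Longrightarrow> continuous_on T (\<phi> b)" "\<And>x. x \<in> T \<Longrightarrow> \<exists>b\<in>I. \<phi> b x > 0"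
  obtains c where "c > 0" "\<And>x. x \<in> T \<Longrightarrow> \<exists>b\<in>I. c \<le> \<phi> b x"
proof -
  define g where "g x = (\<Sum>b\<in>I. max 0 (\<phi> b x))" for x
  have "continuous_on T g"
    unfolding g_def by (intro continuous_on_sum continuous_on_max continuous_on_const assms(3))
  moreover have "g x > 0" if "x \<in> T" for x
  proof -
    from assms(4)[OF that] obtain b where "b \<in> I" "\<phi> b x > 0" by blast
    then show ?thesis unfolding g_def by (intro sum_pos2[of _ b] assms) auto
  qed
  ultimately obtain d where d: "d > 0" "\<And>x. x \<in> T \<Longrightarrow> d \<le> g x"
    using compact_positive_bound[OF assms(1)] by metis
  \<comment> \<open>If all members of the family were below \<open>c\<close> at a point, their
    positive parts would sum to at most \<open>card I * c\<close>. The added 1 makes this strictly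
    less than \<open>d\<close>, also for empty \<open>I\<close>.\<close>
  define c where "c = d / (real (card I) + 1)"
  have c: "c > 0" using d by (simp add: c_def)
  have "\<exists>b\<in>I. c \<le> \<phi> b x" if x: "x \<in> T" for x
  proof (rule ccontr)
    assume "\<not> ?thesis"
    then have "max 0 (\<phi> b x) \<le> c" if "b \<in> I" for b using that c by force
    then have "g x \<le> of_nat (card I) * c" unfolding g_def by (rule sum_bounded_above)
    also have "\<dots> < d" using d by (simp add: c_def field_simps)
    finally show False using d(2)[OF x] by simp
  qed
  then show ?thesis using that c by blast
qed

lemma compact_coordinates_bounded:
  fixes T :: "pt set"
  assumes "compact T"
  obtains R where "\<And>x j. x \<in> T \<Longrightarrow> j < N \<Longrightarrow> \<bar>x j\<bar> \<le> R" "0 \<le> R"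
proof -
  have "continuous_on T (\<lambda>x. \<Sum>j<N. \<bar>x j\<bar>)"
    by (intro continuous_on_sum continuous_on_rabs continuous_on_product_then_coordinatewise[OF continuous_on_id])
  from compact_imp_bounded[OF compact_continuous_image[OF this assms]]
  obtain R where R: "\<And>x. x \<in> T \<Longrightarrow> (\<Sum>j<N. \<bar>x j\<bar>) \<le> R" by (force simp: bounded_iff)
  have "\<bar>x j\<bar> \<le> max 0 R" if "x \<in> T" "j < N" for x j
    using R[OF that(1)] member_le_sum[of j "{..<N}" "\<lambda>j. \<bar>x j\<bar>"] that(2) by auto
  then show ?thesis using that[of "max 0 R"] by auto
qed

section \<open>Tent functions on a grid of cubes\<close>

definition tent :: "nat \<Rightarrow> real \<Rightarrow> (nat \<Rightarrow> int) \<Rightarrow> pt \<Rightarrow> real" where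
  "tent N h z y = (\<Prod>j<N. max 0 (1 - \<bar>y j / h - of_int (z j)\<bar>))"

lemma tent_nonneg: "0 \<le> tent N h z y"
  unfolding tent_def by (intro prod_nonneg) auto

lemma tent_pos_iff: "0 < tent N h z y \<longleftrightarrow> (\<forall>j<N. \<bar>y j / h - of_int (z j)\<bar> < 1)"
proof
  assume "0 < tent N h z y"
  then have "(\<Prod>j<N. max 0 (1 - \<bar>y j / h - of_int (z j)\<bar>)) \<noteq> 0"
    unfolding tent_def by (rule less_imp_neq[symmetric])
  then have "\<forall>j<N. max 0 (1 - \<bar>y j / h - of_int (z j)\<bar>) \<noteq> 0"
    using prod_zero[of "{..<N}" "\<lambda>j. max 0 (1 - \<bar>y j / h - of_int (z j)\<bar>)"]
    by (meson finite_lessThan lessThan_iff)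
  then show "\<forall>j<N. \<bar>y j / h - of_int (z j)\<bar> < 1" by (auto simp: max_def split: if_splits)
qed (auto simp: tent_def intro!: prod_pos)

lemma continuous_on_tent: "continuous_on A (tent N h z)"
proof -
  have "continuous_on A (\<lambda>y. y j / h)" for j :: nat
    unfolding divide_inverse
    by (intro continuous_on_mult continuous_on_const continuous_on_product_then_coordinatewise[OF continuous_on_id])
  then show ?thesis
    unfolding tent_def[abs_def]
    by (intro continuous_on_prod continuous_on_max continuous_on_const continuous_on_diff continuous_on_rabs)
qed

text \<open>The order \<open>2 ^ N\<close> comes from the grid of cubes: a point lies in at most \<open>2 ^ N\<close> open cubes
  of twice the mesh size that are centred at grid points.\<close>

lemma grid_refinement:
  fixes \<phi> :: "'i \<Rightarrow> pt \<Rightarrow> real"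
  assumes T: "compact T" "T \<subseteq> {x. \<forall>j\<ge>N. x j = 0}"
    and I: "finite I" "\<And>b. b \<in> I \<Longrightarrow> continuous_on T (\<phi> b)" "\<And>x. x \<in> T \<Longrightarrow> \<exists>b\<in>I. \<phi> b x > 0"
  obtains \<psi> :: "'i \<Rightarrow> pt \<Rightarrow> real" where "\<And>b. b \<in> I \<Longrightarrow> continuous_on T (\<psi> b)" "\<And>b x. 0 \<le> \<psi> b x"
    "\<And>b x. b \<in> I \<Longrightarrow> x \<in> T \<Longrightarrow> \<psi> b x > 0 \<Longrightarrow> \<phi> b x > 0" "\<And>x. x \<in> T \<Longrightarrow> \<exists>b\<in>I. \<psi> b x > 0"
    "\<And>x. x \<in> T \<Longrightarrow> card {b \<in> I. \<psi> b x > 0} \<le> 2 ^ N"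
proof -
  obtain c where c: "c > 0" "\<And>x. x \<in> T \<Longrightarrow> \<exists>b\<in>I. c \<le> \<phi> b x"
    using compact_family_positive_bound[OF T(1) I] by metis
  have "\<exists>d>0. \<forall>x\<in>T. \<forall>y\<in>T. dist x y < d \<longrightarrow> dist (\<phi> b x) (\<phi> b y) < c" if "b \<in> I" for b
    using compact_uniformly_continuous[OF I(2)[OF that] T(1)] c(1)
    unfolding uniformly_continuous_on_def by (metis dist_commute)
  then obtain d where d: "\<And>b. b \<in> I \<Longrightarrow> d b > 0"
    "\<And>b x y. b \<in> I \<Longrightarrow> x \<in> T \<Longrightarrow> y \<in> T \<Longrightarrow> dist x y < d b \<Longrightarrow> dist (\<phi> b x) (\<phi> b y) < c"
    by metis
  \<comment> \<open>The entry 1 keeps the minimum defined for empty \<open>I\<close>.\<close>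
  define \<delta> where "\<delta> = Min (insert 1 (d ` I))"
  have \<delta>: "\<delta> > 0" "\<And>b. b \<in> I \<Longrightarrow> \<delta> \<le> d b"
    using I(1) d(1) by (auto simp: \<delta>_def)
  \<comment> \<open>Points of one cube differ by at most \<open>2 * h\<close> in each coordinate,
    hence by \<open>dist_fun_le\<close> by at most \<open>4 * h\<close>, which is half of
    \<open>\<delta>\<close>.\<close>
  define h where "h = \<delta> / 8"
  have h: "h > 0" using \<delta> by (simp add: h_def)
  have close: "dist x y < \<delta>" if "x \<in> T" "y \<in> T" "0 < tent N h z x" "0 < tent N h z y" for x y z
  proof -
    have "\<bar>x j - y j\<bar> \<le> 2 * h" for j
    proof (cases "j < N")
      case True
      then have "\<bar>x j / h - of_int (z j)\<bar> < 1" "\<bar>y j / h - of_int (z j)\<bar> < 1"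
        using that by (auto simp: tent_pos_iff)
      then have "\<bar>x j / h - y j / h\<bar> < 2" by linarith
      then have "\<bar>(x j - y j) / h\<bar> < 2" by (simp add: diff_divide_distrib)
      then show ?thesis using h by (simp add: abs_divide field_simps)
    next
      case False
      then show ?thesis using subsetD[OF T(2) that(1)] subsetD[OF T(2) that(2)] h by (simp add: not_less)
    qed
    from dist_fun_le[of x y "2 * h", OF this] show ?thesis using \<delta> by (simp add: h_def)
  qed
  obtain R where R: "\<And>x j. x \<in> T \<Longrightarrow> j < N \<Longrightarrow> \<bar>x j\<bar> \<le> R"
    using compact_coordinates_bounded[OF T(1), of N] by metis
  \<comment> \<open>Bounds the grid, so that there are finitely many cubes; the added 1 allows for
    rounding down negative numbers.\<close>
  define M :: int where "M = \<lceil>R / h\<rceil> + 1"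
  define Z where "Z = PiE {..<N} (\<lambda>_. {-M..M})"
  have finZ: "finite Z" unfolding Z_def by (intro finite_PiE) auto
  define zz where "zz x = restrict (\<lambda>j. \<lfloor>x j / h\<rfloor>) {..<N}" for x :: pt
  have zz: "zz x \<in> Z \<and> 0 < tent N h (zz x) x" if "x \<in> T" for x
  proof
    have "- M \<le> \<lfloor>x j / h\<rfloor> \<and> \<lfloor>x j / h\<rfloor> \<le> M" if j: "j < N" for j
    proof -
      have "\<bar>x j / h\<bar> \<le> R / h" using R[OF \<open>x \<in> T\<close> j] h by (simp add: abs_divide divide_right_mono)
      then show ?thesis unfolding M_def by linarith
    qed
    then show "zz x \<in> Z" by (auto simp: Z_def zz_def)
    have "\<bar>x j / h - of_int (zz x j)\<bar> < 1" if "j < N" for j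
    proof -
      have "zz x j = \<lfloor>x j / h\<rfloor>" using that by (simp add: zz_def)
      then show ?thesis by linarith
    qed
    then show "0 < tent N h (zz x) x" by (simp add: tent_pos_iff)
  qed
  \<comment> \<open>A cube \<open>z\<close> may be assigned to \<open>b\<close> if
    \<open>\<phi> b\<close> reaches \<open>c\<close> somewhere in it. On the part of the cube inside
    \<open>T\<close>, \<open>\<phi> b\<close> varies by less than \<open>c\<close> and is therefore
    positive; \<open>\<psi> b\<close> collects the tents of all cubes assigned to
    \<open>b\<close>.\<close>
  define Q where "Q z b \<longleftrightarrow> b \<in> I \<and> (\<exists>y\<in>T. 0 < tent N h z y \<and> c \<le> \<phi> b y)" for z b
  define \<beta> where "\<beta> z = (SOME b. Q z b)" for z
  have \<beta>: "Q z (\<beta> z)" if "x \<in> T" "0 < tent N h z x" for z x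
    unfolding \<beta>_def by (rule someI_ex) (use c(2)[OF that(1)] that in \<open>auto simp: Q_def\<close>)
  define \<psi> where "\<psi> b x = (\<Sum>z | z \<in> Z \<and> \<beta> z = b. tent N h z x)" for b x
  have \<psi>_pos: "\<exists>z\<in>Z. \<beta> z = b \<and> 0 < tent N h z x" if "0 < \<psi> b x" for b x
  proof (rule ccontr)
    assume "\<not> ?thesis"
    then have "\<psi> b x \<le> 0" unfolding \<psi>_def by (intro sum_nonpos) (auto simp: not_less)
    then show False using that by simp
  qed
  show ?thesis
  proof
    show "continuous_on T (\<psi> b)" for b
      unfolding \<psi>_def[abs_def] by (intro continuous_on_sum continuous_on_tent)
    show "0 \<le> \<psi> b x" for b x unfolding \<psi>_def by (intro sum_nonneg tent_nonneg)
    show "\<phi> b x > 0" if "b \<in> I" "x \<in> T" "\<psi> b x > 0" for b x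
    proof -
      from \<psi>_pos[OF that(3)] obtain z where z: "\<beta> z = b" "0 < tent N h z x" by blast
      from \<beta>[OF that(2) z(2)] obtain y where y: "y \<in> T" "0 < tent N h z y" "c \<le> \<phi> b y"
        unfolding Q_def z(1) by blast
      have "dist (\<phi> b x) (\<phi> b y) < c"
        using close[OF that(2) y(1) z(2) y(2)] \<delta>(2)[OF that(1)] by (intro d(2) that y) linarith
      then show ?thesis using y(3) by (simp add: dist_real_def)
    qed
    show "\<exists>b\<in>I. \<psi> b x > 0" if "x \<in> T" for x
    proof -
      note z = zz[OF that]
      have "\<beta> (zz x) \<in> I" using \<beta>[OF that] z by (auto simp: Q_def)
      moreover have "\<psi> (\<beta> (zz x)) x > 0"
        unfolding \<psi>_def using z finZ by (intro sum_pos2[of _ "zz x"]) (auto simp: tent_nonneg)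
      ultimately show ?thesis by blast
    qed
    show "card {b \<in> I. \<psi> b x > 0} \<le> 2 ^ N" for x
    proof -
      \<comment> \<open>In each coordinate, two integers at most have distance below 1 from
        \<open>x j / h\<close>.\<close>
      define P where "P = PiE {..<N} (\<lambda>j. {\<lfloor>x j / h\<rfloor>, \<lfloor>x j / h\<rfloor> + 1})"
      have finP: "finite P" unfolding P_def by (intro finite_PiE) auto
      have "z \<in> P" if "z \<in> Z" "0 < tent N h z x" for z
      proof -
        have "z j \<in> {\<lfloor>x j / h\<rfloor>, \<lfloor>x j / h\<rfloor> + 1}" if "j < N" for j
        proof -
          have "\<bar>x j / h - of_int (z j)\<bar> < 1" using \<open>0 < tent N h z x\<close> that by (simp add: tent_pos_iff)
          then have "\<lfloor>x j / h\<rfloor> \<le> z j" "z j \<le> \<lfloor>x j / h\<rfloor> + 1" by linarith+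
          then show ?thesis by auto
        qed
        then show ?thesis using that(1) by (auto simp: P_def Z_def PiE_iff)
      qed
      then have "{b \<in> I. \<psi> b x > 0} \<subseteq> \<beta> ` P" using \<psi>_pos by blast
      then have "card {b \<in> I. \<psi> b x > 0} \<le> card (\<beta> ` P)" using finP by (intro card_mono) auto
      also have "\<dots> \<le> card P" by (rule card_image_le[OF finP])
      also have "card P = 2 ^ N" by (simp add: P_def card_PiE numeral_2_eq_2)
      finally show ?thesis .
    qed
  qed
qed

section \<open>Invariant functions and covers of bounded order\<close>

context lattice_action
begin

definition invf :: "pt set \<Rightarrow> (pt \<Rightarrow> real) \<Rightarrow> bool" where
  "invf A \<phi> \<longleftrightarrow> continuous_on A \<phi> \<and> (\<forall>v\<in>rvec l. \<forall>x\<in>A. \<phi> (\<theta> v x) = \<phi> x)"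

lemma invf_weight: "invf A \<phi> \<longleftrightarrow> weight (\<lambda>_. 0) A (\<lambda>x. of_real (\<phi> x))"
proof
  assume "invf A \<phi>"
  then show "weight (\<lambda>_. 0) A (\<lambda>x. of_real (\<phi> x))"
    by (auto simp: invf_def weight_def ipair_zero_left intro: continuous_on_of_real)
next
  assume w: "weight (\<lambda>_. 0) A (\<lambda>x. of_real (\<phi> x))"
  then have "continuous_on A (\<lambda>x. Re (of_real (\<phi> x)))" by (intro continuous_on_Re) (simp add: weight_def)
  then show "invf A \<phi>" using w by (auto simp: invf_def weight_def ipair_zero_left)
qed

lemma invf_norm: "weight k A f \<Longrightarrow> invf A (\<lambda>x. norm (f x))"
  by (auto simp: invf_def weight_def norm_mult intro: continuous_on_norm)

lemma invf_const: "invf A (\<lambda>x. c)"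
  by (auto simp: invf_def)

lemma invf_add: "invf A f \<Longrightarrow> invf A g \<Longrightarrow> invf A (\<lambda>x. f x + g x)"
  and invf_diff: "invf A f \<Longrightarrow> invf A g \<Longrightarrow> invf A (\<lambda>x. f x - g x)"
  and invf_mult: "invf A f \<Longrightarrow> invf A g \<Longrightarrow> invf A (\<lambda>x. f x * g x)"
  and invf_max: "invf A f \<Longrightarrow> invf A g \<Longrightarrow> invf A (\<lambda>x. max (f x) (g x))"
  by (auto simp: invf_def intro: continuous_intros continuous_on_max)

lemma invf_prod: "(\<And>i. i \<in> J \<Longrightarrow> invf A (f i)) \<Longrightarrow> invf A (\<lambda>x. \<Prod>i\<in>J. f i x)"
  by (auto simp: invf_def intro!: continuous_on_prod prod.cong)

lemma invf_subset: "invf A f \<Longrightarrow> B \<subseteq> A \<Longrightarrow> invf B f"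
  by (auto simp: invf_def intro: continuous_on_subset)

lemma weight_subset: "weight k A f \<Longrightarrow> B \<subseteq> A \<Longrightarrow> weight k B f"
  by (auto simp: weight_def intro: continuous_on_subset)

lemma weight_sum: "(\<And>i. i \<in> J \<Longrightarrow> weight k A (f i)) \<Longrightarrow> weight k A (\<lambda>x. \<Sum>i\<in>J. f i x)"
  by (auto simp: weight_def sum_distrib_left intro!: continuous_on_sum sum.cong)

lemma weight_mult_invf: "invf A \<phi> \<Longrightarrow> weight k A f \<Longrightarrow> weight k A (\<lambda>x. of_real (\<phi> x) * f x)"
  by (auto simp: weight_def invf_def intro!: continuous_intros)

lemma weight_scale: "weight k A f \<Longrightarrow> weight k A (\<lambda>x. c * f x)"
  by (auto simp: weight_def intro!: continuous_intros)

lemma orbit_of_sub: "inv_set A \<Longrightarrow> x \<in> A \<Longrightarrow> orbit_of x \<subseteq> A"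
  by (auto simp: inv_set_def orbit_of_def)

definition nprod :: "(nat \<Rightarrow> int) set \<Rightarrow> ((nat \<Rightarrow> int) \<Rightarrow> pt \<Rightarrow> complex) \<Rightarrow> pt \<Rightarrow> real" where
  "nprod G f x = (\<Prod>k\<in>G. norm (f k x))"

lemma nprod_nonneg: "0 \<le> nprod G f x"
  unfolding nprod_def by (intro prod_nonneg) auto

lemma nprod_pos_iff: "finite G \<Longrightarrow> 0 < nprod G f x \<longleftrightarrow> (\<forall>k\<in>G. f k x \<noteq> 0)"
  using nprod_nonneg[of G f x] by (auto simp: nprod_def order_less_le prod_zero_iff)

lemma invf_nprod: "(\<And>k. k \<in> G \<Longrightarrow> weight k A (f k)) \<Longrightarrow> invf A (nprod G f)"
  unfolding nprod_def[abs_def] by (intro invf_prod invf_norm) auto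

text \<open>On \<open>E\<close>, where the tuple \<open>f\<close> stays away from zero, it defines a
  continuous slice map \<open>\<pi>\<close>. The grid refinement takes place on the compact slice
  image inside \<open>N\<close>-dimensional space, and composing with \<open>\<pi>\<close> yields
  invariant functions. The covering hypothesis carries over to the slice because invariant functions
  agree at \<open>x\<close> and \<open>\<pi> x\<close>.\<close>

lemma refine_step:
  fixes \<phi> :: "'i \<Rightarrow> pt \<Rightarrow> real"
  assumes G: "basis_for K G" and D: "compact D" "inv_set D" "\<And>x. x \<in> D \<Longrightarrow> stab x = K"
    and f: "\<And>k. k \<in> G \<Longrightarrow> weight k D (f k)" and "\<epsilon> > 0"
    and I: "finite I" "\<And>b. b \<in> I \<Longrightarrow> invf D (\<phi> b)" "\<And>b x. b \<in> I \<Longrightarrow> x \<in> D \<Longrightarrow> 0 \<le> \<phi> b x"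
      "\<And>x. x \<in> D \<Longrightarrow> \<exists>b\<in>I. \<phi> b x > 0"
  obtains \<phi>' :: "'i \<Rightarrow> pt \<Rightarrow> real" where "\<And>b. b \<in> I \<Longrightarrow> invf D (\<phi>' b)" "\<And>b x. b \<in> I \<Longrightarrow> x \<in> D \<Longrightarrow> 0 \<le> \<phi>' b x"
    "\<And>x. x \<in> D \<Longrightarrow> \<exists>b\<in>I. \<phi>' b x > 0" "\<And>b x. b \<in> I \<Longrightarrow> x \<in> D \<Longrightarrow> \<phi>' b x > 0 \<Longrightarrow> \<phi> b x > 0"
    "\<And>x. x \<in> D \<Longrightarrow> \<epsilon> \<le> nprod G f x \<Longrightarrow> card {b \<in> I. \<phi>' b x > 0} \<le> 2 ^ N"
proof -
  let ?p = "nprod G f"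
  have finG: "finite G" using G by (simp add: basis_for_def)
  have p: "invf D ?p" by (intro invf_nprod f)
  define E where "E = {x \<in> D. \<epsilon> \<le> ?p x}"
  have DS: "D \<subseteq> S" using D(2) by (rule inv_set_sub)
  have ED: "E \<subseteq> D" by (auto simp: E_def)
  have "closed E"
    unfolding E_def using p D(1)
    by (intro continuous_on_closed_Collect_le) (auto simp: invf_def compact_imp_closed)
  have Ec: "compact E" using D(1) \<open>closed E\<close> ED by (metis compact_Int_closed inf.absorb_iff2)
  have Ei: "inv_set E" using D(2) p by (auto simp: E_def inv_set_def invf_def)
  have nz: "f k x \<noteq> 0" if "k \<in> G" "x \<in> E" for k x
    using that nprod_pos_iff[OF finG, of f x] \<open>\<epsilon> > 0\<close> by (auto simp: E_def)
  define \<pi> where "\<pi> = slice G f"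
  have stabE: "stab x = K" if "x \<in> E" for x using that ED D(3) by blast
  have \<pi>c: "continuous_on E \<pi>"
    unfolding \<pi>_def using f ED DS D(3) nz
    by (intro slice_cont[OF G Ec]) (auto simp: weight_def intro: continuous_on_subset)
  have \<pi>o: "\<pi> x \<in> orbit_of x" if "x \<in> E" for x
    unfolding \<pi>_def using that stabE G ED DS nz by (intro slice_in_orbit) auto
  have \<pi>i: "\<pi> (\<theta> v x) = \<pi> x" if "v \<in> rvec l" "x \<in> E" for v x
    unfolding \<pi>_def using that stabE G ED DS nz f by (intro slice_inv) (auto simp: weight_def)
  have \<pi>E: "\<pi> x \<in> E" if "x \<in> E" for x using \<pi>o[OF that] orbit_of_sub[OF Ei that] by blast
  have \<phi>\<pi>: "\<phi> b (\<pi> x) = \<phi> b x" if "b \<in> I" "x \<in> E" for b x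
    using \<pi>o[OF that(2)] I(2)[OF that(1)] that(2) ED by (auto simp: orbit_of_def invf_def)
  define T where "T = \<pi> ` E"
  have T: "compact T" "T \<subseteq> E"
    using compact_continuous_image[OF \<pi>c Ec] \<pi>E by (auto simp: T_def)
  obtain \<psi> :: "'i \<Rightarrow> pt \<Rightarrow> real" where \<psi>: "\<And>b. b \<in> I \<Longrightarrow> continuous_on T (\<psi> b)" "\<And>b x. 0 \<le> \<psi> b x"
    "\<And>b x. b \<in> I \<Longrightarrow> x \<in> T \<Longrightarrow> \<psi> b x > 0 \<Longrightarrow> \<phi> b x > 0" "\<And>x. x \<in> T \<Longrightarrow> \<exists>b\<in>I. \<psi> b x > 0"
    "\<And>x. x \<in> T \<Longrightarrow> card {b \<in> I. \<psi> b x > 0} \<le> 2 ^ N"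
  proof (rule grid_refinement[OF T(1) _ I(1), of N \<phi>])
    show "T \<subseteq> {x. \<forall>j\<ge>N. x j = 0}" using T(2) ED DS S_sub by blast
    show "continuous_on T (\<phi> b)" if "b \<in> I" for b
      using I(2)[OF that] T(2) ED unfolding invf_def by (meson continuous_on_subset)
    show "\<exists>b\<in>I. \<phi> b x > 0" if "x \<in> T" for x using that T(2) ED I(4) by blast
  qed (rule that; assumption)
  have "\<exists>g. weight (\<lambda>_. 0) S g \<and> (\<forall>x\<in>E. g x = of_real (\<psi> b (\<pi> x)))" if "b \<in> I" for b
  proof -
    have "continuous_on E (\<lambda>x. \<psi> b (\<pi> x))"
      by (rule continuous_on_compose2[OF \<psi>(1)[OF that] \<pi>c]) (auto simp: T_def)
    then have "weight (\<lambda>_. 0) E (\<lambda>x. of_real (\<psi> b (\<pi> x)))"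
      using \<pi>i by (auto simp flip: invf_weight simp: invf_def)
    from weight_extend[OF Ei \<open>closed E\<close> this] show ?thesis by metis
  qed
  then obtain g where g: "\<And>b. b \<in> I \<Longrightarrow> weight (\<lambda>_. 0) S (g b)"
    "\<And>b x. b \<in> I \<Longrightarrow> x \<in> E \<Longrightarrow> g b x = of_real (\<psi> b (\<pi> x))" by metis
  \<comment> \<open>On \<open>E\<close> the maximum is 0, so the positive set is cut down to that of
    the refined function. Off \<open>E\<close> the bracket is positive and \<open>\<phi>' b\<close>
    has the sign of \<open>\<phi> b\<close>, so the covering survives everywhere.\<close>
  define \<phi>' where "\<phi>' b x = \<phi> b x * (norm (g b x) + max 0 (\<epsilon> - ?p x))" for b x
  have pos: "\<phi>' b x > 0 \<longleftrightarrow> \<phi> b x > 0 \<and> (g b x \<noteq> 0 \<or> ?p x < \<epsilon>)" if "b \<in> I" "x \<in> D" for b x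
  proof -
    have "norm (g b x) + max 0 (\<epsilon> - ?p x) \<ge> 0" by (simp add: add_nonneg_nonneg)
    moreover have "norm (g b x) + max 0 (\<epsilon> - ?p x) > 0 \<longleftrightarrow> g b x \<noteq> 0 \<or> ?p x < \<epsilon>"
      by (cases "g b x = 0") (auto simp: max_def intro: add_pos_nonneg)
    ultimately show ?thesis
      unfolding \<phi>'_def using I(3)[OF that] by (auto simp: zero_less_mult_iff)
  qed
  show ?thesis
  proof
    show "invf D (\<phi>' b)" if "b \<in> I" for b
      unfolding \<phi>'_def[abs_def]
      by (intro invf_mult invf_add invf_max invf_diff invf_const p I(2) that
           invf_subset[OF invf_norm[OF g(1)] DS])
    show "0 \<le> \<phi>' b x" if "b \<in> I" "x \<in> D" for b x
      unfolding \<phi>'_def using I(3)[OF that] by (intro mult_nonneg_nonneg) auto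
    show "\<exists>b\<in>I. \<phi>' b x > 0" if "x \<in> D" for x
    proof (cases "x \<in> E")
      case True
      then obtain b where b: "b \<in> I" "\<psi> b (\<pi> x) > 0" using \<psi>(4)[of "\<pi> x"] by (auto simp: T_def)
      then have "\<phi> b x > 0" using \<psi>(3)[OF b(1) _ b(2)] True \<phi>\<pi> by (auto simp: T_def)
      then show ?thesis using b g(2)[OF b(1) True] pos[OF b(1) that] by force
    next
      case False
      then show ?thesis using I(4)[OF that] pos[OF _ that] that by (auto simp: E_def not_le)
    qed
    show "\<phi> b x > 0" if "b \<in> I" "x \<in> D" "\<phi>' b x > 0" for b x
      using that pos by blast
    show "card {b \<in> I. \<phi>' b x > 0} \<le> 2 ^ N" if "x \<in> D" "\<epsilon> \<le> ?p x" for x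
    proof -
      have xE: "x \<in> E" using that by (simp add: E_def)
      have "{b \<in> I. \<phi>' b x > 0} \<subseteq> {b \<in> I. \<psi> b (\<pi> x) > 0}"
      proof safe
        fix b assume b: "b \<in> I" "\<phi>' b x > 0"
        then have "\<psi> b (\<pi> x) \<noteq> 0" using pos[OF b(1) that(1)] that(2) g(2)[OF b(1) xE] by auto
        then show "\<psi> b (\<pi> x) > 0" using \<psi>(2)[of b "\<pi> x"] by simp
      qed
      then have "card {b \<in> I. \<phi>' b x > 0} \<le> card {b \<in> I. \<psi> b (\<pi> x) > 0}"
        using I(1) by (intro card_mono) auto
      also have "\<dots> \<le> 2 ^ N" using \<psi>(5) xE by (simp add: T_def)
      finally show ?thesis .
    qed
  qed
qed

text \<open>A slice exists only where a tuple has no zeros, so the bound is achieved region by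
  region: for each \<open>a\<close> in \<open>I\<close>, \<open>refine_step\<close> treats the
  region where its tuple has product at least \<open>\<epsilon>\<close>. Positive sets only shrink,
  so bounds already obtained persist, and by choice of \<open>\<epsilon>\<close> the regions cover
  \<open>D\<close>.\<close>

lemma order_reduction:
  fixes I :: "'i set"
  assumes G: "basis_for K G" and D: "compact D" "inv_set D" "\<And>x. x \<in> D \<Longrightarrow> stab x = K"
    and I: "finite I" "\<And>a k. a \<in> I \<Longrightarrow> k \<in> G \<Longrightarrow> weight k D (f a k)"
      "\<And>x. x \<in> D \<Longrightarrow> \<exists>a\<in>I. \<forall>k\<in>G. f a k x \<noteq> 0"
  obtains \<phi> :: "'i \<Rightarrow> pt \<Rightarrow> real" where "\<And>b. b \<in> I \<Longrightarrow> invf D (\<phi> b)"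
    "\<And>b x. b \<in> I \<Longrightarrow> x \<in> D \<Longrightarrow> 0 \<le> \<phi> b x"
    "\<And>x. x \<in> D \<Longrightarrow> \<exists>b\<in>I. \<phi> b x > 0"
    "\<And>b x k. b \<in> I \<Longrightarrow> x \<in> D \<Longrightarrow> \<phi> b x > 0 \<Longrightarrow> k \<in> G \<Longrightarrow> f b k x \<noteq> 0"
    "\<And>x. x \<in> D \<Longrightarrow> card {b \<in> I. \<phi> b x > 0} \<le> 2 ^ N"
proof -
  have finG: "finite G" using G by (simp add: basis_for_def)
  let ?p = "\<lambda>a. nprod G (f a)"
  have pos: "0 < ?p a x \<longleftrightarrow> (\<forall>k\<in>G. f a k x \<noteq> 0)" for a x by (rule nprod_pos_iff[OF finG])
  have pinv: "invf D (?p a)" if "a \<in> I" for a using I(2) that by (intro invf_nprod) auto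
  have ex: "\<exists>a\<in>I. 0 < ?p a x" if "x \<in> D" for x using I(3)[OF that] pos by blast
  obtain \<epsilon> where \<epsilon>: "\<epsilon> > 0" "\<And>x. x \<in> D \<Longrightarrow> \<exists>a\<in>I. \<epsilon> \<le> ?p a x"
    using compact_family_positive_bound[OF D(1) I(1), of ?p] pinv ex by (auto simp: invf_def)
  define good where "good \<phi> J \<longleftrightarrow> (\<forall>b\<in>I. invf D (\<phi> b)) \<and> (\<forall>b\<in>I. \<forall>x\<in>D. 0 \<le> \<phi> b x) \<and>
    (\<forall>x\<in>D. \<exists>b\<in>I. \<phi> b x > 0) \<and> (\<forall>b\<in>I. \<forall>x\<in>D. \<phi> b x > 0 \<longrightarrow> 0 < ?p b x) \<and>
    (\<forall>a\<in>J. \<forall>x\<in>D. \<epsilon> \<le> ?p a x \<longrightarrow> card {b \<in> I. \<phi> b x > 0} \<le> 2 ^ N)"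
    for \<phi> :: "'i \<Rightarrow> pt \<Rightarrow> real" and J
  have "\<exists>\<phi>. good \<phi> J" if "finite J" "J \<subseteq> I" for J
    using that
  proof (induction J)
    case empty
    show ?case using pinv ex nprod_nonneg by (intro exI[of _ ?p]) (auto simp: good_def)
  next
    case (insert a J)
    then obtain \<phi> where \<phi>: "good \<phi> J" by blast
    have aI: "a \<in> I" using insert by simp
    obtain \<phi>' where \<phi>': "\<And>b. b \<in> I \<Longrightarrow> invf D (\<phi>' b)" "\<And>b x. b \<in> I \<Longrightarrow> x \<in> D \<Longrightarrow> 0 \<le> \<phi>' b x"
      "\<And>x. x \<in> D \<Longrightarrow> \<exists>b\<in>I. \<phi>' b x > 0" "\<And>b x. b \<in> I \<Longrightarrow> x \<in> D \<Longrightarrow> \<phi>' b x > 0 \<Longrightarrow> \<phi> b x > 0"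
      "\<And>x. x \<in> D \<Longrightarrow> \<epsilon> \<le> ?p a x \<Longrightarrow> card {b \<in> I. \<phi>' b x > 0} \<le> 2 ^ N"
    proof (rule refine_step[OF G D, of "f a" \<epsilon> I \<phi>])
      show "weight k D (f a k)" if "k \<in> G" for k by (rule I(2)[OF aI that])
    qed (use \<epsilon>(1) I(1) \<phi> in \<open>auto simp: good_def\<close>)
    have "card {b \<in> I. \<phi>' b x > 0} \<le> 2 ^ N" if "c \<in> insert a J" "x \<in> D" "\<epsilon> \<le> ?p c x" for c x
    proof (cases "c = a")
      case True
      then show ?thesis using \<phi>'(5) that by blast
    next
      case False
      have "card {b \<in> I. \<phi>' b x > 0} \<le> card {b \<in> I. \<phi> b x > 0}"
        using I(1) \<phi>'(4) that(2) by (intro card_mono) auto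
      also have "\<dots> \<le> 2 ^ N" using \<phi> that False by (auto simp: good_def)
      finally show ?thesis .
    qed
    then have "good \<phi>' (insert a J)"
      using \<phi>' \<phi> unfolding good_def by blast
    then show ?case by blast
  qed
  then obtain \<phi> where \<phi>: "good \<phi> I" using I(1) by blast
  show ?thesis
  proof (rule that)
    show "card {b \<in> I. \<phi> b x > 0} \<le> 2 ^ N" if "x \<in> D" for x
      using \<epsilon>(2)[OF that] \<phi> that unfolding good_def by blast
  qed (use \<phi> pos in \<open>auto simp: good_def\<close>)
qed

text \<open>Barycentric subdivision: of the sets \<open>{x. \<phi> a x > \<phi> b x for a \<in> s, b \<notin> s}\<close> with index sets \<open>s\<close>
  of the same cardinality, no two distinct ones meet, so one colour per cardinality suffices.\<close>

lemma colouring: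
  fixes I :: "'i set" and \<phi> :: "'i \<Rightarrow> pt \<Rightarrow> real"
  assumes I: "finite I" "\<And>a k. a \<in> I \<Longrightarrow> k \<in> G \<Longrightarrow> weight k D (f a k)"
    and \<phi>: "\<And>b. b \<in> I \<Longrightarrow> invf D (\<phi> b)" "\<And>b x. b \<in> I \<Longrightarrow> x \<in> D \<Longrightarrow> 0 \<le> \<phi> b x"
      "\<And>x. x \<in> D \<Longrightarrow> \<exists>b\<in>I. \<phi> b x > 0"
      "\<And>b x k. b \<in> I \<Longrightarrow> x \<in> D \<Longrightarrow> \<phi> b x > 0 \<Longrightarrow> k \<in> G \<Longrightarrow> f b k x \<noteq> 0"
      "\<And>x. x \<in> D \<Longrightarrow> card {b \<in> I. \<phi> b x > 0} \<le> m"
  obtains F :: "nat \<Rightarrow> (nat \<Rightarrow> int) \<Rightarrow> pt \<Rightarrow> complex" where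
    "\<And>c k. k \<in> G \<Longrightarrow> weight k D (F c k)" "\<And>x. x \<in> D \<Longrightarrow> \<exists>c<m. \<forall>k\<in>G. F c k x \<noteq> 0"
proof -
  \<comment> \<open>Nonzero exactly where all indices in \<open>s\<close> are positive and each
    dominates every index outside \<open>s\<close>. Any member of \<open>s\<close> then has a tuple
    without zeros, so \<open>sel s\<close> may be arbitrary.\<close>
  define w where "w s x = (\<Prod>a\<in>s. \<phi> a x * (\<Prod>b\<in>I - s. max 0 (\<phi> a x - \<phi> b x)))" for s x
  define sel :: "'i set \<Rightarrow> 'i" where "sel s = (SOME a. a \<in> s)" for s
  define \<C> where "\<C> c = {s. s \<subseteq> I \<and> card s = Suc c}" for c
  have fin\<C>: "finite (\<C> c)" for c using I(1) by (auto simp: \<C>_def)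
  have sel: "sel s \<in> s" if "s \<in> \<C> c" for s c
  proof -
    have "s \<noteq> {}" using that by (auto simp: \<C>_def)
    then show ?thesis unfolding sel_def by (simp add: some_in_eq)
  qed
  have winv: "invf D (w s)" if "s \<subseteq> I" for s
    unfolding w_def[abs_def] using that
    by (intro invf_prod invf_mult invf_max invf_diff invf_const \<phi>(1)) auto
  have finsub: "finite s" if "s \<subseteq> I" for s using that I(1) by (rule finite_subset)
  have wnz: "(\<forall>a\<in>s. \<phi> a x > 0) \<and> (\<forall>a\<in>s. \<forall>b\<in>I - s. \<phi> b x < \<phi> a x)"
    if "w s x \<noteq> 0" "s \<subseteq> I" "x \<in> D" for s x
  proof -
    have *: "\<phi> a x \<noteq> 0 \<and> (\<forall>b\<in>I - s. max 0 (\<phi> a x - \<phi> b x) \<noteq> 0)" if "a \<in> s" for a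
      using \<open>w s x \<noteq> 0\<close> that finsub[OF \<open>s \<subseteq> I\<close>] I(1) by (auto simp: w_def)
    have "\<phi> b x < \<phi> a x" if "a \<in> s" "b \<in> I - s" for a b
    proof -
      have "max 0 (\<phi> a x - \<phi> b x) \<noteq> 0" using *[OF that(1)] that(2) by blast
      then show ?thesis by (simp add: max_def split: if_splits)
    qed
    moreover have "\<phi> a x > 0" if "a \<in> s" for a
      using *[OF that] \<phi>(2)[of a x] \<open>s \<subseteq> I\<close> \<open>x \<in> D\<close> that by (auto simp: order_less_le)
    ultimately show ?thesis by blast
  qed
  define F where "F c k x = (\<Sum>s\<in>\<C> c. of_real (w s x) * f (sel s) k x)" for c k x
  show ?thesis
  proof
    show "weight k D (F c k)" if "k \<in> G" for c k
      unfolding F_def[abs_def]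
    proof (intro weight_sum weight_mult_invf winv I(2) that)
      fix s assume s: "s \<in> \<C> c"
      then show "s \<subseteq> I" by (simp add: \<C>_def)
      then show "sel s \<in> I" using sel[OF s] by blast
    qed
    fix x assume x: "x \<in> D"
    define s where "s = {b \<in> I. \<phi> b x > 0}"
    have s: "s \<subseteq> I" "s \<noteq> {}" "card s \<le> m" using \<phi>(3,5)[OF x] by (auto simp: s_def)
    \<comment> \<open>Colour \<open>c\<close> collects the sets of cardinality \<open>c + 1\<close>,
      so at most \<open>m\<close> positive indices give a colour below \<open>m\<close>.\<close>
    define c where "c = card s - 1"
    have "card s > 0" using s finsub[of s] by (simp add: card_gt_0_iff)
    then have c: "Suc c = card s" "c < m" using s(3) by (auto simp: c_def)
    have sC: "s \<in> \<C> c" using c s by (simp add: \<C>_def)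
    have "w s x > 0" unfolding w_def
    proof (intro prod_pos ballI mult_pos_pos)
      fix a b assume "a \<in> s" "b \<in> I - s"
      then show "0 < max 0 (\<phi> a x - \<phi> b x)" using \<phi>(2)[of b x] x by (auto simp: s_def)
    qed (auto simp: s_def)
    have "w s' x = 0" if "s' \<in> \<C> c" "s' \<noteq> s" for s'
    proof (rule ccontr)
      assume nz: "w s' x \<noteq> 0"
      have s': "s' \<subseteq> I" "card s' = card s" using that c by (auto simp: \<C>_def)
      \<comment> \<open>\<open>s\<close> contains all indices positive at \<open>x\<close>, and a
        nonzero weight makes every index in \<open>s'\<close> positive; equal cardinality does the
        rest.\<close>
      have "s' \<subseteq> s" using wnz[OF nz s'(1) x] s' by (auto simp: s_def)
      then have "s' = s" using s'(2) finsub[OF s(1)] by (metis card_subset_eq)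
      then show False using that by simp
    qed
    then have F: "F c k x = of_real (w s x) * f (sel s) k x" for k
      unfolding F_def using fin\<C> sC
      by (subst sum.remove[of _ s]) (auto intro!: sum.neutral)
    have "\<forall>k\<in>G. F c k x \<noteq> 0"
      using \<open>w s x > 0\<close> \<phi>(4)[OF _ x] sel[OF sC] by (auto simp: F s_def)
    then show "\<exists>c<m. \<forall>k\<in>G. F c k x \<noteq> 0" using c by blast
  qed
qed

text \<open>The number of tuples depends neither on \<open>D\<close> nor on the size of a finite
  subcover, which lets infinitely many shells share the same colours. The bound 1 on the functions
  prepares for summing them over the shells.\<close>

lemma bounded_cover_functions:
  assumes G: "basis_for K G" and D: "compact D" "inv_set D" "\<And>x. x \<in> D \<Longrightarrow> stab x = K"
  obtains F :: "nat \<Rightarrow> (nat \<Rightarrow> int) \<Rightarrow> pt \<Rightarrow> complex" where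
    "\<And>c k. k \<in> G \<Longrightarrow> weight k S (F c k)" "\<And>c k x. k \<in> G \<Longrightarrow> x \<in> S \<Longrightarrow> norm (F c k x) \<le> 1"
    "\<And>x. x \<in> D \<Longrightarrow> \<exists>c<2 ^ N. \<forall>k\<in>G. F c k x \<noteq> 0"
proof -
  have finG: "finite G" using G by (simp add: basis_for_def)
  have DS: "D \<subseteq> S" using D(2) by (rule inv_set_sub)
  have "\<exists>g. x \<in> D \<longrightarrow> (\<forall>k\<in>G. weight k S (g k) \<and> g k x \<noteq> 0)" for x
  proof (cases "x \<in> D")
    case True
    have "\<exists>g. weight k S g \<and> g x \<noteq> 0" if "k \<in> G" for k
    proof -
      have "ipair l k v \<in> \<int>" if "v \<in> stab x" for v
        using that D(3)[OF True] G \<open>k \<in> G\<close> by (simp add: basis_for_def)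
      then show ?thesis using weight_nonzero_exists[of x k] True DS by blast
    qed
    then show ?thesis by metis
  qed auto
  then obtain g where g: "\<And>x k. x \<in> D \<Longrightarrow> k \<in> G \<Longrightarrow> weight k S (g x k)"
    "\<And>x k. x \<in> D \<Longrightarrow> k \<in> G \<Longrightarrow> g x k x \<noteq> 0" by metis
  define U where "U x = {y \<in> D. 0 < nprod G (g x) y}" for x
  have "openin (top_of_set D) (U x)" if "x \<in> D" for x
  proof -
    have "invf D (nprod G (g x))" using g that DS by (intro invf_nprod) (auto intro: weight_subset)
    then have "openin (top_of_set D) (D \<inter> nprod G (g x) -` {0<..})"
      by (intro continuous_openin_preimage_gen) (auto simp: invf_def)
    moreover have "D \<inter> nprod G (g x) -` {0<..} = U x" by (auto simp: U_def)
    ultimately show ?thesis by simp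
  qed
  moreover have "D \<subseteq> \<Union> (U ` D)" using g(2) nprod_pos_iff[OF finG] by (force simp: U_def)
  ultimately obtain \<U> where "\<U> \<subseteq> U ` D" "finite \<U>" "D \<subseteq> \<Union> \<U>"
    using D(1) unfolding compact_eq_openin_cover by (metis (no_types, lifting) image_iff)
  then obtain I where I: "I \<subseteq> D" "finite I" "D \<subseteq> \<Union> (U ` I)"
    using finite_subset_image by metis
  have w: "weight k D (g a k)" if "a \<in> I" "k \<in> G" for a k
    using g(1) that I(1) DS weight_subset by blast
  have nz: "\<exists>a\<in>I. \<forall>k\<in>G. g a k x \<noteq> 0" if "x \<in> D" for x
    using I(3) that nprod_pos_iff[OF finG] by (force simp: U_def)
  obtain \<phi> :: "pt \<Rightarrow> pt \<Rightarrow> real" where \<phi>: "\<And>b. b \<in> I \<Longrightarrow> invf D (\<phi> b)"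
    "\<And>b x. b \<in> I \<Longrightarrow> x \<in> D \<Longrightarrow> 0 \<le> \<phi> b x"
    "\<And>x. x \<in> D \<Longrightarrow> \<exists>b\<in>I. \<phi> b x > 0"
    "\<And>b x k. b \<in> I \<Longrightarrow> x \<in> D \<Longrightarrow> \<phi> b x > 0 \<Longrightarrow> k \<in> G \<Longrightarrow> g b k x \<noteq> 0"
    "\<And>x. x \<in> D \<Longrightarrow> card {b \<in> I. \<phi> b x > 0} \<le> 2 ^ N"
    by (rule order_reduction[OF G D I(2) w nz]) blast+
  obtain F :: "nat \<Rightarrow> (nat \<Rightarrow> int) \<Rightarrow> pt \<Rightarrow> complex" where
    F: "\<And>c k. k \<in> G \<Longrightarrow> weight k D (F c k)" "\<And>x. x \<in> D \<Longrightarrow> \<exists>c<2 ^ N. \<forall>k\<in>G. F c k x \<noteq> 0"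
    by (rule colouring[OF I(2) w \<phi>]) blast+
  \<comment> \<open>Of \<open>F c k\<close> only the nonvanishing is to be kept, so its extension
    may be divided by a bound on the compact \<open>S\<close>.\<close>
  define Q where "Q c k h \<longleftrightarrow> k \<in> G \<longrightarrow>
    weight k S h \<and> (\<forall>x\<in>S. norm (h x) \<le> 1) \<and> (\<forall>x\<in>D. F c k x \<noteq> 0 \<longrightarrow> h x \<noteq> 0)" for c k h
  have ex: "\<exists>h. Q c k h" for c k
  proof (cases "k \<in> G")
    case True
    obtain h where h: "weight k S h" "\<And>x. x \<in> D \<Longrightarrow> h x = F c k x"
      using weight_extend[OF D(2) compact_imp_closed[OF D(1)] F(1)[OF True]] by metis
    have "compact (h ` S)" using h(1) compact_S by (auto simp: weight_def intro: compact_continuous_image)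
    then obtain B where B: "B > 0" "\<And>x. x \<in> S \<Longrightarrow> norm (h x) \<le> B"
      using compact_imp_bounded bounded_pos by (metis image_eqI)
    have "weight k S (\<lambda>x. of_real (1 / B) * h x)" by (rule weight_scale[OF h(1)])
    then show ?thesis unfolding Q_def
      using B h(2) by (intro exI[of _ "\<lambda>x. of_real (1 / B) * h x"]) (auto simp: norm_mult norm_divide divide_simps)
  qed (auto simp: Q_def)
  define H where "H c k = (SOME h. Q c k h)" for c k
  have "Q c k (H c k)" for c k unfolding H_def by (rule someI_ex[OF ex])
  then have H: "\<And>c k. k \<in> G \<Longrightarrow> weight k S (H c k)"
    "\<And>c k x. k \<in> G \<Longrightarrow> x \<in> S \<Longrightarrow> norm (H c k x) \<le> 1"
    "\<And>c k x. k \<in> G \<Longrightarrow> x \<in> D \<Longrightarrow> F c k x \<noteq> 0 \<Longrightarrow> H c k x \<noteq> 0" by (auto simp: Q_def)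
  have "\<exists>c<2 ^ N. \<forall>k\<in>G. H c k x \<noteq> 0" if "x \<in> D" for x
  proof -
    from F(2)[OF that] obtain c where "c < 2 ^ N" "\<forall>k\<in>G. F c k x \<noteq> 0" by blast
    then show ?thesis using H(3) that by blast
  qed
  then show ?thesis using that[of H] H by blast
qed

end

section \<open>Strata and the separating family\<close>

context lattice_action
begin

definition fixset :: "pt set \<Rightarrow> pt set" where
  "fixset K = {x \<in> S. K \<subseteq> stab x}"

lemma closed_fixset: assumes "K \<subseteq> rvec l" shows "closed (fixset K)"
proof -
  have "closed {x \<in> S. dist (\<theta> v x) x = 0}" if "v \<in> K" for v
  proof (intro continuous_closed_preimage_constant continuous_on_dist act_compose_cont)
    show "(\<lambda>x. v) ` S \<subseteq> rvec l" using that assms by auto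
  qed (auto simp: compact_S compact_imp_closed)
  then have "closed (S \<inter> (\<Inter>v\<in>K. {x \<in> S. dist (\<theta> v x) x = 0}))"
    by (intro closed_Int closed_INT compact_imp_closed compact_S) auto
  moreover have "S \<inter> (\<Inter>v\<in>K. {x \<in> S. dist (\<theta> v x) x = 0}) = fixset K"
    using assms by (auto simp: fixset_def stab_def)
  ultimately show ?thesis by simp
qed

lemma inv_set_fixset: "inv_set (fixset K)"
  by (auto simp: inv_set_def fixset_def act_closed stab_act)

lemma stab_sub: "stab x \<subseteq> rvec l" by (auto simp: stab_def)

text \<open>The integral of a nonnegative continuous function vanishes only if the integrand does,
  in particular at parameter 0. Conversely the circle through a point of \<open>Z\<close> stays in
  \<open>Z\<close>.\<close>

lemma avg_zero_set:
  fixes r :: "pt \<Rightarrow> real"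
  assumes "i < l" "inv_set Z" "continuous_on S r" "\<And>x. x \<in> S \<Longrightarrow> 0 \<le> r x" "\<And>x. x \<in> S \<Longrightarrow> r x = 0 \<longleftrightarrow> x \<in> Z"
  obtains r' :: "pt \<Rightarrow> real" where "\<And>x. x \<in> S \<Longrightarrow> avg i 0 (\<lambda>x. of_real (r x)) x = of_real (r' x)"
    "\<And>x. x \<in> S \<Longrightarrow> 0 \<le> r' x" "\<And>x. x \<in> S \<Longrightarrow> r' x = 0 \<longleftrightarrow> x \<in> Z"
proof
  define r' where "r' x = integral {0..1} (\<lambda>s. r (\<theta> (axis_vec i s) x))" for x
  have cont: "continuous_on UNIV (\<lambda>s. r (\<theta> (axis_vec i s) x))" if "x \<in> S" for x
  proof -
    have "continuous_on UNIV (\<lambda>s. Re (of_real (r (\<theta> (axis_vec i s) x))))"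
      by (intro continuous_on_Re cont_along_axis[OF assms(1) inv_set_S _ that] continuous_on_of_real assms(3))
    then show ?thesis by simp
  qed
  note int = continuous_UNIV_imp_integrable[OF cont]
  fix x assume x: "x \<in> S"
  have "((\<lambda>s. of_real (r (\<theta> (axis_vec i s) x)) :: complex) has_integral of_real (r' x)) {0..1}"
    unfolding r'_def by (intro has_integral_of_real integrable_integral int x)
  then show "avg i 0 (\<lambda>x. of_real (r x)) x = of_real (r' x)"
    by (simp add: avg_def integral_unique)
  have mem: "\<theta> (axis_vec i s) x \<in> S" for s using x assms(1) by (simp add: act_closed rvec_axis)
  show nn: "0 \<le> r' x" unfolding r'_def
    by (intro Henstock_Kurzweil_Integration.integral_nonneg int x) (use mem assms(4) in auto)
  show "r' x = 0 \<longleftrightarrow> x \<in> Z"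
  proof
    assume "x \<in> Z"
    then have "\<theta> (axis_vec i s) x \<in> Z" for s using assms(1,2) by (simp add: inv_setD rvec_axis)
    then have "r (\<theta> (axis_vec i s) x) = 0" for s using assms(5) mem by blast
    then show "r' x = 0" by (simp add: r'_def)
  next
    assume 0: "r' x = 0"
    have "((\<lambda>s. r (\<theta> (axis_vec i s) x)) has_integral 0) (cbox 0 1)"
      using integrable_integral[OF int[OF x, of 0 1]] 0 by (simp add: r'_def)
    then have "r (\<theta> (axis_vec i 0) x) = 0"
      by (rule has_integral_0_cbox_imp_0[rotated 2])
        (use mem assms(4) in \<open>auto intro: continuous_on_subset[OF cont[OF x]]\<close>)
    then show "x \<in> Z" using assms(5)[OF x] act_axis_int[OF assms(1) x, of 0] by simp
  qed
qed

text \<open>The distance to \<open>Z\<close> is averaged over all circles; nonnegativity and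
  invariance of \<open>Z\<close> keep the zero set at each step. The cap 1/2 is the range in which
  \<open>shell_cover\<close> applies.\<close>

lemma invariant_zero_function:
  assumes Z: "inv_set Z" "closed Z"
  obtains d where "invf S d" "\<And>x. x \<in> S \<Longrightarrow> 0 \<le> d x" "\<And>x. x \<in> S \<Longrightarrow> d x \<le> 1 / 2"
    "\<And>x. x \<in> S \<Longrightarrow> d x = 0 \<longleftrightarrow> x \<in> Z"
proof (cases "Z = {}")
  case True
  \<comment> \<open>The distance to the empty set is 0 by convention, hence a constant
    instead.\<close>
  then show ?thesis by (intro that[of "\<lambda>_. 1 / 2"]) (auto simp: invf_const)
next
  case False
  have c: "continuous_on S (\<lambda>x. of_real (infdist x Z) :: complex)"
    by (intro continuous_on_of_real continuous_on_infdist continuous_on_id)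
  have "\<exists>r. (\<forall>x\<in>S. Avg n (\<lambda>_. 0) (\<lambda>x. of_real (infdist x Z)) x = of_real (r x)) \<and> (\<forall>x\<in>S. 0 \<le> r x) \<and>
     (\<forall>x\<in>S. r x = 0 \<longleftrightarrow> x \<in> Z)" if "n \<le> l" for n
    using that
  proof (induction n)
    case 0
    show ?case
      using Z(2) False by (intro exI[of _ "\<lambda>x. infdist x Z"]) (auto simp: infdist_nonneg in_closed_iff_infdist_zero)
  next
    case (Suc n)
    then obtain r where r: "\<And>x. x \<in> S \<Longrightarrow> Avg n (\<lambda>_. 0) (\<lambda>x. of_real (infdist x Z)) x = of_real (r x)"
      "\<And>x. x \<in> S \<Longrightarrow> 0 \<le> r x" "\<And>x. x \<in> S \<Longrightarrow> r x = 0 \<longleftrightarrow> x \<in> Z" by force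
    have n: "n < l" using Suc by simp
    have "continuous_on S (\<lambda>x. Re (Avg n (\<lambda>_. 0) (\<lambda>x. of_real (infdist x Z)) x))"
      using Avg_props[OF inv_set_S c, of n] n by (intro continuous_on_Re) simp
    then have "continuous_on S r" by (simp add: r(1) cong: continuous_on_cong)
    then obtain r' where r': "\<And>x. x \<in> S \<Longrightarrow> avg n 0 (\<lambda>x. of_real (r x)) x = of_real (r' x)"
      "\<And>x. x \<in> S \<Longrightarrow> 0 \<le> r' x" "\<And>x. x \<in> S \<Longrightarrow> r' x = 0 \<longleftrightarrow> x \<in> Z"
      by (rule avg_zero_set[OF n Z(1) _ r(2,3)]) blast+
    have "avg n 0 (Avg n (\<lambda>_. 0) (\<lambda>x. of_real (infdist x Z))) x = avg n 0 (\<lambda>x. of_real (r x)) x" if "x \<in> S" for x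
      using that n by (simp add: avg_def r(1) act_closed rvec_axis)
    then show ?case using r' by (intro exI[of _ r']) simp
  qed
  from this[OF order_refl] obtain r where
    r: "\<And>x. x \<in> S \<Longrightarrow> Avg l (\<lambda>_. 0) (\<lambda>x. of_real (infdist x Z)) x = of_real (r x)"
      "\<And>x. x \<in> S \<Longrightarrow> 0 \<le> r x" "\<And>x. x \<in> S \<Longrightarrow> r x = 0 \<longleftrightarrow> x \<in> Z" by force
  have "weight (\<lambda>_. 0) S (Avg l (\<lambda>_. 0) (\<lambda>x. of_real (infdist x Z)))"
    by (rule weight_Avg[OF inv_set_S c])
  then have "weight (\<lambda>_. 0) S (\<lambda>x. of_real (r x))"
    by (auto simp: weight_def r(1) act_closed cong: continuous_on_cong)
  then have "invf S r" by (simp add: invf_weight)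
  then have "invf S (\<lambda>x. min (1 / 2) (r x))"
    by (auto simp: invf_def intro: continuous_on_min)
  moreover have "min (1 / 2) (r x) = 0 \<longleftrightarrow> r x = 0" for x by (auto simp: min_def)
  ultimately show ?thesis using r(2,3) by (intro that[of "\<lambda>x. min (1 / 2) (r x)"]) simp_all
qed

text \<open>A bump on the interval from \<open>1 / (n + 3)\<close> to \<open>1 / (n + 1)\<close>.
  Neighbouring intervals overlap, so that no value is missed, while two intervals of equal parity
  are disjoint.\<close>

definition shell :: "nat \<Rightarrow> real \<Rightarrow> real" where
  "shell n u = max 0 ((u - 1 / real (n + 3)) * (1 / real (n + 1) - u))"

lemma shell_nonneg: "0 \<le> shell n u" by (simp add: shell_def)

lemma shell_pos_iff: "0 < shell n u \<longleftrightarrow> 1 / real (n + 3) < u \<and> u < 1 / real (n + 1)"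
proof -
  have "1 / real (n + 3) < 1 / real (n + 1)" by (simp add: field_simps)
  then show ?thesis by (auto simp: shell_def zero_less_mult_iff less_max_iff_disj)
qed

lemma shell_le_1: "shell n u \<le> 1"
proof (cases "0 < shell n u")
  case True
  then have u: "1 / real (n + 3) < u" "u < 1 / real (n + 1)" by (auto simp: shell_pos_iff)
  have "0 < 1 / real (n + 3)" "1 / real (n + 1) \<le> 1" by auto
  then have "(u - 1 / real (n + 3)) * (1 / real (n + 1) - u) \<le> 1 * 1"
    using u by (intro mult_mono) linarith+
  then show ?thesis by (simp add: shell_def)
qed simp

lemma shell_unique:
  assumes "0 < shell n u" "0 < shell m u" "even n = even m"
  shows "n = m"
proof (rule ccontr)
  assume "n \<noteq> m"
  have "\<not> (n + 2 \<le> m \<and> 0 < shell n u \<and> 0 < shell m u)" for n m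
  proof
    assume *: "n + 2 \<le> m \<and> 0 < shell n u \<and> 0 < shell m u"
    then have "1 / real (n + 3) < u" "u < 1 / real (m + 1)" by (auto simp: shell_pos_iff)
    moreover have "1 / real (m + 1) \<le> 1 / real (n + 3)" using * by (intro divide_left_mono) auto
    ultimately show False by linarith
  qed
  moreover have "n + 2 \<le> m \<or> m + 2 \<le> n" using \<open>n \<noteq> m\<close> assms(3) by presburger
  ultimately show False using assms by blast
qed

lemma shell_cover:
  assumes "0 < u" "u \<le> 1 / 2"
  obtains n where "0 < shell n u"
proof -
  \<comment> \<open>\<open>n + 2\<close> is the integer part of \<open>1 / u\<close>, which puts
    \<open>1 / u\<close> strictly between \<open>n + 1\<close> and \<open>n + 3\<close>. By
    \<open>u \<le> 1 / 2\<close> the subtraction of natural numbers is exact.\<close>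
  define n where "n = nat \<lfloor>1 / u\<rfloor> - 2"
  have "2 \<le> 1 / u" using assms by (simp add: field_simps)
  then have "2 \<le> \<lfloor>1 / u\<rfloor>" by linarith
  then have n: "int n = \<lfloor>1 / u\<rfloor> - 2" unfolding n_def by linarith
  then have "of_int (int n) = (of_int (\<lfloor>1 / u\<rfloor> - 2) :: real)" by simp
  then have "real n = of_int \<lfloor>1 / u\<rfloor> - 2" by simp
  then have "real n + 2 \<le> 1 / u" "1 / u < real n + 3" by linarith+
  then have "(real n + 2) * u \<le> 1" "1 < (real n + 3) * u"
    using assms(1) by (simp_all add: pos_divide_less_eq pos_le_divide_eq)
  then have "1 / real (n + 3) < u \<and> u < 1 / real (n + 1)"
    using assms(1) by (simp add: pos_divide_less_eq pos_less_divide_eq algebra_simps)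
  then show ?thesis using that shell_pos_iff by blast
qed

text \<open>The compact sets \<open>D n\<close> approach the points with larger stabilizer, and each
  comes with tuples for the same finite set of colours. Within one parity class at most one bump is
  positive at a point, so the summands cannot cancel.\<close>

lemma stratum_functions:
  assumes x0: "x0 \<in> S" and fin: "finite (stab ` S)" and G: "basis_for (stab x0) G"
  obtains d and E :: "bool \<times> nat \<Rightarrow> (nat \<Rightarrow> int) \<Rightarrow> pt \<Rightarrow> complex" and J where "finite J" "invf S d" "\<And>x. x \<in> S \<Longrightarrow> 0 \<le> d x"
    "\<And>x. x \<in> fixset (stab x0) \<Longrightarrow> 0 < d x \<longleftrightarrow> stab x = stab x0"
    "\<And>q k. k \<in> G \<Longrightarrow> weight k S (E q k)"
    "\<And>x. x \<in> S \<Longrightarrow> stab x = stab x0 \<Longrightarrow> \<exists>q\<in>J. \<forall>k\<in>G. E q k x \<noteq> 0"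
proof -
  define K where "K = stab x0"
  \<comment> \<open>The points of \<open>fixset K\<close> with a stabilizer larger than
    \<open>K\<close>. Finitely many orbit types make this a finite union of closed sets.\<close>
  define Z where "Z = (\<Union>K'\<in>{K' \<in> stab ` S. K \<subset> K'}. fixset K')"
  have Zi: "inv_set Z" using inv_set_fixset unfolding Z_def inv_set_def by fast
  have "closed (fixset K')" if "K' \<in> stab ` S" for K'
    using that stab_sub by (intro closed_fixset) auto
  then have Zc: "closed Z" unfolding Z_def using fin by (intro closed_UN) auto
  obtain d where d: "invf S d" "\<And>x. x \<in> S \<Longrightarrow> 0 \<le> d x" "\<And>x. x \<in> S \<Longrightarrow> d x \<le> 1 / 2"
    "\<And>x. x \<in> S \<Longrightarrow> d x = 0 \<longleftrightarrow> x \<in> Z"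
    using invariant_zero_function[OF Zi Zc] by metis
  have dK: "0 < d x \<longleftrightarrow> stab x = K" if "x \<in> fixset K" for x
  proof -
    have x: "x \<in> S" "K \<subseteq> stab x" using that by (auto simp: fixset_def)
    have "x \<in> Z \<longleftrightarrow> stab x \<noteq> K" using x by (auto simp: Z_def fixset_def)
    then show ?thesis using d(2,4)[OF x(1)] by (auto simp: order_less_le)
  qed
  define D where "D n = {x \<in> fixset K. 1 / real (n + 3) \<le> d x \<and> d x \<le> 1 / real (n + 1)}" for n
  have FS: "fixset K \<subseteq> S" by (auto simp: fixset_def)
  have Fc: "closed (fixset K)" unfolding K_def by (intro closed_fixset stab_sub)
  have dF: "continuous_on (fixset K) d" using d(1) FS by (auto simp: invf_def intro: continuous_on_subset)
  have D: "compact (D n)" "inv_set (D n)" "\<And>x. x \<in> D n \<Longrightarrow> stab x = K" for n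
  proof -
    have "D n = {x \<in> fixset K. 1 / real (n + 3) \<le> d x} \<inter> {x \<in> fixset K. d x \<le> 1 / real (n + 1)}"
      by (auto simp: D_def)
    then have "closed (D n)"
      by (simp only:) (intro closed_Int continuous_on_closed_Collect_le continuous_on_const dF Fc)
    moreover have "D n = S \<inter> D n" using FS by (auto simp: D_def)
    ultimately show "compact (D n)" using compact_Int_closed[OF compact_S] by metis
    show "inv_set (D n)"
      using inv_set_fixset[of K] d(1) FS unfolding inv_set_def D_def invf_def by auto
    show "stab x = K" if "x \<in> D n" for x
    proof -
      have "0 < 1 / real (n + 3)" by simp
      moreover have "1 / real (n + 3) \<le> d x" using that by (simp add: D_def)
      ultimately have "0 < d x" by linarith
      then show ?thesis using dK that by (simp add: D_def)
    qed
  qed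
  have "\<exists>F :: nat \<Rightarrow> (nat \<Rightarrow> int) \<Rightarrow> pt \<Rightarrow> complex. (\<forall>c. \<forall>k\<in>G. weight k S (F c k)) \<and>
      (\<forall>c. \<forall>k\<in>G. \<forall>x\<in>S. norm (F c k x) \<le> 1) \<and> (\<forall>x\<in>D n. \<exists>c<2 ^ N. \<forall>k\<in>G. F c k x \<noteq> 0)" for n
    by (rule bounded_cover_functions[OF G[folded K_def] D]) blast+
  then obtain F :: "nat \<Rightarrow> nat \<Rightarrow> (nat \<Rightarrow> int) \<Rightarrow> pt \<Rightarrow> complex" where
    F: "\<And>n c k. k \<in> G \<Longrightarrow> weight k S (F n c k)" "\<And>n c k x. k \<in> G \<Longrightarrow> x \<in> S \<Longrightarrow> norm (F n c k x) \<le> 1"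
      "\<And>n x. x \<in> D n \<Longrightarrow> \<exists>c<2 ^ N. \<forall>k\<in>G. F n c k x \<noteq> 0" by metis
  \<comment> \<open>The index \<open>q\<close> consists of a parity and a colour. The factor
    \<open>(1/2)^n\<close> gives uniform convergence, since all \<open>F n c k\<close> are bounded
    by 1 on \<open>S\<close>.\<close>
  define e where "e q k n x = (if even n = fst q then of_real ((1/2)^n * shell n (d x)) * F n (snd q) k x else 0)"
    for q :: "bool \<times> nat" and k n x
  define E where "E q k x = (\<Sum>n. e q k n x)" for q k x
  have ew: "weight k S (e q k n)" if "k \<in> G" for q k n
  proof (cases "even n = fst q")
    case True
    have "invf S (\<lambda>x. (1/2)^n * shell n (d x))"
      unfolding shell_def by (intro invf_mult invf_max invf_diff invf_const d(1))
    from weight_mult_invf[OF this F(1)[OF that]] show ?thesis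
      using True by (simp add: e_def[abs_def])
  next
    case False
    then show ?thesis by (simp add: e_def[abs_def] weight_def)
  qed
  have eb: "norm (e q k n x) \<le> (1/2)^n" if "k \<in> G" "x \<in> S" for q k n x
  proof -
    have "norm (of_real ((1/2)^n * shell n (d x)) * F n (snd q) k x) \<le> ((1/2)^n * 1) * 1"
      unfolding norm_mult norm_of_real abs_mult using shell_nonneg[of n "d x"] shell_le_1[of n "d x"] F(2)[OF that]
      by (intro mult_mono) auto
    then show ?thesis by (simp add: e_def)
  qed
  have geo: "summable (\<lambda>n. (1/2::real)^n)" by (intro summable_geometric) simp
  have Ew: "weight k S (E q k)" if k: "k \<in> G" for q k
    unfolding weight_def
  proof (intro conjI ballI)
    have ul: "uniform_limit S (\<lambda>n x. \<Sum>i<n. e q k i x) (\<lambda>x. \<Sum>i. e q k i x) sequentially"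
      by (rule Weierstrass_m_test[OF eb[OF k] geo])
    have "continuous_on S (\<lambda>x. \<Sum>i<n. e q k i x)" for n
      by (intro continuous_on_sum) (use ew[OF k, unfolded weight_def] in blast)
    then show "continuous_on S (E q k)"
      unfolding E_def[abs_def]
      by (intro uniform_limit_theorem[OF _ ul] always_eventually allI) auto
    fix v x assume vx: "v \<in> rvec l" "x \<in> S"
    have "summable (\<lambda>n. e q k n x)"
      by (rule summable_comparison_test'[OF geo, of 0]) (use eb[OF k vx(2)] in auto)
    moreover have "e q k n (\<theta> v x) = e2 (ipair l k v) * e q k n x" for n
      using ew[OF k] vx by (simp add: weight_def)
    ultimately show "E q k (\<theta> v x) = e2 (ipair l k v) * E q k x"
      by (simp add: E_def suminf_mult)
  qed
  have Enz: "\<exists>q\<in>UNIV \<times> {..<2 ^ N}. \<forall>k\<in>G. E q k x \<noteq> 0" if x: "x \<in> S" "stab x = K" for x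
  proof -
    have xF: "x \<in> fixset K" using x by (simp add: fixset_def)
    then have "0 < d x" using dK x by simp
    then obtain n where n: "0 < shell n (d x)" using shell_cover d(3)[OF x(1)] by metis
    then have "x \<in> D n" using xF by (auto simp: D_def shell_pos_iff less_imp_le)
    then obtain c where c: "c < 2 ^ N" "\<forall>k\<in>G. F n c k x \<noteq> 0" using F(3) by blast
    have "E (even n, c) k x \<noteq> 0" if "k \<in> G" for k
    proof -
      \<comment> \<open>A shell of the same parity that contains \<open>d x\<close> is shell
        \<open>n\<close> itself, and the other parity is left out of this sum; a single nonzero term
        remains.\<close>
      have "e (even n, c) k m x = 0" if "m \<noteq> n" for m
      proof (cases "even m = even n")
        case True
        then have "\<not> 0 < shell m (d x)" using shell_unique[OF n, of m] that by blast
        then have "shell m (d x) = 0" using shell_nonneg[of m "d x"] by linarith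
        then show ?thesis by (simp add: e_def)
      qed (simp add: e_def)
      then have "E (even n, c) k x = e (even n, c) k n x"
        unfolding E_def by (subst suminf_finite[of "{n}"]) auto
      then show ?thesis using n c that by (simp add: e_def)
    qed
    then show ?thesis using c by (intro bexI[of _ "(even n, c)"]) auto
  qed
  show ?thesis
    by (rule that[of "UNIV \<times> {..<2 ^ N}" d E]) (use d Ew Enz dK in \<open>auto simp: K_def\<close>)
qed


text \<open>The slice coordinate \<open>g\<close> has no limit in general where \<open>w\<close>
  tends to 0, but it is bounded, so the product with \<open>w\<close> extends by 0. Cutting off at
  level \<open>e n\<close> gives continuous functions \<open>f n\<close>, as only the sets where
  \<open>w\<close> is at least \<open>e n\<close> are involved; the error
  \<open>min (w x) (e n) * g x\<close> is uniformly at most \<open>e n * B\<close>.\<close>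

lemma slice_coordinate_cont:
  assumes A: "A \<subseteq> S" "closed A" and w: "continuous_on A w" "\<And>x. x \<in> A \<Longrightarrow> 0 \<le> w x"
    and g: "\<And>\<epsilon>. \<epsilon> > 0 \<Longrightarrow> continuous_on {x \<in> A. \<epsilon> \<le> w x} g"
    and B: "\<And>x. x \<in> A \<Longrightarrow> 0 < w x \<Longrightarrow> \<bar>g x\<bar> \<le> B" "0 \<le> B"
  shows "continuous_on A (\<lambda>x. if w x \<le> 0 then 0 else w x * g x :: real)"
proof -
  let ?h = "\<lambda>x. if w x \<le> 0 then 0 else w x * g x"
  define e where "e n = inverse (real (Suc n))" for n
  have e: "0 < e n" for n by (simp add: e_def)
  define f where "f n x = (if w x \<le> e n then 0 else (w x - e n) * g x)" for n x
  have c: "continuous_on A (f n)" for n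
    unfolding f_def
  proof (rule continuous_on_cases_le[OF _ _ w(1)])
    have "continuous_on {x \<in> A. e n \<le> w x} w" by (rule continuous_on_subset[OF w(1)]) auto
    then show "continuous_on {x \<in> A. e n \<le> w x} (\<lambda>x. (w x - e n) * g x)"
      by (intro continuous_on_mult continuous_on_diff continuous_on_const g e)
  qed auto
  have ul: "uniform_limit A f ?h sequentially"
  proof (rule uniform_limitI)
    fix \<epsilon> :: real assume \<epsilon>: "\<epsilon> > 0"
    have "(\<lambda>n. e n * B) \<longlonglongrightarrow> 0 * B" unfolding e_def by (intro tendsto_mult LIMSEQ_inverse_real_of_nat tendsto_const)
    then have "\<forall>\<^sub>F n in sequentially. e n * B < \<epsilon>" using \<epsilon> by (auto dest: order_tendstoD(2))
    then show "\<forall>\<^sub>F n in sequentially. \<forall>x\<in>A. dist (f n x) (?h x) < \<epsilon>"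
    proof eventually_elim
      case (elim n)
      show ?case
      proof
        fix x assume x: "x \<in> A"
        show "dist (f n x) (?h x) < \<epsilon>"
        proof (cases "0 < w x")
          case False
          then show ?thesis using \<epsilon> e[of n] by (simp add: f_def not_less)
        next
          case True
          have "f n x - ?h x = - (min (w x) (e n) * g x)"
            using True by (auto simp: f_def min_def algebra_simps)
          then have "\<bar>f n x - ?h x\<bar> = \<bar>min (w x) (e n)\<bar> * \<bar>g x\<bar>" by (simp only: abs_minus abs_mult)
          also have "\<dots> \<le> e n * B"
            using True B(1)[OF x True] e[of n] B(2) by (intro mult_mono) (auto simp: min_def)
          finally show ?thesis using elim by (simp add: dist_real_def)
        qed
      qed
    qed
  qed
  show ?thesis by (rule uniform_limit_theorem[OF always_eventually[OF allI[OF c]] ul]) simp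
qed

text \<open>The last clause says that the characters of the functions not vanishing at
  \<open>x\<close> determine its stabilizer. It is what distinguishes points of different
  strata.\<close>

definition separates_stratum :: "pt set \<Rightarrow> ((nat \<Rightarrow> int) \<times> (pt \<Rightarrow> complex)) set \<Rightarrow> bool" where
  "separates_stratum K W \<longleftrightarrow> finite W \<and> (\<forall>k f. (k, f) \<in> W \<longrightarrow> weight k S f) \<and>
    (\<forall>x\<in>S. \<forall>y\<in>S. stab x = K \<longrightarrow> stab y = K \<longrightarrow> (\<forall>k f. (k, f) \<in> W \<longrightarrow> f x = f y) \<longrightarrow> x = y) \<and>
    (\<forall>x\<in>S. \<forall>v\<in>rvec l. stab x = K \<longrightarrow> (\<forall>k f. (k, f) \<in> W \<longrightarrow> f x \<noteq> 0 \<longrightarrow> ipair l k v \<in> \<int>) \<longrightarrow> v \<in> K)"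

text \<open>\<open>W\<close> contains the tuples \<open>E q\<close>, their cutoffs
  \<open>w q\<close> and the slice coordinates times \<open>w q\<close>. If all agree at two points
  of the stratum, then for a suitable \<open>q\<close> the slice points coincide, so the points lie
  on one orbit; agreement of the nonzero values of \<open>E q k\<close> makes the vector between
  them pair integrally with the basis, hence fix the point.\<close>

lemma stratum_separation:
  assumes x0: "x0 \<in> S" and fin: "finite (stab ` S)"
  shows "\<exists>W. separates_stratum (stab x0) W"
proof -
  define K where "K = stab x0"
  obtain G where G: "basis_for K G" using basis_for_exists[OF x0] unfolding K_def by metis
  have finG: "finite G" using G by (simp add: basis_for_def)
  obtain d :: "pt \<Rightarrow> real" and E :: "bool \<times> nat \<Rightarrow> (nat \<Rightarrow> int) \<Rightarrow> pt \<Rightarrow> complex" and J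
    where J: "finite J" and d: "invf S d" "\<And>x. x \<in> S \<Longrightarrow> 0 \<le> d x"
    "\<And>x. x \<in> fixset K \<Longrightarrow> 0 < d x \<longleftrightarrow> stab x = K"
    and E: "\<And>q k. k \<in> G \<Longrightarrow> weight k S (E q k)"
    "\<And>x. x \<in> S \<Longrightarrow> stab x = K \<Longrightarrow> \<exists>q\<in>J. \<forall>k\<in>G. E q k x \<noteq> 0"
    by (rule stratum_functions[OF x0 fin G[unfolded K_def], folded K_def]) blast+
  define A where "A = fixset K"
  have A: "A \<subseteq> S" "closed A" "inv_set A"
    using closed_fixset[OF stab_sub] inv_set_fixset by (auto simp: A_def K_def fixset_def)
  \<comment> \<open>The factor \<open>d\<close> makes \<open>w q\<close> vanish at the points of
    \<open>fixset K\<close> with larger stabilizer, where \<open>G\<close> is not a basis; on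
    \<open>fixset K\<close> it is positive exactly where the slice of \<open>E q\<close> is
    available.\<close>
  define w where "w q x = d x * nprod G (E q) x" for q x
  have wi: "invf S (w q)" for q
    unfolding w_def[abs_def] by (intro invf_mult d(1) invf_nprod E(1))
  have wA: "continuous_on A (w q)" for q
    using wi[of q] A(1) by (auto simp: invf_def intro: continuous_on_subset)
  have w0: "0 \<le> w q x" if "x \<in> S" for q x
    unfolding w_def using d(2)[OF that] nprod_nonneg by (intro mult_nonneg_nonneg)
  have wpos: "0 < w q x \<longleftrightarrow> stab x = K \<and> (\<forall>k\<in>G. E q k x \<noteq> 0)" if "x \<in> A" for q x
  proof -
    have "0 < w q x \<longleftrightarrow> 0 < d x \<and> 0 < nprod G (E q) x"
      using d(2)[of x] A(1) that nprod_nonneg[of G "E q" x] by (auto simp: w_def zero_less_mult_iff)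
    then show ?thesis using d(3)[of x] that by (simp add: A_def nprod_pos_iff[OF finG])
  qed
  obtain B where B: "\<And>x j. x \<in> S \<Longrightarrow> j < N \<Longrightarrow> \<bar>x j\<bar> \<le> B" "0 \<le> B"
    using compact_coordinates_bounded[OF compact_S, of N] by metis
  define \<pi> where "\<pi> q = slice G (E q)" for q
  have \<pi>o: "\<pi> q x \<in> orbit_of x" if "x \<in> A" "0 < w q x" for q x
    unfolding \<pi>_def using wpos[OF that(1)] that G A(1) by (intro slice_in_orbit) auto
  have \<pi>S: "\<pi> q x \<in> S" if "x \<in> A" "0 < w q x" for q x
    using \<pi>o[OF that] orbit_of_sub[OF inv_set_S, of x] that A(1) by blast
  define h where "h q j x = (if w q x \<le> 0 then 0 else w q x * \<pi> q x j)" for q j x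
  have "invf A (h q j)" if j: "j < N" for q j
    unfolding invf_def
  proof (intro conjI ballI)
    show "continuous_on A (h q j)"
      unfolding h_def[abs_def]
    proof (rule slice_coordinate_cont[OF A(1,2) wA])
      show "\<bar>\<pi> q x j\<bar> \<le> B" if "x \<in> A" "0 < w q x" for x using B(1)[OF \<pi>S[OF that] j] .
    next
      fix \<epsilon> :: real assume \<epsilon>: "\<epsilon> > 0"
      let ?D = "{x \<in> A. \<epsilon> \<le> w q x}"
      have "closed ?D" by (intro continuous_on_closed_Collect_le continuous_on_const wA A(2))
      then have "compact (S \<inter> ?D)" by (rule compact_Int_closed[OF compact_S])
      moreover have "S \<inter> ?D = ?D" using A(1) by auto
      ultimately have "compact ?D" by (simp only:)
      moreover have pos: "0 < w q x" if "x \<in> ?D" for x using that \<epsilon> by auto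
      ultimately have "continuous_on ?D (\<pi> q)"
        unfolding \<pi>_def
      proof (intro slice_cont[OF G])
        show "stab x = K" if "x \<in> ?D" for x using wpos[of x q] pos[OF that] that by blast
        show "E q k x \<noteq> 0" if "k \<in> G" "x \<in> ?D" for k x using wpos[of x q] pos[OF that(2)] that by blast
        show "continuous_on ?D (E q k)" if "k \<in> G" for k
          using E(1)[OF that, of q] A(1) unfolding weight_def by (auto elim!: continuous_on_subset)
      qed (use A(1) in auto)
      then show "continuous_on ?D (\<lambda>x. \<pi> q x j)" by (rule continuous_on_product_then_coordinatewise)
    qed (use w0 A(1) B(2) in blast)+
    fix v x assume vx: "v \<in> rvec l" "x \<in> A"
    have weq: "w q (\<theta> v x) = w q x" using wi[of q] vx A(1) unfolding invf_def by blast
    show "h q j (\<theta> v x) = h q j x"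
    proof (cases "0 < w q x")
      case True
      have "\<pi> q (\<theta> v x) = \<pi> q x"
        unfolding \<pi>_def
      proof (rule slice_inv[OF _ _ _ vx(1)])
        show "basis_for (stab x) G" "x \<in> S" using wpos[OF vx(2), of q] True G vx(2) A(1) by auto
        show "E q k x \<noteq> 0" if "k \<in> G" for k using wpos[OF vx(2), of q] True that by blast
        show "E q k (\<theta> v x) = e2 (ipair l k v) * E q k x" if "k \<in> G" for k
          using E(1)[OF that, of q] vx A(1) unfolding weight_def by blast
      qed
      then show ?thesis by (simp add: h_def weq)
    qed (simp add: h_def weq)
  qed
  then have hw: "weight (\<lambda>_. 0) A (\<lambda>x. of_real (h q j x))" if "j < N" for q j
    using that by (simp flip: invf_weight)
  have ex: "\<exists>H. weight (\<lambda>_. 0) S H \<and> (\<forall>x\<in>A. H x = of_real (h q j x))" if j: "j < N" for q j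
  proof -
    obtain g where "weight (\<lambda>_. 0) S g" "\<And>x. x \<in> A \<Longrightarrow> g x = of_real (h q j x)"
      by (rule weight_extend[OF A(3,2) hw[OF j, of q]]) blast
    then show ?thesis by blast
  qed
  define H where "H q j = (SOME H. weight (\<lambda>_. 0) S H \<and> (\<forall>x\<in>A. H x = of_real (h q j x)))" for q j
  have "weight (\<lambda>_. 0) S (H q j) \<and> (\<forall>x\<in>A. H q j x = of_real (h q j x))" if "j < N" for q j
    unfolding H_def by (rule someI_ex[OF ex[OF that]])
  then have H: "\<And>q j. j < N \<Longrightarrow> weight (\<lambda>_. 0) S (H q j)"
    "\<And>q j x. j < N \<Longrightarrow> x \<in> A \<Longrightarrow> H q j x = of_real (h q j x)"
    by blast+
  define W where "W = (\<lambda>(q, k). (k, E q k)) ` (J \<times> G) \<union> (\<lambda>q. ((\<lambda>_. 0), (\<lambda>x. of_real (w q x)))) ` J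
    \<union> (\<lambda>(q, j). ((\<lambda>_. 0), H q j)) ` (J \<times> {..<N})"
  have W: "(k, E q k) \<in> W" "((\<lambda>_. 0), (\<lambda>x. of_real (w q x))) \<in> W" "j < N \<Longrightarrow> ((\<lambda>_. 0), H q j) \<in> W"
    if "q \<in> J" "k \<in> G" for q k j using that by (force simp: W_def)+
  have W2: "((\<lambda>_. 0), (\<lambda>x. of_real (w q x))) \<in> W" "j < N \<Longrightarrow> ((\<lambda>_. 0), H q j) \<in> W"
    if "q \<in> J" for q j using that by (force simp: W_def)+
  have "separates_stratum K W"
    unfolding separates_stratum_def
  proof (intro conjI allI ballI impI)
    show "finite W" unfolding W_def using J finG by auto
    show "weight k S f" if "(k, f) \<in> W" for k f
      using that E(1) H(1) wi by (auto simp: W_def invf_weight)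
    show "v \<in> K" if x: "x \<in> S" "stab x = K" and v: "v \<in> rvec l"
      and eq: "\<forall>k f. (k, f) \<in> W \<longrightarrow> f x \<noteq> 0 \<longrightarrow> ipair l k v \<in> \<int>" for x v
    proof -
      obtain q where "q \<in> J" "\<forall>k\<in>G. E q k x \<noteq> 0" using E(2)[OF x] by blast
      then have "\<forall>k\<in>G. ipair l k v \<in> \<int>" using eq W(1) by blast
      then show ?thesis using G v by (auto simp: basis_for_def)
    qed
    show "x = y" if x: "x \<in> S" "stab x = K" and y: "y \<in> S" "stab y = K"
      and eq': "\<forall>k f. (k, f) \<in> W \<longrightarrow> f x = f y" for x y
    proof -
      have eq: "f x = f y" if "(k, f) \<in> W" for k f using eq' that by blast
      have A': "x \<in> A" "y \<in> A" using x y by (auto simp: A_def fixset_def)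
      obtain q where q: "q \<in> J" "\<forall>k\<in>G. E q k x \<noteq> 0" using E(2)[OF x] by blast
      have wx: "0 < w q x" using wpos[OF A'(1)] q x by blast
      have "w q x = w q y" using eq[OF W2(1)[OF q(1)]] by simp
      then have wy: "0 < w q y" using wx by simp
      have "\<pi> q x j = \<pi> q y j" for j
      proof (cases "j < N")
        case True
        have "h q j x = h q j y" using eq[OF W2(2)[OF q(1) True]] H(2)[OF True] A' by simp
        then show ?thesis using wx wy \<open>w q x = w q y\<close> by (simp add: h_def)
      next
        case False
        then show ?thesis using subsetD[OF S_sub \<pi>S[OF A'(1) wx]] subsetD[OF S_sub \<pi>S[OF A'(2) wy]] by simp
      qed
      then have "\<pi> q x = \<pi> q y" by auto
      then obtain u v where uv: "u \<in> rvec l" "v \<in> rvec l" "\<theta> u x = \<theta> v y"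
        using \<pi>o[OF A'(1) wx] \<pi>o[OF A'(2) wy] by (auto simp: orbit_of_def)
      have yx: "y = \<theta> (\<lambda>i. - v i + u i) x"
        using uv x(1) y(1) act_cancel(1)[OF uv(2) y(1)] act_add[OF rvec_uminus[OF uv(2)] uv(1) x(1)] by simp
      let ?z = "\<lambda>i. - v i + u i"
      have z: "?z \<in> rvec l" by (rule rvec_add[OF rvec_uminus[OF uv(2)] uv(1)])
      have "ipair l k ?z \<in> \<int>" if "k \<in> G" for k
      proof -
        have "E q k y = e2 (ipair l k ?z) * E q k x"
          using E(1)[OF that, of q] z x(1) unfolding yx by (simp add: weight_def)
        moreover have "E q k x = E q k y" using eq[OF W(1)[OF q(1) that]] .
        moreover have "E q k x \<noteq> 0" using q(2) that by blast
        ultimately show ?thesis by (simp flip: e2_eq_1_iff)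
      qed
      then have "?z \<in> stab x" using G z x(2) by (auto simp: basis_for_def)
      then show ?thesis using yx by (simp add: stab_def)
    qed
  qed
  then show ?thesis unfolding K_def by blast
qed

text \<open>Equal values force equal stabilizers: a function that is nonzero at \<open>y\<close> is
  nonzero at \<open>x\<close>, so its character is trivial on \<open>stab x\<close>, and the family
  of the stratum of \<open>y\<close> then yields \<open>stab x \<subseteq> stab y\<close>. By
  symmetry both points lie in one stratum, whose own family separates them.\<close>

theorem finite_separating_weights:
  assumes fin: "finite (stab ` S)"
  obtains W where "finite W" "\<And>k f. (k, f) \<in> W \<Longrightarrow> weight k S f"
    "\<And>x y. x \<in> S \<Longrightarrow> y \<in> S \<Longrightarrow> (\<And>k f. (k, f) \<in> W \<Longrightarrow> f x = f y) \<Longrightarrow> x = y"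
proof -
  have "\<forall>K\<in>stab ` S. \<exists>V. separates_stratum K V" using stratum_separation fin by blast
  then obtain V where V: "\<And>K. K \<in> stab ` S \<Longrightarrow> separates_stratum K (V K)" by metis
  define W where "W = (\<Union>K\<in>stab ` S. V K)"
  have le: "stab x \<subseteq> stab y" if x: "x \<in> S" and y: "y \<in> S" and eq: "\<And>k f. (k, f) \<in> W \<Longrightarrow> f x = f y" for x y
  proof
    fix v assume v: "v \<in> stab x"
    have PV: "separates_stratum (stab y) (V (stab y))" using V y by blast
    have "\<forall>k f. (k, f) \<in> V (stab y) \<longrightarrow> f y \<noteq> 0 \<longrightarrow> ipair l k v \<in> \<int>"
    proof (intro allI impI)
      fix k f assume kf: "(k, f) \<in> V (stab y)" "f y \<noteq> 0"
      then have "(k, f) \<in> W" using y by (auto simp: W_def)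
      then have "f x \<noteq> 0" using eq kf by metis
      moreover have "weight k S f" using PV kf by (auto simp: separates_stratum_def)
      ultimately show "ipair l k v \<in> \<int>" using stab_weight x v by blast
    qed
    then show "v \<in> stab y" using PV y v stab_sub unfolding separates_stratum_def by blast
  qed
  show ?thesis
  proof (rule that[of W])
    show "finite W" unfolding W_def by (rule finite_UN_I[OF fin]) (use V in \<open>simp add: separates_stratum_def\<close>)
    show "weight k S f" if "(k, f) \<in> W" for k f using that V by (fastforce simp: W_def separates_stratum_def)
    show "x = y" if x: "x \<in> S" and y: "y \<in> S" and eq: "\<And>k f. (k, f) \<in> W \<Longrightarrow> f x = f y" for x y
    proof -
      have "stab x \<subseteq> stab y" using le[OF x y] eq by blast
      moreover have "stab y \<subseteq> stab x" by (rule le[OF y x]) (rule eq[symmetric])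
      ultimately have "stab x = stab y" by (rule subset_antisym)
      moreover have "separates_stratum (stab y) (V (stab y))" using V y by blast
      moreover have "\<forall>k f. (k, f) \<in> V (stab y) \<longrightarrow> f x = f y" using eq y by (auto simp: W_def)
      ultimately show ?thesis using x y unfolding separates_stratum_def by blast
    qed
  qed
qed

end

section \<open>Embedding compact subspaces of manifolds\<close>

lemma chart_at_point:
  assumes loc: "locally_Euclidean_space d M" and hom: "X homeomorphic_space subtopology M S"
    and x: "x \<in> topspace X"
  obtains U c where "openin X U" "x \<in> U" "continuous_map (subtopology X U) (Euclidean_space d) c" "inj_on c U"
proof -
  obtain f where f: "homeomorphic_map X (subtopology M S) f"
    using hom by (auto simp: homeomorphic_space)
  then have fc: "continuous_map X M f" and fi: "inj_on f (topspace X)"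
    by (auto simp: homeomorphic_eq_everything_map continuous_map_in_subtopology)
  have "f x \<in> topspace M" using fc x by (auto simp: continuous_map_def)
  then obtain W V where W: "openin M W" "f x \<in> W"
    and hW: "subtopology M W homeomorphic_space subtopology (Euclidean_space d) V"
    using loc unfolding locally_Euclidean_space_def by blast
  obtain g where g: "homeomorphic_map (subtopology M W) (subtopology (Euclidean_space d) V) g"
    using hW by (auto simp: homeomorphic_space)
  then have gc: "continuous_map (subtopology M W) (Euclidean_space d) g" and gi: "inj_on g (topspace (subtopology M W))"
    by (auto simp: homeomorphic_eq_everything_map continuous_map_in_subtopology)
  define U where "U = {y \<in> topspace X. f y \<in> W}"
  show ?thesis
  proof
    show "openin X U" unfolding U_def by (rule openin_continuous_map_preimage[OF fc W(1)])
    show "x \<in> U" using x W by (simp add: U_def)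
    have "continuous_map (subtopology X U) (subtopology M W) f"
      using fc by (auto simp: continuous_map_in_subtopology U_def intro: continuous_map_from_subtopology)
    from continuous_map_compose[OF this gc]
    show "continuous_map (subtopology X U) (Euclidean_space d) (g \<circ> f)" .
    have "f ` U \<subseteq> topspace (subtopology M W)" using W(1) openin_subset by (fastforce simp: U_def)
    then show "inj_on (g \<circ> f) U"
      by (intro comp_inj_on inj_on_subset[OF gi]) (auto simp: U_def intro: inj_on_subset[OF fi])
  qed
qed

lemma finite_separating_embedding:
  assumes "finite \<F>" "\<And>f. f \<in> \<F> \<Longrightarrow> continuous_map X euclideanreal f"
    and sep: "\<And>x y. x \<in> topspace X \<Longrightarrow> y \<in> topspace X \<Longrightarrow> (\<And>f. f \<in> \<F> \<Longrightarrow> f x = f y) \<Longrightarrow> x = y"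
  obtains N E where "continuous_map X (Euclidean_space N) E" "inj_on E (topspace X)"
proof -
  obtain b where b: "bij_betw b {0..<card \<F>} \<F>" using ex_bij_betw_nat_finite[OF assms(1)] by blast
  define E where "E x = (\<lambda>i. if i < card \<F> then b i x else 0)" for x
  show ?thesis
  proof
    show "continuous_map X (Euclidean_space (card \<F>)) E"
      unfolding E_def[abs_def]
      by (subst continuous_map_componentwise_Euclidean_space)
        (use bij_betwE[OF b] assms(2) in simp)
    show "inj_on E (topspace X)"
    proof
      fix x y assume xy: "x \<in> topspace X" "y \<in> topspace X" "E x = E y"
      show "x = y"
      proof (rule sep[OF xy(1,2)])
        fix f assume "f \<in> \<F>"
        then have "f \<in> b ` {0..<card \<F>}" by (simp add: bij_betw_imp_surj_on[OF b])
        then obtain i where "i < card \<F>" "f = b i" by auto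
        then show "f x = f y" using fun_cong[OF xy(3), of i] by (simp add: E_def)
      qed
    qed
  qed
qed

text \<open>Each point gets a Urysohn function \<open>\<phi>\<close> that vanishes outside its
  chart, and Tietze extensions of the chart coordinates. If all functions agree at \<open>y\<close>
  and \<open>z\<close>, a \<open>\<phi>\<close> exceeding 1/2 at \<open>y\<close> places both points
  in one chart, where the coordinates are injective.\<close>

lemma compact_locally_embedded_imp_embedded:
  assumes comp: "compact_space X" and haus: "Hausdorff_space X"
    and ch: "\<And>x. x \<in> topspace X \<Longrightarrow> \<exists>U c. openin X U \<and> x \<in> U \<and>
      continuous_map (subtopology X U) (Euclidean_space d) c \<and> inj_on c U"
  obtains N E where "continuous_map X (Euclidean_space N) E" "inj_on E (topspace X)"
proof -
  have norm: "normal_space X"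
    using compact_Hausdorff_or_regular_imp_normal_space comp haus by blast
  define P where "P x \<phi> g \<longleftrightarrow> continuous_map X euclideanreal \<phi> \<and> (\<forall>j<d. continuous_map X euclideanreal (g j)) \<and>
      \<phi> x = (1::real) \<and> (\<forall>y\<in>topspace X. \<forall>z\<in>topspace X. 1 / 2 \<le> \<phi> y \<longrightarrow> 1 / 2 \<le> \<phi> z \<longrightarrow>
        (\<forall>j<d. g j y = (g j z::real)) \<longrightarrow> y = z)" for x \<phi> and g :: "nat \<Rightarrow> 'a \<Rightarrow> real"
  have ex: "\<exists>\<phi> g. P x \<phi> g" if x: "x \<in> topspace X" for x
  proof -
    obtain U c where U: "openin X U" "x \<in> U" "continuous_map (subtopology X U) (Euclidean_space d) c" "inj_on c U"
      using ch[OF x] by blast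
    have "closedin X {x}" using haus x by (simp add: closedin_Hausdorff_sing_eq)
    moreover have "closedin X (topspace X - U)" using U(1) by blast
    moreover have "disjnt {x} (topspace X - U)" using U(2) by (simp add: disjnt_def)
    ultimately obtain \<phi> where \<phi>: "continuous_map X euclideanreal \<phi>" "\<phi> ` {x} \<subseteq> {1::real}" "\<phi> ` (topspace X - U) \<subseteq> {0}"
      using Urysohn_lemma_alt[OF norm] by metis
    \<comment> \<open>A closed level set, as Tietze requires. The open cover \<open>O'\<close> uses
      the strict inequality at the same level, so its members stay inside the sets where the
      extensions are true coordinates.\<close>
    define C where "C = {y \<in> topspace X. \<phi> y \<in> {1/2..}}"
    have C: "closedin X C" unfolding C_def by (rule closedin_continuous_map_preimage[OF \<phi>(1)]) simp
    have CU: "C \<subseteq> U" using \<phi>(3) by (force simp: C_def)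
    have "\<exists>g. continuous_map X euclideanreal g \<and> (\<forall>y\<in>C. g y = c y j)" for j
    proof -
      have "continuous_map (subtopology X C) (Euclidean_space d) c"
        using continuous_map_from_subtopology_mono[OF U(3) CU] .
      then have "continuous_map (subtopology X C) (powertop_real UNIV) c"
        by (simp add: Euclidean_space_def continuous_map_in_subtopology)
      then have cj: "continuous_map (subtopology X C) euclideanreal (\<lambda>y. c y j)"
        by (simp add: continuous_map_componentwise_UNIV)
      obtain g where "continuous_map X euclideanreal g" "\<And>y. y \<in> C \<Longrightarrow> g y = c y j"
        by (rule Tietze_extension_realinterval[OF norm C _ _ cj, of UNIV]) auto
      then show ?thesis by blast
    qed
    then obtain g where g: "\<And>j. continuous_map X euclideanreal (g j)" "\<And>j y. y \<in> C \<Longrightarrow> g j y = c y j" by metis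
    have "y = z" if yz: "y \<in> C" "z \<in> C" and eq: "\<forall>j<d. g j y = g j z" for y z
    proof -
      have "c y \<in> topspace (Euclidean_space d)" "c z \<in> topspace (Euclidean_space d)"
        using U(3) yz CU C closedin_subset[OF C] by (auto simp: continuous_map_def)
      then have "c y j = c z j" for j
        using eq g(2) yz by (cases "j < d") (auto simp: topspace_Euclidean_space)
      then show ?thesis using U(4) yz CU by (metis ext inj_onD subsetD)
    qed
    then show ?thesis
      unfolding P_def using \<phi>(1,2) g(1) by (intro exI[of _ \<phi>] exI[of _ g]) (auto simp: C_def)
  qed
  define \<phi> where "\<phi> x = (SOME \<phi>. \<exists>g. P x \<phi> g)" for x
  define g where "g x = (SOME g. P x (\<phi> x) g)" for x
  have P: "P x (\<phi> x) (g x)" if "x \<in> topspace X" for x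
  proof -
    have "\<exists>g. P x (\<phi> x) g" unfolding \<phi>_def by (rule someI_ex[OF ex[OF that]])
    then show ?thesis unfolding g_def by (rule someI_ex)
  qed
  have \<phi>: "\<And>x. x \<in> topspace X \<Longrightarrow> continuous_map X euclideanreal (\<phi> x)" "\<And>x. x \<in> topspace X \<Longrightarrow> \<phi> x x = 1"
    and g: "\<And>x j. x \<in> topspace X \<Longrightarrow> j < d \<Longrightarrow> continuous_map X euclideanreal (g x j)"
    and sep: "\<And>x y z. x \<in> topspace X \<Longrightarrow> y \<in> topspace X \<Longrightarrow> z \<in> topspace X \<Longrightarrow> 1 / 2 \<le> \<phi> x y \<Longrightarrow> 1 / 2 \<le> \<phi> x z \<Longrightarrow>
       (\<forall>j<d. g x j y = g x j z) \<Longrightarrow> y = z"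
    using P unfolding P_def by simp_all
  define O' where "O' x = {y \<in> topspace X. \<phi> x y \<in> {1/2<..}}" for x
  have "openin X (O' x)" if "x \<in> topspace X" for x
    unfolding O'_def by (rule openin_continuous_map_preimage[OF \<phi>(1)[OF that]]) simp
  then have "\<forall>U \<in> O' ` topspace X. openin X U" by blast
  moreover have "topspace X \<subseteq> \<Union> (O' ` topspace X)" using \<phi>(2) by (force simp: O'_def)
  ultimately obtain \<G> where "finite \<G>" "\<G> \<subseteq> O' ` topspace X" "topspace X \<subseteq> \<Union> \<G>"
    using comp unfolding compact_space_alt by (metis (no_types, lifting))
  then obtain I where I: "I \<subseteq> topspace X" "finite I" "topspace X \<subseteq> \<Union> (O' ` I)"
    using finite_subset_image by metis
  define \<F> where "\<F> = \<phi> ` I \<union> (\<lambda>(x, j). g x j) ` (I \<times> {..<d})"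
  show ?thesis
  proof (rule finite_separating_embedding[of \<F> X])
    show "finite \<F>" unfolding \<F>_def using I(2) by auto
    show "continuous_map X euclideanreal f" if "f \<in> \<F>" for f using that \<phi>(1) g I(1) by (auto simp: \<F>_def)
    fix y z assume yz: "y \<in> topspace X" "z \<in> topspace X" and eq: "\<And>f. f \<in> \<F> \<Longrightarrow> f y = f z"
    obtain x where x: "x \<in> I" "1 / 2 < \<phi> x y" using I(3) yz(1) by (force simp: O'_def)
    have "\<phi> x \<in> \<F>" "\<And>j. j < d \<Longrightarrow> g x j \<in> \<F>" using x(1) unfolding \<F>_def by auto
    then have "\<phi> x y = \<phi> x z" "\<forall>j<d. g x j y = g x j z" using eq by blast+
    then show "y = z" using sep[of x y z] x yz I(1) by auto
  qed (rule that)
qed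

lemma compact_in_manifold_embeds:
  assumes "compact_space X" "topological_manifold M" "X homeomorphic_space subtopology M S"
  obtains N E where "continuous_map X (Euclidean_space N) E" "inj_on E (topspace X)"
proof -
  obtain d where d: "locally_Euclidean_space d M" using assms(2) by (auto simp: topological_manifold_def)
  have "Hausdorff_space X"
    using assms(2,3) homeomorphic_Hausdorff_space Hausdorff_space_subtopology
    unfolding topological_manifold_def by blast
  moreover have "\<exists>U c. openin X U \<and> x \<in> U \<and>
      continuous_map (subtopology X U) (Euclidean_space d) c \<and> inj_on c U" if "x \<in> topspace X" for x
    using chart_at_point[OF d assms(3) that] by metis
  ultimately show ?thesis using compact_locally_embedded_imp_embedded[OF assms(1)] that by metis
qed

section \<open>The matrix exponential and linear differential equations\<close>

lemma smult_pow_mat_index: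
  fixes B :: "real mat"
  assumes B: "B \<in> carrier_mat n n" and "i < n" "j < n"
  shows "((t \<cdot>\<^sub>m B) ^\<^sub>m k) $$ (i, j) = t ^ k * (B ^\<^sub>m k) $$ (i, j)"
proof -
  have "(t \<cdot>\<^sub>m B) ^\<^sub>m k = t ^ k \<cdot>\<^sub>m (B ^\<^sub>m k)"
  proof (induction k)
    case 0
    show ?case by (rule eq_matI) (use B in auto)
  next
    case (Suc k)
    have c: "B ^\<^sub>m k \<in> carrier_mat n n" using B by simp
    have "(t \<cdot>\<^sub>m B) ^\<^sub>m Suc k = t \<cdot>\<^sub>m (t ^ k \<cdot>\<^sub>m (B ^\<^sub>m k * B))"
      using Suc B c by (simp add: mult_smult_assoc_mat[of _ n n] mult_smult_distrib[of _ n n])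
    also have "\<dots> = t ^ Suc k \<cdot>\<^sub>m (B ^\<^sub>m Suc k)"
      by (rule eq_matI) auto
    finally show ?case .
  qed
  then show ?thesis using assms pow_carrier_mat[OF B, of k] by simp
qed

lemma pow_mat_Suc_index:
  fixes B :: "real mat"
  assumes B: "B \<in> carrier_mat n n" and "i < n" "j < n"
  shows "(B ^\<^sub>m Suc k) $$ (i, j) = (\<Sum>m<n. (B ^\<^sub>m k) $$ (i, m) * B $$ (m, j))"
  using assms pow_carrier_mat[OF B, of k] by (auto simp: scalar_prod_def lessThan_atLeast0)

lemma mat_exp_index:
  assumes B: "B \<in> carrier_mat n n" and "i < n" "j < n"
  shows "mat_exp (t \<cdot>\<^sub>m B) $$ (i, j) = (\<Sum>k. ((B ^\<^sub>m k) $$ (i, j) / fact k) * t ^ k)"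
  using assms unfolding mat_exp_def by (simp add: smult_pow_mat_index[OF assms] mult.commute)

lemma mat_exp_carrier: "B \<in> carrier_mat n n \<Longrightarrow> mat_exp (t \<cdot>\<^sub>m B) \<in> carrier_mat n n"
  by (simp add: mat_exp_def)

lemma mat_exp_0_index:
  assumes "B \<in> carrier_mat n n" "i < n" "j < n"
  shows "mat_exp (0 \<cdot>\<^sub>m B) $$ (i, j) = (if i = j then 1 else 0)"
proof -
  have "mat_exp (0 \<cdot>\<^sub>m B) $$ (i, j) = (B ^\<^sub>m 0) $$ (i, j) / fact 0"
    unfolding mat_exp_index[OF assms] by (rule powser_zero)
  then show ?thesis using assms by (simp add: one_mat_def)
qed

text \<open>Termwise differentiation: coefficient \<open>k\<close> of the derived series is an entry
  of the power \<open>k + 1\<close> of \<open>B\<close> over \<open>fact k\<close>, and the last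
  factor \<open>B\<close> splits off on the right.\<close>

lemma DERIV_mat_exp_index:
  assumes B: "B \<in> carrier_mat n n" and ij: "i < n" "j < n"
  shows "((\<lambda>t. mat_exp (t \<cdot>\<^sub>m B) $$ (i, j)) has_real_derivative
    (\<Sum>m<n. mat_exp (t \<cdot>\<^sub>m B) $$ (i, m) * B $$ (m, j))) (at t)"
proof -
  define c where "c m k = (B ^\<^sub>m k) $$ (i, m) / fact k" for m k
  have sum: "summable (\<lambda>k. c m k * t ^ k)" if "m < n" for m t
  proof -
    have "t \<cdot>\<^sub>m B \<in> carrier_mat n n" using B by simp
    from summable_mat_exp[OF this ij(1) that]
    show ?thesis by (simp add: c_def smult_pow_mat_index[OF B ij(1) that] mult.commute)
  qed
  have "diffs (c j) k = (\<Sum>m<n. c m k * B $$ (m, j))" for k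
  proof -
    have "diffs (c j) k = (B ^\<^sub>m Suc k) $$ (i, j) / fact k"
      unfolding diffs_def c_def by (simp del: pow_mat.simps of_nat_Suc)
    then show ?thesis
      by (simp add: pow_mat_Suc_index[OF B ij] c_def sum_divide_distrib del: pow_mat.simps)
  qed
  then have "(\<Sum>k. diffs (c j) k * t ^ k) = (\<Sum>k. \<Sum>m<n. (c m k * t ^ k) * B $$ (m, j))"
    by (simp add: sum_distrib_left sum_distrib_right mult_ac)
  also have "\<dots> = (\<Sum>m<n. \<Sum>k. (c m k * t ^ k) * B $$ (m, j))"
    by (intro suminf_sum summable_mult2 sum) auto
  also have "\<dots> = (\<Sum>m<n. (\<Sum>k. c m k * t ^ k) * B $$ (m, j))"
    by (intro sum.cong refl suminf_mult2[symmetric] sum) auto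
  finally have eq: "(\<Sum>k. diffs (c j) k * t ^ k) = (\<Sum>m<n. mat_exp (t \<cdot>\<^sub>m B) $$ (i, m) * B $$ (m, j))"
    using mat_exp_index[OF B ij(1)] by (simp add: c_def)
  have f: "(\<lambda>t. mat_exp (t \<cdot>\<^sub>m B) $$ (i, j)) = (\<lambda>t. \<Sum>k. c j k * t ^ k)"
    by (rule ext) (simp only: mat_exp_index[OF B ij] c_def)
  show ?thesis
    unfolding f eq[symmetric] by (rule termdiffs_strong_converges_everywhere[OF sum[OF ij(2)]])
qed

lemma mult_mat_vec_index:
  assumes "A \<in> carrier_mat n n" "i < n"
  shows "(A *\<^sub>v Matrix.vec n y) $ i = (\<Sum>j<n. A $$ (i, j) * y j)"
  using assms by (auto simp: scalar_prod_def lessThan_atLeast0)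

text \<open>The curve \<open>z\<close>, coordinate \<open>i\<close> of the exponential at time
  \<open>t - s\<close> applied to \<open>y s\<close>, is constant in \<open>s\<close>: the two parts
  of the product rule are the same double sum with opposite signs. Its values at
  \<open>s = t\<close> and \<open>s = 0\<close> are the two sides.\<close>

lemma linear_ode_solution:
  fixes y :: "real \<Rightarrow> nat \<Rightarrow> real"
  assumes B: "B \<in> carrier_mat n n"
    and ode: "\<And>i t. i < n \<Longrightarrow> ((\<lambda>t. y t i) has_real_derivative (\<Sum>j<n. B $$ (i, j) * y t j)) (at t)"
  shows "Matrix.vec n (y t) = mat_exp (t \<cdot>\<^sub>m B) *\<^sub>v Matrix.vec n (y 0)"
proof (rule eq_vecI)
  fix i assume "i < dim_vec (mat_exp (t \<cdot>\<^sub>m B) *\<^sub>v Matrix.vec n (y 0))"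
  then have i: "i < n" using mat_exp_carrier[OF B, of t] by simp
  let ?M = "\<lambda>s j. mat_exp (s \<cdot>\<^sub>m B) $$ (i, j)"
  define z where "z s = (\<Sum>j<n. ?M (t - s) j * y s j)" for s
  have "(z has_real_derivative 0) (at s)" for s
  proof -
    have d: "((\<lambda>s. ?M (t - s) j) has_real_derivative (\<Sum>m<n. ?M (t - s) m * B $$ (m, j)) * (- 1)) (at s)"
      if "j < n" for j
      by (rule DERIV_chain2[OF DERIV_mat_exp_index[OF B i that]]) (auto intro!: derivative_eq_intros)
    have zd: "(z has_real_derivative (\<Sum>j<n. (\<Sum>m<n. ?M (t - s) m * B $$ (m, j)) * (- 1) * y s j
        + (\<Sum>m<n. B $$ (j, m) * y s m) * ?M (t - s) j)) (at s)"
      unfolding z_def by (intro DERIV_sum DERIV_mult d ode) auto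
    have "(\<Sum>j<n. \<Sum>m<n. ?M (t - s) m * B $$ (m, j) * y s j) = (\<Sum>j<n. \<Sum>m<n. ?M (t - s) j * B $$ (j, m) * y s m)"
      by (rule sum.swap)
    moreover have "(\<Sum>j<n. (\<Sum>m<n. ?M (t - s) m * B $$ (m, j)) * (- 1) * y s j)
        = - (\<Sum>j<n. \<Sum>m<n. ?M (t - s) m * B $$ (m, j) * y s j)"
      by (simp add: sum_distrib_right sum_negf)
    moreover have "(\<Sum>j<n. (\<Sum>m<n. B $$ (j, m) * y s m) * ?M (t - s) j)
        = (\<Sum>j<n. \<Sum>m<n. ?M (t - s) j * B $$ (j, m) * y s m)"
      by (simp add: sum_distrib_left sum_distrib_right mult_ac)
    ultimately have "(\<Sum>j<n. (\<Sum>m<n. ?M (t - s) m * B $$ (m, j)) * (- 1) * y s j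
        + (\<Sum>m<n. B $$ (j, m) * y s m) * ?M (t - s) j) = 0"
      unfolding sum.distrib by linarith
    then show ?thesis using zd by simp
  qed
  then have "z t = z 0" using DERIV_isconst_all by blast
  moreover have "z t = (\<Sum>j<n. (if i = j then 1 else 0) * y t j)"
    unfolding z_def using mat_exp_0_index[OF B i] by (intro sum.cong) auto
  then have "z t = y t i" using i by (simp add: if_distrib[of "\<lambda>x. x * _"] sum.delta cong: if_cong)
  moreover have "z 0 = (mat_exp (t \<cdot>\<^sub>m B) *\<^sub>v Matrix.vec n (y 0)) $ i"
    unfolding z_def mult_mat_vec_index[OF mat_exp_carrier[OF B] i] by simp
  ultimately show "Matrix.vec n (y t) $ i = (mat_exp (t \<cdot>\<^sub>m B) *\<^sub>v Matrix.vec n (y 0)) $ i"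
    using i by simp
qed (use mat_exp_carrier[OF B, of t] in simp)

text \<open>Conversely a one-parameter group of exponentials solves the equation; by the group property
  it suffices to differentiate at 0.\<close>

lemma linear_flow_ode:
  fixes y :: "real \<Rightarrow> nat \<Rightarrow> real"
  assumes B: "B \<in> carrier_mat n n" and i: "i < n"
    and flow: "\<And>s t. Matrix.vec n (y (s + t)) = mat_exp (s \<cdot>\<^sub>m B) *\<^sub>v Matrix.vec n (y t)"
  shows "((\<lambda>t. y t i) has_real_derivative (\<Sum>j<n. B $$ (i, j) * y t j)) (at t)"
proof -
  have eq: "y (s + t) i = (\<Sum>j<n. mat_exp (s \<cdot>\<^sub>m B) $$ (i, j) * y t j)" for s
  proof -
    have "y (s + t) i = Matrix.vec n (y (s + t)) $ i" using i by simp
    then show ?thesis unfolding flow mult_mat_vec_index[OF mat_exp_carrier[OF B] i] .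
  qed
  have "(\<Sum>m<n. mat_exp (0 \<cdot>\<^sub>m B) $$ (i, m) * B $$ (m, j)) = B $$ (i, j)" if "j < n" for j
  proof -
    have "(\<Sum>m<n. mat_exp (0 \<cdot>\<^sub>m B) $$ (i, m) * B $$ (m, j)) = (\<Sum>m<n. (if i = m then 1 else 0) * B $$ (m, j))"
      using mat_exp_0_index[OF B i] by (intro sum.cong) auto
    then show ?thesis using i by (simp add: if_distrib[of "\<lambda>x. x * _"] sum.delta cong: if_cong)
  qed
  then have "((\<lambda>s. mat_exp (s \<cdot>\<^sub>m B) $$ (i, j)) has_real_derivative B $$ (i, j)) (at 0)" if "j < n" for j
    using DERIV_mat_exp_index[OF B i that, of 0] that by simp
  then have "((\<lambda>s. \<Sum>j<n. mat_exp (s \<cdot>\<^sub>m B) $$ (i, j) * y t j) has_real_derivative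
      (\<Sum>j<n. B $$ (i, j) * y t j)) (at 0)"
    by (intro DERIV_sum DERIV_cmult_right) simp
  then have "((\<lambda>s. y (s + t) i) has_real_derivative (\<Sum>j<n. B $$ (i, j) * y t j)) (at 0)"
    by (simp add: eq)
  then show ?thesis
    using DERIV_shift[of "\<lambda>t. y t i" _ 0 t] by simp
qed

section \<open>From torus actions to linearizing embeddings\<close>

lemma topspace_Euclidean_rvec: "topspace (Euclidean_space l) = rvec l"
  by (simp add: topspace_Euclidean_space rvec_def)

lemma Euclidean_space_top_of_set: "Euclidean_space l = top_of_set (rvec l)"
  by (simp add: Euclidean_space_def euclidean_product_topology rvec_def)

lemma compact_continuous_injective_imp_embedding:
  assumes "compact_space X" "Hausdorff_space Y" "continuous_map X Y f" "inj_on f (topspace X)"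
  shows "embedding_map X Y f"
  using assms by (intro injective_closed_imp_embedding_map continuous_imp_closed_map_gen Hausdorff_imp_kc_space)

lemma torus_proj_hom: "torus_proj l \<in> hom (real_vec_group l) (torus l)"
  using normal.r_coset_hom_Mod[OF normal_int_lattice[of l]]
  unfolding torus_def torus_proj_def[abs_def] .

lemma torus_proj_closed: "v \<in> rvec l \<Longrightarrow> torus_proj l v \<in> carrier (torus l)"
  by (simp add: carrier_torus topspace_Euclidean_rvec)

lemma torus_proj_add:
  "u \<in> rvec l \<Longrightarrow> v \<in> rvec l \<Longrightarrow>
    torus_proj l (\<lambda>i. u i + v i) = torus_proj l u \<otimes>\<^bsub>torus l\<^esub> torus_proj l v"
  using hom_mult[OF torus_proj_hom, of u l v] by (simp add: real_vec_group_def topspace_Euclidean_rvec)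

lemma torus_proj_int:
  assumes "v \<in> rvec l" "\<And>i. v i \<in> \<int>"
  shows "torus_proj l v = \<one>\<^bsub>torus l\<^esub>"
proof -
  have "torus_proj l (\<lambda>i. 0) = \<one>\<^bsub>torus l\<^esub>"
    using group_hom.hom_one[of "real_vec_group l" "torus l" "torus_proj l"] torus_proj_hom group_torus
      comm_group.axioms(2)[OF comm_group_real_vec_group[of l]]
    by (simp add: group_hom_def group_hom_axioms_def real_vec_group_def)
  moreover have "torus_proj l v = torus_proj l (\<lambda>i. 0)"
    using assms rvec_0 by (subst torus_proj_eq_iff) (auto simp: topspace_Euclidean_rvec)
  ultimately show ?thesis by simp
qed

text \<open>A complex coordinate turning at constant speed is a rotation of a real plane, and
  compactness makes the separating family an embedding. \<open>linear_ode_solution\<close>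
  identifies the rotations with the matrix exponential.\<close>

lemma flow_of_rotations_linearizing:
  fixes \<beta> :: "nat \<Rightarrow> real"
  assumes f: "\<And>j x t. j < m \<Longrightarrow> x \<in> topspace X \<Longrightarrow> f j (\<Phi> t x) = cis (\<beta> j * t) * f j x"
    and cont: "\<And>j. j < m \<Longrightarrow> continuous_map X euclidean (f j)"
    and sep: "\<And>x y. x \<in> topspace X \<Longrightarrow> y \<in> topspace X \<Longrightarrow> (\<And>j. j < m \<Longrightarrow> f j x = f j y) \<Longrightarrow> x = y"
    and comp: "compact_space X"
  shows "linearizable_by_C0_embedding X \<Phi>"
proof -
  define F where "F x = (\<lambda>i. if i < 2 * m then (if even i then Re (f (i div 2) x) else Im (f (i div 2) x)) else 0)" for x
  \<comment> \<open>One rotation block per complex coordinate: even positions hold real parts, odd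
    ones imaginary parts, and \<open>i div 2\<close> is the number of the block in both
    branches.\<close>
  define B where "B = Matrix.mat (2 * m) (2 * m) (\<lambda>(i, j).
    if even i \<and> j = Suc i then - \<beta> (i div 2) else if even j \<and> i = Suc j then \<beta> (i div 2) else 0)"
  have B: "B \<in> carrier_mat (2 * m) (2 * m)" by (simp add: B_def)
  have Fc: "continuous_map X (Euclidean_space (2 * m)) F"
    unfolding F_def[abs_def]
  proof (subst continuous_map_componentwise_Euclidean_space, intro allI impI)
    fix i assume "i < 2 * m"
    then have c: "continuous_map X euclidean (f (i div 2))" by (intro cont) simp
    have "continuous_map euclidean euclideanreal Re" "continuous_map euclidean euclideanreal Im"
      by (auto intro: continuous_intros)
    from this[THEN continuous_map_compose[OF c]]
    show "continuous_map X euclideanreal (\<lambda>x. if even i then Re (f (i div 2) x) else Im (f (i div 2) x))"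
      by (cases "even i") (simp_all add: o_def)
  qed
  have "inj_on F (topspace X)"
  proof
    fix x y assume xy: "x \<in> topspace X" "y \<in> topspace X" and eq: "F x = F y"
    have "f j x = f j y" if "j < m" for j
      using fun_cong[OF eq, of "2 * j"] fun_cong[OF eq, of "Suc (2 * j)"] that
      by (simp add: F_def complex_eq_iff)
    then show "x = y" using sep xy by blast
  qed
  then have emb: "embedding_map X (Euclidean_space (2 * m)) F"
    by (intro compact_continuous_injective_imp_embedding comp Hausdorff_Euclidean_space Fc)
  have lin: "Matrix.vec (2 * m) (F (\<Phi> t x)) = mat_exp (t \<cdot>\<^sub>m B) *\<^sub>v Matrix.vec (2 * m) (F x)"
    if x: "x \<in> topspace X" for t x
  proof -
    define y where "y t i = (if even i then Re (cis (\<beta> (i div 2) * t) * f (i div 2) x)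
      else Im (cis (\<beta> (i div 2) * t) * f (i div 2) x))" for t and i :: nat
    have "Matrix.vec (2 * m) (y t) = mat_exp (t \<cdot>\<^sub>m B) *\<^sub>v Matrix.vec (2 * m) (y 0)"
    proof (rule linear_ode_solution[OF B])
      fix i t assume i: "i < 2 * m"
      show "((\<lambda>t. y t i) has_real_derivative (\<Sum>j<2 * m. B $$ (i, j) * y t j)) (at t)"
      proof (cases "even i")
        case True
        then have si: "Suc i < 2 * m" using i by presburger
        have "B $$ (i, j) * y t j = (if j = Suc i then - \<beta> (i div 2) * y t (Suc i) else 0)" if "j < 2 * m" for j
          using that i True by (auto simp: B_def)
        then have "(\<Sum>j<2 * m. B $$ (i, j) * y t j) = - \<beta> (i div 2) * y t (Suc i)"
          using si by (simp add: sum.delta)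
        moreover have "((\<lambda>t. y t i) has_real_derivative - \<beta> (i div 2) * y t (Suc i)) (at t)"
          using True unfolding y_def by (auto intro!: derivative_eq_intros simp: algebra_simps)
        ultimately show ?thesis by simp
      next
        case False
        then obtain k where k: "i = Suc k" "even k" by (cases i) auto
        have "B $$ (i, j) * y t j = (if j = k then \<beta> (i div 2) * y t k else 0)" if "j < 2 * m" for j
          using that i k by (auto simp: B_def)
        then have "(\<Sum>j<2 * m. B $$ (i, j) * y t j) = \<beta> (i div 2) * y t k"
          using i k by (simp add: sum.delta)
        moreover have "((\<lambda>t. y t i) has_real_derivative \<beta> (i div 2) * y t k) (at t)"
          using k unfolding y_def by (auto intro!: derivative_eq_intros simp: algebra_simps)
        ultimately show ?thesis by simp
      qed
    qed
    moreover have "Matrix.vec (2 * m) (y t) = Matrix.vec (2 * m) (F (\<Phi> t x))"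
      by (rule eq_vecI) (auto simp: y_def F_def f[OF _ x])
    moreover have "Matrix.vec (2 * m) (y 0) = Matrix.vec (2 * m) (F x)"
      by (rule eq_vecI) (auto simp: y_def F_def)
    ultimately show ?thesis by simp
  qed
  have "linearizing X \<Phi> (2 * m) F"
    unfolding linearizing_def
  proof (intro conjI bexI[OF _ B] allI ballI lin)
    show "F \<in> topspace X \<rightarrow> topspace (Euclidean_space (2 * m))"
      using Fc by (auto simp: continuous_map_def)
  qed
  then show ?thesis using emb unfolding linearizable_by_C0_embedding_def by blast
qed

lemma torus_action_imp_linearizable:
  assumes comp: "compact_space X" and E: "continuous_map X (Euclidean_space N) E" "inj_on E (topspace X)"
    and act: "C0_torus_action l X \<Theta>" and fin: "finitely_many_orbit_types l X \<Theta>"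
    and sub: "one_parameter_subgroup \<Phi> l \<Theta>"
  shows "linearizable_by_C0_embedding X \<Phi>"
proof -
  have ga: "group_action (torus l) (topspace X) \<Theta>"
    and \<Theta>c: "continuous_map (prod_topology (torus_topology l) X) X (\<lambda>(g, x). \<Theta> g x)"
    using act by (auto simp: C0_torus_action_def continuous_action_def)
  interpret ga: group_action "torus l" "topspace X" \<Theta> by (rule ga)
  define S where "S = E ` topspace X"
  have Ecu: "continuous_map X euclidean E" and SN: "S \<subseteq> {x. \<forall>j\<ge>N. x j = 0}"
    using E(1) by (auto simp: Euclidean_space_top_of_set continuous_map_in_subtopology S_def rvec_def)
  have "embedding_map X euclidean E"
    by (rule compact_continuous_injective_imp_embedding[OF comp _ Ecu E(2)]) simp
  then have "homeomorphic_map X (top_of_set S) E" by (simp add: embedding_map_def S_def)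
  then obtain D where "homeomorphic_maps X (top_of_set S) E D" by (auto simp: homeomorphic_map_maps)
  then have Dc: "continuous_map (top_of_set S) X D" and DE: "\<And>x. x \<in> topspace X \<Longrightarrow> D (E x) = x"
    and ED: "\<And>p. p \<in> S \<Longrightarrow> E (D p) = p"
    by (auto simp: homeomorphic_maps_def)
  have DX: "D p \<in> topspace X" if "p \<in> S" for p using Dc that by (auto simp: continuous_map_def)
  define \<theta> where "\<theta> v p = E (\<Theta> (torus_proj l v) (D p))" for v p
  have \<Theta>X: "\<Theta> (torus_proj l v) x \<in> topspace X" if "v \<in> rvec l" "x \<in> topspace X" for v x
    using ga.element_image[OF torus_proj_closed[OF that(1)] that(2)] by blast
  have D\<theta>: "D (\<theta> v p) = \<Theta> (torus_proj l v) (D p)" if "v \<in> rvec l" "p \<in> S" for v p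
    unfolding \<theta>_def by (rule DE[OF \<Theta>X[OF that(1) DX[OF that(2)]]])
  interpret la: lattice_action l N S \<theta>
  proof
    have "compactin euclidean S" unfolding S_def
      by (rule image_compactin[OF _ Ecu]) (use comp in \<open>simp add: compact_space_def\<close>)
    then show "compact S" by simp
    show "S \<subseteq> {x. \<forall>j\<ge>N. x j = 0}" by (rule SN)
    show "\<theta> v p \<in> S" if "v \<in> rvec l" "p \<in> S" for v p
      unfolding \<theta>_def S_def by (intro imageI \<Theta>X that DX)
    show "\<theta> (\<lambda>i. u i + v i) p = \<theta> u (\<theta> v p)" if "u \<in> rvec l" "v \<in> rvec l" "p \<in> S" for u v p
      unfolding \<theta>_def[of u] D\<theta>[OF that(2,3)]
      using ga.composition_rule[OF DX[OF that(3)] torus_proj_closed[OF that(1)] torus_proj_closed[OF that(2)]]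
      by (simp add: \<theta>_def torus_proj_add[OF that(1,2)])
    show "\<theta> v p = p" if "v \<in> rvec l" "\<And>i. v i \<in> \<int>" "p \<in> S" for v p
    proof -
      have "\<Theta> (torus_proj l v) (D p) = D p"
        unfolding torus_proj_int[OF that(1,2)] ga.id_eq_one[symmetric] using DX[OF that(3)] by simp
      then show ?thesis by (simp add: \<theta>_def ED that(3))
    qed
    show "continuous_on (rvec l \<times> S) (\<lambda>(v, p). \<theta> v p)"
    proof -
      have q: "continuous_map (top_of_set (rvec l)) (torus_topology l) (torus_proj l)"
        using quotient_imp_continuous_map[OF quotient_map_torus_proj[of l]] by (simp add: Euclidean_space_top_of_set)
      have "continuous_map (prod_topology (top_of_set (rvec l)) (top_of_set S)) (prod_topology (torus_topology l) X)
          (\<lambda>vp. (torus_proj l (fst vp), D (snd vp)))"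
        by (intro continuous_map_pairedI continuous_map_compose[OF continuous_map_fst q, unfolded o_def]
            continuous_map_compose[OF continuous_map_snd Dc, unfolded o_def])
      from continuous_map_compose[OF continuous_map_compose[OF this \<Theta>c] Ecu]
      have "continuous_map (top_of_set (rvec l \<times> S)) euclidean (\<lambda>vp. \<theta> (fst vp) (snd vp))"
        by (simp add: o_def \<theta>_def)
      then show ?thesis by (simp add: split_def)
    qed
  qed
  have stab: "la.stab (E x) = {v \<in> rvec l. torus_proj l v \<in> stabilizer (torus l) \<Theta> x}" if x: "x \<in> topspace X" for x
  proof -
    have "\<theta> v (E x) = E x \<longleftrightarrow> \<Theta> (torus_proj l v) x = x" if "v \<in> rvec l" for v
      using inj_on_eq_iff[OF E(2) \<Theta>X[OF that x] x] by (simp add: \<theta>_def DE x)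
    then show ?thesis
      by (auto simp: la.stab_def stabilizer_def torus_proj_closed)
  qed
  \<comment> \<open>Stabilizers of vectors are preimages of torus stabilizers, so finiteness of the
    orbit types carries over.\<close>
  have "la.stab ` S \<subseteq> (\<lambda>H. {v \<in> rvec l. torus_proj l v \<in> H}) ` {stabilizer (torus l) \<Theta> x | x. x \<in> topspace X}"
    using stab by (auto simp: S_def)
  moreover have "finite {stabilizer (torus l) \<Theta> x | x. x \<in> topspace X}"
    using fin by (simp add: finitely_many_orbit_types_def)
  ultimately have "finite (la.stab ` S)" using finite_surj by blast
  then obtain W where W: "finite W" "\<And>k f. (k, f) \<in> W \<Longrightarrow> la.weight k S f"
    "\<And>x y. x \<in> S \<Longrightarrow> y \<in> S \<Longrightarrow> (\<And>k f. (k, f) \<in> W \<Longrightarrow> f x = f y) \<Longrightarrow> x = y"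
    by (rule la.finite_separating_weights) blast
  obtain b where b: "bij_betw b {0..<card W} W" using ex_bij_betw_nat_finite[OF W(1)] by blast
  obtain \<omega> where \<omega>: "\<omega> \<in> rvec l" "\<And>t. \<Phi> t = \<Theta> (torus_proj l (\<lambda>i. \<omega> i * t))"
    using sub by (auto simp: one_parameter_subgroup_def topspace_Euclidean_rvec)
  have bW: "la.weight (fst (b j)) S (snd (b j))" if "j < card W" for j
    using W(2)[of "fst (b j)" "snd (b j)"] bij_betwE[OF b] that by simp
  show ?thesis
  \<comment> \<open>At time \<open>t\<close> the flow acts by the vector
    \<open>\<omega> * t\<close>, so a function of weight \<open>k\<close> turns at angular speed
    \<open>2 * pi * ipair l k \<omega>\<close>.\<close>
  proof (rule flow_of_rotations_linearizing[where m = "card W" and f = "\<lambda>j x. snd (b j) (E x)"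
        and \<beta> = "\<lambda>j. 2 * pi * ipair l (fst (b j)) \<omega>"])
    fix j x t assume j: "j < card W" and x: "x \<in> topspace X"
    have v: "(\<lambda>i. \<omega> i * t) \<in> rvec l" using \<omega>(1) by (simp add: rvec_def)
    have "E (\<Phi> t x) = \<theta> (\<lambda>i. \<omega> i * t) (E x)" by (simp add: \<omega>(2) \<theta>_def DE x)
    moreover have "E x \<in> S" using x by (simp add: S_def)
    moreover have "ipair l k (\<lambda>i. \<omega> i * t) = ipair l k \<omega> * t" for k
      by (simp add: ipair_def sum_distrib_left sum_distrib_right mult_ac)
    ultimately show "snd (b j) (E (\<Phi> t x)) = cis (2 * pi * ipair l (fst (b j)) \<omega> * t) * snd (b j) (E x)"
      using bW[OF j] v by (simp add: la.weight_def e2_def mult.assoc)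
  next
    fix j assume j: "j < card W"
    have c: "continuous_map (top_of_set S) euclidean (snd (b j))" using bW[OF j] by (simp add: la.weight_def)
    have "continuous_map X (top_of_set S) E"
      using Ecu by (auto simp: continuous_map_in_subtopology S_def)
    from continuous_map_compose[OF this c] show "continuous_map X euclidean (\<lambda>x. snd (b j) (E x))"
      by (simp add: o_def)
  next
    fix x y assume xy: "x \<in> topspace X" "y \<in> topspace X"
      and eq: "\<And>j. j < card W \<Longrightarrow> snd (b j) (E x) = snd (b j) (E y)"
    have "E x = E y"
    proof (rule W(3))
      fix k f assume "(k, f) \<in> W"
      then have "(k, f) \<in> b ` {0..<card W}" by (simp add: bij_betw_imp_surj_on[OF b])
      then obtain j where "j < card W" "b j = (k, f)" by auto
      then show "f (E x) = f (E y)" using eq[of j] by simp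
    qed (use xy in \<open>auto simp: S_def\<close>)
    then show "x = y" using E(2) xy by (simp add: inj_on_eq_iff)
  qed (rule comp)
qed

section \<open>Bounded linear flows are diagonal\<close>

lemma exponential_solution:
  fixes u :: "real \<Rightarrow> complex"
  assumes "\<And>t. (u has_vector_derivative \<mu> * u t) (at t)"
  shows "u t = exp (\<mu> * of_real t) * u 0"
proof -
  define v where "v t = exp (- \<mu> * of_real t) * u t" for t
  have "(v has_vector_derivative 0) (at t)" for t
  proof -
    have "((\<lambda>t. exp (- \<mu> * of_real t)) has_vector_derivative (- \<mu> * exp (- \<mu> * of_real t))) (at t)"
      by (rule has_vector_derivative_real_field) (auto intro!: derivative_eq_intros)
    from has_vector_derivative_mult[OF this assms[of t]]
    show ?thesis unfolding v_def[abs_def] by (simp add: algebra_simps)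
  qed
  then obtain c where "\<And>t. v t = c"
    using has_vector_derivative_zero_constant[of UNIV v] by auto
  then have "v t = v 0" by simp
  then have "exp (\<mu> * of_real t) * (exp (- \<mu> * of_real t) * u t) = exp (\<mu> * of_real t) * u 0" by (simp add: v_def)
  then show ?thesis by (simp flip: exp_add mult.assoc)
qed

text \<open>Removing the exponential factor from \<open>u\<close> leaves \<open>u 0 + t * c\<close>
  with \<open>c = w 0\<close>. In one direction of time that factor is bounded, so boundedness of
  \<open>u\<close> excludes linear growth.\<close>

lemma bounded_jordan_chain:
  fixes u w :: "real \<Rightarrow> complex"
  assumes u: "\<And>t. (u has_vector_derivative \<mu> * u t + w t) (at t)"
    and w: "\<And>t. (w has_vector_derivative \<mu> * w t) (at t)"
    and B: "\<And>t. norm (u t) \<le> B"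
  shows "w t = 0"
proof -
  define c where "c = w 0"
  have wt: "w t = exp (\<mu> * of_real t) * c" for t
    unfolding c_def by (rule exponential_solution[OF w])
  define v where "v t = exp (- \<mu> * of_real t) * u t - of_real t * c" for t
  have "(v has_vector_derivative 0) (at t)" for t
  proof -
    have 1: "((\<lambda>t. exp (- \<mu> * of_real t)) has_vector_derivative (- \<mu> * exp (- \<mu> * of_real t))) (at t)"
      by (rule has_vector_derivative_real_field) (auto intro!: derivative_eq_intros)
    have 2: "((\<lambda>t. of_real t * c) has_vector_derivative c) (at t)"
      by (rule has_vector_derivative_real_field) (auto intro!: derivative_eq_intros)
    have "exp (- \<mu> * of_real t) * w t = c"
      by (simp add: wt flip: exp_add mult.assoc)
    then show ?thesis
      using has_vector_derivative_diff[OF has_vector_derivative_mult[OF 1 u[of t]] 2]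
      unfolding v_def[abs_def] by (simp add: algebra_simps)
  qed
  then obtain d where d: "\<And>t. v t = d"
    using has_vector_derivative_zero_constant[of UNIV v] by auto
  have vt: "exp (- \<mu> * of_real t) * u t = u 0 + of_real t * c" for t
    using d[of 0] d[of t] by (simp add: v_def algebra_simps)
  \<comment> \<open>Time runs in the direction in which \<open>exp (- \<mu> * t)\<close> does not
    grow; \<open>u\<close> is bounded in both.\<close>
  define s :: real where "s = (if Re \<mu> \<ge> 0 then 1 else - 1)"
  have "norm c * \<tau> \<le> B + norm (u 0)" if \<tau>: "\<tau> \<ge> 0" for \<tau>
  proof -
    have "norm (exp (- \<mu> * of_real (s * \<tau>))) \<le> 1"
      using \<tau> by (auto simp: s_def norm_exp_eq_Re mult_nonneg_nonneg mult_nonpos_nonneg)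
    then have "norm (exp (- \<mu> * of_real (s * \<tau>)) * u (s * \<tau>)) \<le> 1 * B"
      unfolding norm_mult using B by (intro mult_mono) auto
    then have "norm (u 0 + of_real (s * \<tau>) * c) \<le> B" by (simp only: vt mult_1)
    moreover have "norm (of_real (s * \<tau>) * c) = norm c * \<tau>" using \<tau> by (simp add: norm_mult s_def)
    ultimately show ?thesis
      using norm_triangle_ineq4[of "u 0 + of_real (s * \<tau>) * c" "u 0"] by simp
  qed
  note * = this
  have "c = 0"
  proof (rule ccontr)
    assume "c \<noteq> 0"
    have B0: "0 \<le> B + norm (u 0)" using *[of 0] by simp
    \<comment> \<open>The time is chosen to exceed the linear bound by 1.\<close>
    have "norm c * ((B + norm (u 0) + 1) / norm c) \<le> B + norm (u 0)"
      by (rule *) (use B0 in simp)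
    then show False using \<open>c \<noteq> 0\<close> by simp
  qed
  then show ?thesis by (simp add: wt)
qed

text \<open>If \<open>Re \<mu>\<close> were nonzero, the time \<open>\<tau> / Re \<mu>\<close> would
  give norm \<open>exp \<tau> * norm (u 0)\<close> for every \<open>\<tau>\<close>. A solution
  starting at 0 vanishes, so the formula holds for it with any \<open>\<mu>\<close>.\<close>

lemma bounded_exponential:
  fixes u :: "real \<Rightarrow> complex"
  assumes u: "\<And>t. (u has_vector_derivative \<mu> * u t) (at t)" and B: "\<And>t. norm (u t) \<le> B"
  shows "u t = cis (Im \<mu> * t) * u 0"
proof (cases "u 0 = 0")
  case True
  then show ?thesis using exponential_solution[OF u, of t] by simp
next
  case False
  have "Re \<mu> = 0"
  proof (rule ccontr)
    assume "Re \<mu> \<noteq> 0"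
    have "exp \<tau> * norm (u 0) \<le> B" for \<tau>
      using B[of "\<tau> / Re \<mu>"] \<open>Re \<mu> \<noteq> 0\<close>
      by (subst (asm) exponential_solution[OF u]) (simp add: norm_mult norm_exp_eq_Re)
    moreover have "exp (B / norm (u 0)) > B / norm (u 0)"
      using exp_ge_add_one_self[of "B / norm (u 0)"] by linarith
    then have "exp (B / norm (u 0)) * norm (u 0) > B" using False by (simp add: pos_divide_less_eq)
    ultimately show False by (metis not_less)
  qed
  then have "\<mu> * of_real t = \<i> * of_real (Im \<mu> * t)" by (simp add: complex_eq_iff)
  then show ?thesis using exponential_solution[OF u, of t] by (simp only: cis_conv_exp)
qed

text \<open>The induction starts at the end of a Jordan chain. Once the next coordinate solves a
  pure exponential equation, \<open>bounded_jordan_chain\<close> makes it vanish, and the coupling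
  term in row \<open>k\<close> disappears.\<close>

lemma bounded_bidiagonal_flow:
  fixes z :: "real \<Rightarrow> nat \<Rightarrow> complex"
  assumes z: "\<And>k t. k < n \<Longrightarrow>
      ((\<lambda>t. z t k) has_vector_derivative \<mu> k * z t k + (if b k then z t (Suc k) else 0)) (at t)"
    and b: "\<And>k. k < n \<Longrightarrow> b k \<Longrightarrow> Suc k < n \<and> \<mu> (Suc k) = \<mu> k"
    and B: "\<And>k t. k < n \<Longrightarrow> norm (z t k) \<le> B"
    and k: "k < n"
  shows "z t k = cis (Im (\<mu> k) * t) * z 0 k"
proof -
  have "\<forall>t. ((\<lambda>t. z t k) has_vector_derivative \<mu> k * z t k) (at t)" if "k < n" for k
    using that
  proof (induction "n - k" arbitrary: k rule: less_induct)
    case less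
    show ?case
    proof (cases "b k")
      case True
      then have sk: "Suc k < n" "\<mu> (Suc k) = \<mu> k" using b less.prems by auto
      have "\<forall>t. ((\<lambda>t. z t (Suc k)) has_vector_derivative \<mu> (Suc k) * z t (Suc k)) (at t)"
        using sk by (intro less.hyps) auto
      then have w: "((\<lambda>t. z t (Suc k)) has_vector_derivative \<mu> k * z t (Suc k)) (at t)" for t
        by (simp add: sk(2))
      have "z t (Suc k) = 0" for t
      proof (rule bounded_jordan_chain[OF _ w B[OF less.prems]])
        show "((\<lambda>t. z t k) has_vector_derivative \<mu> k * z t k + z t (Suc k)) (at t)" for t
          using z[OF less.prems, of t] True by simp
      qed
      then show ?thesis using z[OF less.prems] True by simp
    next
      case False
      then show ?thesis using z[OF less.prems] by simp
    qed
  qed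
  then show ?thesis using bounded_exponential[of "\<lambda>t. z t k" "\<mu> k" B t] B[OF k] k by blast
qed

text \<open>\<open>b\<close> marks the entries 1 above the diagonal. It is false in the last row of
  a block, so chains stay inside a block and the eigenvalue is constant along them.\<close>

lemma jordan_matrix_rows:
  fixes n_as :: "(nat \<times> complex) list"
  defines "n \<equiv> sum_list (map fst n_as)"
  shows "\<exists>\<mu> b. (\<forall>i<n. \<forall>j<n. jordan_matrix n_as $$ (i, j) =
      (if j = i then \<mu> i else if j = Suc i \<and> b i then 1 else 0)) \<and>
    (\<forall>i<n. b i \<longrightarrow> Suc i < n \<and> \<mu> (Suc i) = \<mu> i)"
  unfolding n_def
proof (induction n_as)
  case Nil
  then show ?case by simp
next
  case (Cons p n_as)
  obtain m a where p: "p = (m, a)" by fastforce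
  let ?n = "sum_list (map fst n_as)"
  from Cons obtain \<mu> b where \<mu>: "\<And>i j. i < ?n \<Longrightarrow> j < ?n \<Longrightarrow> jordan_matrix n_as $$ (i, j) =
      (if j = i then \<mu> i else if j = Suc i \<and> b i then 1 else 0)"
    and b: "\<And>i. i < ?n \<Longrightarrow> b i \<Longrightarrow> Suc i < ?n \<and> \<mu> (Suc i) = \<mu> i" by blast
  define \<mu>' where "\<mu>' i = (if i < m then a else \<mu> (i - m))" for i
  define b' where "b' i \<longleftrightarrow> (if i < m then Suc i < m else b (i - m))" for i
  have "jordan_matrix (p # n_as) $$ (i, j) = (if j = i then \<mu>' i else if j = Suc i \<and> b' i then 1 else 0)"
    if "i < m + ?n" "j < m + ?n" for i j
    using that unfolding p jordan_matrix_Cons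
    by (auto simp: \<mu>'_def b'_def \<mu>)
  moreover have "Suc i < m + ?n \<and> \<mu>' (Suc i) = \<mu>' i" if "i < m + ?n" "b' i" for i
  proof (cases "i < m")
    case True
    then show ?thesis using that by (simp add: \<mu>'_def b'_def)
  next
    case False
    then obtain r where r: "i = m + r" by (metis le_add_diff_inverse not_less)
    then have "b r" "r < ?n" using that by (auto simp: b'_def)
    then show ?thesis using b[of r] r by (simp add: \<mu>'_def)
  qed
  ultimately show ?case by (intro exI[of _ \<mu>'] exI[of _ b']) (simp add: p)
qed

text \<open>Over the complex numbers the characteristic polynomial splits. From
  \<open>A = P * J * Q\<close> follows \<open>Q * A = J * Q\<close>: the rows of \<open>Q\<close>
  are chains of generalized left eigenvectors, so the coordinates they define evolve by a bidiagonal
  system.\<close>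

lemma real_matrix_bidiagonalizable:
  fixes B :: "real mat"
  assumes B: "B \<in> carrier_mat n n"
  obtains P Q :: "nat \<Rightarrow> nat \<Rightarrow> complex" and \<mu> b where
    "\<And>i j. i < n \<Longrightarrow> j < n \<Longrightarrow> (\<Sum>k<n. P i k * Q k j) = (if i = j then 1 else 0)"
    "\<And>k j. k < n \<Longrightarrow> j < n \<Longrightarrow> (\<Sum>i<n. Q k i * of_real (B $$ (i, j))) =
      \<mu> k * Q k j + (if b k then Q (Suc k) j else 0)"
    "\<And>k. k < n \<Longrightarrow> b k \<Longrightarrow> Suc k < n \<and> \<mu> (Suc k) = \<mu> k"
proof -
  define A where "A = map_mat complex_of_real B"
  have A: "A \<in> carrier_mat n n" using B by (simp add: A_def)
  obtain as where "char_poly A = (\<Prod>a\<leftarrow>as. [:- a, 1:])" using char_poly_factorized[OF A] by blast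
  then obtain n_as where "jordan_nf A n_as" using jordan_nf_exists[OF A] by blast
  then obtain P Q where PQ: "similar_mat_wit A (jordan_matrix n_as) P Q"
    by (auto simp: jordan_nf_def similar_mat_def)
  let ?J = "jordan_matrix n_as"
  have c: "?J \<in> carrier_mat n n" "P \<in> carrier_mat n n" "Q \<in> carrier_mat n n"
    and eq: "P * Q = 1\<^sub>m n" "Q * P = 1\<^sub>m n" "A = P * ?J * Q"
    using PQ A by (auto simp: similar_mat_wit_def Let_def)
  have n: "sum_list (map fst n_as) = n" using c(1) by auto
  obtain \<mu> b where \<mu>: "\<And>i j. i < n \<Longrightarrow> j < n \<Longrightarrow> ?J $$ (i, j) =
      (if j = i then \<mu> i else if j = Suc i \<and> b i then 1 else 0)"
    and b: "\<And>i. i < n \<Longrightarrow> b i \<Longrightarrow> Suc i < n \<and> \<mu> (Suc i) = \<mu> i"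
    using jordan_matrix_rows[of n_as] unfolding n by blast
  have idx: "(M * M') $$ (i, j) = (\<Sum>k<n. M $$ (i, k) * M' $$ (k, j))"
    if "M \<in> carrier_mat n n" "M' \<in> carrier_mat n n" "i < n" "j < n" for M M' :: "complex mat" and i j
    using that by (auto simp: scalar_prod_def lessThan_atLeast0)
  have "Q * A = (Q * P) * (?J * Q)"
    unfolding eq(3) using c by (simp add: assoc_mult_mat[of _ n n _ n _ n])
  then have QA: "Q * A = ?J * Q"
    using left_mult_one_mat[OF mult_carrier_mat[OF c(1,3)]] by (simp add: eq(2))
  show ?thesis
  proof (rule that[of "\<lambda>i j. P $$ (i, j)" "\<lambda>i j. Q $$ (i, j)" \<mu> b])
    show "(\<Sum>k<n. P $$ (i, k) * Q $$ (k, j)) = (if i = j then 1 else 0)" if "i < n" "j < n" for i j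
      using idx[OF c(2,3) that] that by (simp add: eq(1))
    show "(\<Sum>i<n. Q $$ (k, i) * of_real (B $$ (i, j))) = \<mu> k * Q $$ (k, j) + (if b k then Q $$ (Suc k, j) else 0)"
      if "k < n" "j < n" for k j
    proof -
      have "(\<Sum>i<n. Q $$ (k, i) * of_real (B $$ (i, j))) = (Q * A) $$ (k, j)"
        unfolding idx[OF c(3) A that] using that B by (intro sum.cong) (auto simp: A_def)
      also have "\<dots> = (\<Sum>m<n. ?J $$ (k, m) * Q $$ (m, j))"
        unfolding QA by (rule idx[OF c(1,3) that])
      also have "\<dots> = (\<Sum>m<n. (if m = k then \<mu> k * Q $$ (k, j) else 0) + (if m = Suc k then (if b k then Q $$ (Suc k, j) else 0) else 0))"
        using that \<mu>[OF that(1)] by (intro sum.cong) auto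
      also have "\<dots> = \<mu> k * Q $$ (k, j) + (if b k then Q $$ (Suc k, j) else 0)"
        unfolding sum.distrib using that(1) b[OF that(1)] by (auto simp: sum.delta)
      finally show ?thesis .
    qed
  qed (rule b)
qed

lemma linearizable_imp_rotation_coordinates:
  assumes comp: "compact_space X" and lin: "linearizable_by_C0_embedding X \<Phi>" and flow: "C0_flow X \<Phi>"
  obtains n and f :: "nat \<Rightarrow> 'a \<Rightarrow> complex" and \<nu> :: "nat \<Rightarrow> real" where
    "\<And>k. k < n \<Longrightarrow> continuous_map X euclidean (f k)"
    "\<And>k x t. k < n \<Longrightarrow> x \<in> topspace X \<Longrightarrow> f k (\<Phi> t x) = cis (\<nu> k * t) * f k x"
    "\<And>x y. x \<in> topspace X \<Longrightarrow> y \<in> topspace X \<Longrightarrow> (\<And>k. k < n \<Longrightarrow> f k x = f k y) \<Longrightarrow> x = y"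
proof -
  obtain n F B where F: "F \<in> topspace X \<rightarrow> topspace (Euclidean_space n)" and emb: "embedding_map X (Euclidean_space n) F"
    and B: "B \<in> carrier_mat n n"
    and FB: "\<And>t x. x \<in> topspace X \<Longrightarrow> Matrix.vec n (F (\<Phi> t x)) = mat_exp (t \<cdot>\<^sub>m B) *\<^sub>v Matrix.vec n (F x)"
    using lin unfolding linearizable_by_C0_embedding_def linearizing_def by blast
  have "group_action real_group (topspace X) \<Phi>"
    using flow by (simp add: C0_flow_def continuous_action_def)
  then interpret ga: group_action real_group "topspace X" \<Phi> .
  have \<Phi>X: "\<Phi> t x \<in> topspace X" if "x \<in> topspace X" for t x
    using ga.element_image[of t x] that by (simp add: real_group_def)
  have \<Phi>add: "\<Phi> (s + t) x = \<Phi> s (\<Phi> t x)" if "x \<in> topspace X" for s t x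
    using ga.composition_rule[OF that, of s t] by (simp add: real_group_def)
  have \<Phi>0: "\<Phi> 0 x = x" if "x \<in> topspace X" for x
    using ga.id_eq_one that by (metis monoid.select_convs(2) real_group_def restrict_apply')
  have Fc: "continuous_map X (Euclidean_space n) F" and Fi: "inj_on F (topspace X)"
    using emb by (auto simp: embedding_map_def homeomorphic_eq_everything_map continuous_map_in_subtopology)
  have Fi': "continuous_map X euclideanreal (\<lambda>x. F x i)" for i
    using Fc by (simp add: Euclidean_space_def continuous_map_in_subtopology continuous_map_componentwise_UNIV)
  obtain R where R: "\<And>x i. x \<in> topspace X \<Longrightarrow> i < n \<Longrightarrow> \<bar>F x i\<bar> \<le> R"
  proof -
    have "continuous_map X euclidean F"
      using Fc by (simp add: Euclidean_space_top_of_set continuous_map_in_subtopology)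
    then have "compactin euclidean (F ` topspace X)"
      using comp by (intro image_compactin) (auto simp: compact_space_def)
    then have "compact (F ` topspace X)" by simp
    then obtain R where "\<And>p i. p \<in> F ` topspace X \<Longrightarrow> i < n \<Longrightarrow> \<bar>p i\<bar> \<le> R"
      by (rule compact_coordinates_bounded[of _ n]) blast
    then show ?thesis using that by blast
  qed
  obtain P Q :: "nat \<Rightarrow> nat \<Rightarrow> complex" and \<mu> b where
    PQ: "\<And>i j. i < n \<Longrightarrow> j < n \<Longrightarrow> (\<Sum>k<n. P i k * Q k j) = (if i = j then 1 else 0)"
    and QB: "\<And>k j. k < n \<Longrightarrow> j < n \<Longrightarrow> (\<Sum>i<n. Q k i * of_real (B $$ (i, j))) =
      \<mu> k * Q k j + (if b k then Q (Suc k) j else 0)"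
    and b: "\<And>k. k < n \<Longrightarrow> b k \<Longrightarrow> Suc k < n \<and> \<mu> (Suc k) = \<mu> k"
  proof (rule real_matrix_bidiagonalizable[OF B], goal_cases)
    case (1 P Q \<mu> b)
    show ?case by (rule 1(1)[of P Q \<mu> b]) (fact 1)+
  qed
  define f where "f k x = (\<Sum>j<n. Q k j * of_real (F x j))" for k x
  show ?thesis
  proof (rule that[of n f "\<lambda>k. Im (\<mu> k)"])
    show "continuous_map X euclidean (f k)" if "k < n" for k
      unfolding f_def[abs_def]
    proof (intro continuous_map_sum)
      fix j
      have "continuous_map euclideanreal euclidean (\<lambda>r. Q k j * of_real r)"
        by (auto intro!: continuous_intros)
      from continuous_map_compose[OF Fi' this] show "continuous_map X euclidean (\<lambda>x. Q k j * of_real (F x j))"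
        by (simp add: o_def)
    qed auto
    show "f k (\<Phi> t x) = cis (Im (\<mu> k) * t) * f k x" if k: "k < n" and x: "x \<in> topspace X" for k x t
    proof -
      have dF: "((\<lambda>t. F (\<Phi> t x) i) has_real_derivative (\<Sum>j<n. B $$ (i, j) * F (\<Phi> t x) j)) (at t)"
        if "i < n" for i t
        using that by (intro linear_flow_ode[OF B]) (simp_all add: \<Phi>add x FB \<Phi>X)
      define K where "K = (\<Sum>k<n. \<Sum>j<n. norm (Q k j) * R)"
      have "f k (\<Phi> t x) = cis (Im (\<mu> k) * t) * f k (\<Phi> 0 x)"
      proof (rule bounded_bidiagonal_flow[of n "\<lambda>t k. f k (\<Phi> t x)" \<mu> b K k t, OF _ b _ k])
        fix k t assume k: "k < n"
        have "((\<lambda>t. f k (\<Phi> t x)) has_vector_derivative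
            (\<Sum>i<n. Q k i * of_real (\<Sum>j<n. B $$ (i, j) * F (\<Phi> t x) j))) (at t)"
          unfolding f_def
          using dF by (intro has_vector_derivative_sum has_vector_derivative_mult_right has_vector_derivative_of_real)
            (simp flip: has_real_derivative_iff_has_vector_derivative)
        moreover have "(\<Sum>i<n. Q k i * of_real (\<Sum>j<n. B $$ (i, j) * F (\<Phi> t x) j))
            = (\<Sum>j<n. (\<Sum>i<n. Q k i * of_real (B $$ (i, j))) * of_real (F (\<Phi> t x) j))"
          by (simp add: sum_distrib_left sum_distrib_right mult.assoc) (rule sum.swap)
        moreover have "\<dots> = (\<Sum>j<n. (\<mu> k * Q k j + (if b k then Q (Suc k) j else 0)) * of_real (F (\<Phi> t x) j))"
          using QB[OF k] by simp
        moreover have "\<dots> = \<mu> k * f k (\<Phi> t x) + (if b k then f (Suc k) (\<Phi> t x) else 0)"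
          by (simp add: f_def ring_distribs sum.distrib sum_distrib_left mult.assoc)
        ultimately show "((\<lambda>t. f k (\<Phi> t x)) has_vector_derivative
            \<mu> k * f k (\<Phi> t x) + (if b k then f (Suc k) (\<Phi> t x) else 0)) (at t)" by simp
        have "norm (f k (\<Phi> t x)) \<le> (\<Sum>j<n. norm (Q k j) * R)"
          unfolding f_def using R[OF \<Phi>X[OF x]]
          by (intro sum_norm_le) (simp add: norm_mult mult_left_mono)
        also have "\<dots> \<le> K"
          unfolding K_def
        proof (rule member_le_sum[of k "{..<n}" "\<lambda>k. \<Sum>j<n. norm (Q k j) * R"])
          show "0 \<le> (\<Sum>j<n. norm (Q i j) * R)" for i
            using R[OF x] k by (intro sum_nonneg mult_nonneg_nonneg) (auto intro: order_trans[OF abs_ge_zero])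
        qed (use k in auto)
        finally show "norm (f k (\<Phi> t x)) \<le> K" .
      qed
      then show ?thesis by (simp add: \<Phi>0 x)
    qed
    fix x y assume xy: "x \<in> topspace X" "y \<in> topspace X" and eq: "\<And>k. k < n \<Longrightarrow> f k x = f k y"
    \<comment> \<open>\<open>P\<close> inverts \<open>Q\<close>, so the complex coordinates
      determine \<open>F\<close> and inherit its injectivity.\<close>
    have rec: "of_real (F x i) = (\<Sum>k<n. P i k * f k x)" if "i < n" for i x
    proof -
      have "(\<Sum>k<n. P i k * f k x) = (\<Sum>k<n. \<Sum>j<n. P i k * Q k j * of_real (F x j))"
        by (simp add: f_def sum_distrib_left mult.assoc)
      also have "\<dots> = (\<Sum>j<n. (\<Sum>k<n. P i k * Q k j) * of_real (F x j))"
        unfolding sum_distrib_right by (rule sum.swap)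
      also have "\<dots> = (\<Sum>j<n. if j = i then of_real (F x j) else 0)"
        using PQ[OF that] by (intro sum.cong) auto
      finally show ?thesis using that by (simp add: sum.delta)
    qed
    have "F x i = F y i" for i
    proof (cases "i < n")
      case True
      have "complex_of_real (F x i) = of_real (F y i)" unfolding rec[OF True] using eq by simp
      then show ?thesis by simp
    next
      case False
      have "F x \<in> topspace (Euclidean_space n)" "F y \<in> topspace (Euclidean_space n)" using F xy by auto
      then show ?thesis using False by (simp add: topspace_Euclidean_space)
    qed
    then have "F x = F y" by (rule ext)
    then show "x = y" using Fi xy by (simp add: inj_on_eq_iff)
  qed
qed

section \<open>From linearizing embeddings to torus actions\<close>

definition int_indep :: "nat \<Rightarrow> (nat \<Rightarrow> real) \<Rightarrow> bool" where
  "int_indep l \<omega> \<longleftrightarrow> (\<forall>a::nat \<Rightarrow> int. ipair l a \<omega> = 0 \<longrightarrow> (\<forall>i<l. a i = 0))"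

text \<open>If a nonzero multiple \<open>q\<close> of the new frequency is an integer combination of
  the basis, dividing the basis by \<open>q\<close> makes the new frequency integral too, while old
  exponents are multiplied by \<open>q\<close>. Otherwise the new frequency joins the basis.\<close>

lemma int_indep_frequencies:
  fixes \<rho> :: "nat \<Rightarrow> real"
  shows "\<exists>l \<omega> m. int_indep l \<omega> \<and> (\<forall>k<n. \<rho> k = ipair l (m k) \<omega>)"
proof (induction n)
  case 0
  show ?case by (intro exI[of _ 0]) (simp add: int_indep_def)
next
  case (Suc n)
  then obtain l \<omega> m where ind: "int_indep l \<omega>" and \<rho>: "\<And>k. k < n \<Longrightarrow> \<rho> k = ipair l (m k) \<omega>" by blast
  show ?case
  proof (cases "\<exists>q a. q \<noteq> 0 \<and> of_int q * \<rho> n = ipair l a \<omega>")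
    case True
    then obtain q a where q: "q \<noteq> 0" "of_int q * \<rho> n = ipair l a \<omega>" by blast
    define \<omega>' where "\<omega>' i = \<omega> i / of_int q" for i
    have ip: "ipair l a \<omega>' = ipair l a \<omega> / of_int q" for a
      by (simp add: ipair_def \<omega>'_def sum_divide_distrib)
    have "int_indep l \<omega>'" using ind q(1) by (simp add: int_indep_def ip)
    moreover have "\<rho> k = ipair l (if k = n then a else (\<lambda>i. q * m k i)) \<omega>'" if "k < Suc n" for k
    proof (cases "k = n")
      case True
      then show ?thesis using q by (simp add: ip field_simps)
    next
      case False
      have "ipair l (\<lambda>i. q * m k i) \<omega> = of_int q * ipair l (m k) \<omega>"
        by (simp add: ipair_def sum_distrib_left mult.assoc)
      then show ?thesis using False that q(1) \<rho>[of k] by (simp add: ip)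
    qed
    ultimately show ?thesis
      by (intro exI[of _ l] exI[of _ \<omega>'] exI[of _ "\<lambda>k. if k = n then a else (\<lambda>i. q * m k i)"]) simp
  next
    case False
    define \<omega>' where "\<omega>' = fun_upd \<omega> l (\<rho> n)"
    have ip: "ipair (Suc l) a \<omega>' = ipair l a \<omega> + of_int (a l) * \<rho> n" for a
      by (simp add: ipair_def \<omega>'_def)
    have "int_indep (Suc l) \<omega>'"
      unfolding int_indep_def ip
    proof (intro allI impI)
      fix a i assume a: "ipair l a \<omega> + of_int (a l) * \<rho> n = 0" and i: "i < Suc l"
      have "of_int (- a l) * \<rho> n = ipair l a \<omega>" using a by simp
      then have "- a l = 0" using False by blast
      then show "a i = 0" using a i ind by (auto simp: int_indep_def less_Suc_eq)
    qed
    moreover have "\<rho> k = ipair (Suc l) (if k = n then (\<lambda>i. if i = l then 1 else 0) else fun_upd (m k) l 0) \<omega>'" if "k < Suc n" for k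
    proof (cases "k = n")
      case True
      have "ipair l (\<lambda>i. if i = l then 1 else 0) \<omega> = 0" by (simp add: ipair_def)
      then show ?thesis using True by (simp add: ip)
    next
      case False
      have "ipair l (fun_upd (m k) l 0) \<omega> = ipair l (m k) \<omega>" by (rule ipair_cong) simp
      then show ?thesis using False that \<rho>[of k] by (simp add: ip)
    qed
    ultimately show ?thesis
      by (intro exI[of _ "Suc l"] exI[of _ \<omega>'] exI[of _ "\<lambda>k. if k = n then (\<lambda>i. if i = l then 1 else 0) else fun_upd (m k) l 0"]) simp
  qed
qed

text \<open>Kronecker's theorem is applied to an independent set with an injective enumeration. Two
  equal frequencies would satisfy the relation with coefficients 1 and -1, so independence of the
  family gives both.\<close>

lemma int_indep_dense:
  assumes ind: "int_indep l \<omega>" and "\<epsilon> > 0"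
  obtains t h where "\<And>i. i < l \<Longrightarrow> \<bar>t * \<omega> i - of_int (h i) - v i\<bar> < \<epsilon>"
proof -
  have inj: "inj_on \<omega> {..<l}"
  proof (rule inj_onI, rule ccontr)
    fix i j assume ij: "i \<in> {..<l}" "j \<in> {..<l}" "\<omega> i = \<omega> j" "i \<noteq> j"
    define a :: "nat \<Rightarrow> int" where "a k = (if k = i then 1 else if k = j then - 1 else 0)" for k
    have "ipair l a \<omega> = (\<Sum>k<l. (if k = i then \<omega> i else 0) - (if k = j then \<omega> j else 0))"
      unfolding ipair_def using ij(4) by (intro sum.cong) (auto simp: a_def)
    also have "\<dots> = 0" using ij by (simp add: sum_subtractf sum.delta)
    finally have "a i = 0" using ind ij(1) by (simp add: int_indep_def)
    then show False by (simp add: a_def)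
  qed
  interpret M: Modules.module "\<lambda>r. (*) (real_of_int r)"
    by (simp add: Modules.module.intro distrib_left mult.commute)
  have "M.independent (\<omega> ` {..<l})"
    unfolding M.dependent_explicit
  proof safe
    fix T u x assume T: "finite T" "T \<subseteq> \<omega> ` {..<l}" and s: "(\<Sum>x\<in>T. real_of_int (u x) * x) = 0"
      and x: "x \<in> T" "u x \<noteq> 0"
    define a where "a i = (if \<omega> i \<in> T then u (\<omega> i) else 0)" for i
    have "ipair l a \<omega> = (\<Sum>y\<in>\<omega> ` {..<l}. real_of_int (if y \<in> T then u y else 0) * y)"
      unfolding ipair_def a_def by (simp add: sum.reindex[OF inj])
    also have "\<dots> = (\<Sum>y\<in>T. real_of_int (u y) * y)"
      by (rule sum.mono_neutral_cong_right) (use T in auto)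
    finally have "\<forall>i<l. a i = 0" using s ind by (simp add: int_indep_def)
    moreover obtain i where "i < l" "x = \<omega> i" using T(2) x(1) by auto
    ultimately show False using x by (auto simp: a_def split: if_splits)
  qed
  from Kronecker_thm_1[OF this inj \<open>\<epsilon> > 0\<close>, of v] show ?thesis using that by metis
qed

locale rotation_coordinates =
  fixes X :: "'a topology" and \<Phi> :: "real \<Rightarrow> 'a \<Rightarrow> 'a" and n l :: nat
    and f :: "nat \<Rightarrow> 'a \<Rightarrow> complex" and m :: "nat \<Rightarrow> nat \<Rightarrow> int" and \<omega> :: "nat \<Rightarrow> real"
  assumes comp: "compact_space X"
    and flow: "C0_flow X \<Phi>"
    and f_cont: "k < n \<Longrightarrow> continuous_map X euclidean (f k)"
    and f_flow: "k < n \<Longrightarrow> x \<in> topspace X \<Longrightarrow> f k (\<Phi> t x) = e2 (ipair l (m k) \<omega> * t) * f k x"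
    and f_sep: "x \<in> topspace X \<Longrightarrow> y \<in> topspace X \<Longrightarrow> (\<And>k. k < n \<Longrightarrow> f k x = f k y) \<Longrightarrow> x = y"
    and indep: "int_indep l \<omega>"
begin

lemma flow_Bij: "\<Phi> t \<in> Bij (topspace X)"
proof -
  interpret group_action real_group "topspace X" \<Phi>
    using flow by (simp add: C0_flow_def continuous_action_def)
  show ?thesis by (rule bij_prop0) (simp add: real_group_def)
qed

lemma flow_closed: "x \<in> topspace X \<Longrightarrow> \<Phi> t x \<in> topspace X"
  using flow_Bij[of t] by (auto simp: Bij_def bij_betw_def)

text \<open>By Kronecker's theorem the flow comes arbitrarily close to every rotation by an element of the
  torus, and the image of the coordinates is closed.\<close>

lemma rotation_exists:
  assumes x: "x \<in> topspace X"
  shows "\<exists>y\<in>topspace X. \<forall>k<n. f k y = e2 (ipair l (m k) v) * f k x"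
proof -
  \<comment> \<open>\<open>g\<close> vanishes exactly at the points sought. Its range is compact, so
    small values along the flow line of \<open>x\<close> suffice.\<close>
  define g where "g y = (\<Sum>k<n. norm (f k y - e2 (ipair l (m k) v) * f k x))" for y
  have "continuous_map X euclideanreal g"
    unfolding g_def[abs_def]
  proof (intro continuous_map_sum)
    fix k assume "k \<in> {..<n}"
    then have c: "continuous_map X euclidean (f k)" using f_cont by simp
    have "continuous_map euclidean euclideanreal (\<lambda>z. norm (z - e2 (ipair l (m k) v) * f k x))"
      by (auto intro!: continuous_intros)
    from continuous_map_compose[OF c this]
    show "continuous_map X euclideanreal (\<lambda>y. norm (f k y - e2 (ipair l (m k) v) * f k x))" by (simp add: o_def)
  qed auto
  then have "compactin euclidean (g ` topspace X)"
    using comp by (intro image_compactin) (auto simp: compact_space_def)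
  then have "closed (g ` topspace X)" by (simp add: compact_imp_closed)
  moreover have "\<exists>r\<in>g ` topspace X. dist r 0 < \<epsilon>" if \<epsilon>: "\<epsilon> > 0" for \<epsilon>
  proof -
    define h where "h u = (\<Sum>k<n. norm (e2 (ipair l (m k) u) - e2 (ipair l (m k) v)) * norm (f k x))" for u
    have "continuous_on UNIV h"
      unfolding h_def[abs_def]
      by (intro continuous_on_sum continuous_on_mult continuous_on_norm continuous_on_diff continuous_on_e2
          continuous_on_ipair continuous_on_const continuous_on_id)
    moreover have "h v = 0" by (simp add: h_def)
    ultimately obtain \<delta> where \<delta>: "\<delta> > 0" "\<And>u. dist u v < \<delta> \<Longrightarrow> \<bar>h u\<bar> < \<epsilon>"
      using \<epsilon> unfolding continuous_on_iff by (metis UNIV_I dist_real_def diff_zero)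
    \<comment> \<open>\<open>dist_fun_le\<close> doubles the coordinate bound, which leaves
      \<open>\<delta> / 2\<close>.\<close>
    obtain t p where tp: "\<And>i. i < l \<Longrightarrow> \<bar>t * \<omega> i - of_int (p i) - v i\<bar> < \<delta> / 4"
      using int_indep_dense[OF indep, of "\<delta> / 4" v] \<delta>(1) by (metis zero_less_divide_iff zero_less_numeral)
    \<comment> \<open>Coordinates from \<open>l\<close> on are copied from \<open>v\<close>: the
      characters do not see them, but the metric does.\<close>
    define u where "u i = (if i < l then t * \<omega> i - of_int (p i) else v i)" for i
    have "\<bar>u i - v i\<bar> \<le> \<delta> / 4" for i using tp[of i] \<delta>(1) by (auto simp: u_def)
    from dist_fun_le[of u v "\<delta> / 4", OF this] have "dist u v < \<delta>" using \<delta>(1) by simp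
    then have hu: "\<bar>h u\<bar> < \<epsilon>" by (rule \<delta>(2))
    have "e2 (ipair l (m k) u) = e2 (ipair l (m k) \<omega> * t)" for k
    proof -
      have "ipair l (m k) u - ipair l (m k) \<omega> * t = - (\<Sum>i<l. of_int (m k i) * of_int (p i))"
        by (simp add: ipair_def u_def sum_distrib_left sum_distrib_right right_diff_distrib sum_subtractf mult_ac)
      also have "\<dots> \<in> \<int>" by auto
      finally show ?thesis by (simp add: e2_eq_iff)
    qed
    then have "g (\<Phi> t x) = h u"
      unfolding g_def h_def using f_flow x by (intro sum.cong) (auto simp flip: norm_mult simp: left_diff_distrib)
    then have "dist (g (\<Phi> t x)) 0 < \<epsilon>" using hu by simp
    then show ?thesis using flow_closed[OF x] by blast
  qed
  ultimately have "0 \<in> g ` topspace X" using closed_approachable by blast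
  then obtain y where y: "y \<in> topspace X" "g y = 0" by auto
  then have "\<forall>k<n. f k y = e2 (ipair l (m k) v) * f k x"
    by (auto simp: g_def sum_nonneg_eq_0_iff)
  then show ?thesis using y by blast
qed

definition char_at :: "nat \<Rightarrow> (nat \<Rightarrow> real) set \<Rightarrow> complex" where
  "char_at k c = e2 (ipair l (m k) (SOME v. v \<in> rvec l \<and> torus_proj l v = c))"

lemma char_at_proj: assumes "v \<in> rvec l" shows "char_at k (torus_proj l v) = e2 (ipair l (m k) v)"
proof -
  define w where "w = (SOME w. w \<in> rvec l \<and> torus_proj l w = torus_proj l v)"
  have "w \<in> rvec l \<and> torus_proj l w = torus_proj l v"
    unfolding w_def by (rule someI[of _ v]) (use assms in simp)
  then have "\<forall>i. w i - v i \<in> \<int>"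
    using torus_proj_eq_iff[of w l v] assms by (simp add: topspace_Euclidean_rvec)
  then have "ipair l (m k) (\<lambda>i. w i - v i) \<in> \<int>" by (intro ipair_int) simp
  then show ?thesis by (simp add: char_at_def e2_eq_iff ipair_diff flip: w_def)
qed

lemma torus_carrierE:
  assumes "c \<in> carrier (torus l)" obtains v where "v \<in> rvec l" "c = torus_proj l v"
  using assms by (auto simp: carrier_torus topspace_Euclidean_rvec)

text \<open>Restricting to the space makes the map extensional, as \<open>BijGroup\<close> requires;
  the described point is unique because the coordinates separate points.\<close>

definition rot :: "(nat \<Rightarrow> real) set \<Rightarrow> 'a \<Rightarrow> 'a" where
  "rot c = (\<lambda>x\<in>topspace X. THE y. y \<in> topspace X \<and> (\<forall>k<n. f k y = char_at k c * f k x))"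

lemma rot:
  assumes "c \<in> carrier (torus l)" "x \<in> topspace X"
  shows "rot c x \<in> topspace X" "k < n \<Longrightarrow> f k (rot c x) = char_at k c * f k x"
proof -
  obtain v where v: "v \<in> rvec l" "c = torus_proj l v" using torus_carrierE[OF assms(1)] by metis
  obtain y where y: "y \<in> topspace X \<and> (\<forall>k<n. f k y = char_at k c * f k x)"
    using rotation_exists[OF assms(2), of v] by (auto simp: v char_at_proj)
  have "rot c x \<in> topspace X \<and> (\<forall>k<n. f k (rot c x) = char_at k c * f k x)"
    unfolding rot_def restrict_apply'[OF assms(2)]
  proof (rule theI[of _ y])
    show "z = y" if "z \<in> topspace X \<and> (\<forall>k<n. f k z = char_at k c * f k x)" for z
      using that y by (intro f_sep) auto
  qed (rule y)
  then show "rot c x \<in> topspace X" "k < n \<Longrightarrow> f k (rot c x) = char_at k c * f k x" by auto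
qed

text \<open>Separation by the coordinates reduces identities between rotations to identities between
  characters.\<close>

lemma rot_eqI:
  assumes "c \<in> carrier (torus l)" "x \<in> topspace X" "y \<in> topspace X" "\<And>k. k < n \<Longrightarrow> f k y = char_at k c * f k x"
  shows "rot c x = y"
  using rot[OF assms(1,2)] assms(3,4) by (intro f_sep) auto

lemma char_at_mult:
  assumes "c \<in> carrier (torus l)" "d \<in> carrier (torus l)"
  shows "char_at k (c \<otimes>\<^bsub>torus l\<^esub> d) = char_at k c * char_at k d"
proof -
  obtain u v where uv: "u \<in> rvec l" "c = torus_proj l u" "v \<in> rvec l" "d = torus_proj l v"
    using assms torus_carrierE by metis
  have "c \<otimes>\<^bsub>torus l\<^esub> d = torus_proj l (\<lambda>i. u i + v i)" by (simp add: uv torus_proj_add)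
  then show ?thesis using uv by (simp add: char_at_proj rvec_add ipair_add e2_add)
qed

lemma rot_mult:
  assumes "c \<in> carrier (torus l)" "d \<in> carrier (torus l)" "x \<in> topspace X"
  shows "rot (c \<otimes>\<^bsub>torus l\<^esub> d) x = rot c (rot d x)"
proof -
  interpret T: group "torus l" by (rule group_torus)
  show ?thesis
    using assms by (intro rot_eqI T.m_closed) (simp_all add: rot char_at_mult)
qed

lemma rot_Bij: assumes c: "c \<in> carrier (torus l)" shows "rot c \<in> Bij (topspace X)"
proof -
  interpret T: group "torus l" by (rule group_torus)
  have id: "rot \<one>\<^bsub>torus l\<^esub> x = x" if "x \<in> topspace X" for x
  proof (rule rot_eqI)
    have "\<one>\<^bsub>torus l\<^esub> = torus_proj l (\<lambda>i. 0)" by (rule torus_proj_int[symmetric]) (auto simp: rvec_0)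
    then show "f k x = char_at k \<one>\<^bsub>torus l\<^esub> * f k x" for k by (simp add: char_at_proj rvec_0 ipair_0)
  qed (use that in auto)
  have "rot (inv\<^bsub>torus l\<^esub> c) (rot c x) = x" "rot c (rot (inv\<^bsub>torus l\<^esub> c) x) = x" if "x \<in> topspace X" for x
    using c that by (simp_all add: id flip: rot_mult)
  then have "bij_betw (rot c) (topspace X) (topspace X)"
    using c rot(1) by (intro bij_betw_byWitness[where f' = "rot (inv\<^bsub>torus l\<^esub> c)"]) auto
  then show ?thesis by (simp add: Bij_def rot_def)
qed

lemma rot_group_action: "group_action (torus l) (topspace X) rot"
proof -
  have "rot \<in> hom (torus l) (BijGroup (topspace X))"
  proof (rule homI)
    show "rot c \<in> carrier (BijGroup (topspace X))" if "c \<in> carrier (torus l)" for c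
      using rot_Bij[OF that] by (simp add: BijGroup_def)
    fix c d assume cd: "c \<in> carrier (torus l)" "d \<in> carrier (torus l)"
    have "rot (c \<otimes>\<^bsub>torus l\<^esub> d) = compose (topspace X) (rot c) (rot d)"
      by (rule extensionalityI[of _ "topspace X"])
        (auto simp: rot_def[of "c \<otimes>\<^bsub>torus l\<^esub> d"] compose_eq rot_mult[OF cd, symmetric])
    then show "rot (c \<otimes>\<^bsub>torus l\<^esub> d) = rot c \<otimes>\<^bsub>BijGroup (topspace X)\<^esub> rot d"
      using cd rot_Bij by (simp add: BijGroup_def)
  qed
  then show ?thesis
    by (simp add: group_action_def group_hom_def group_hom_axioms_def group_torus group_BijGroup)
qed

lemma char_at_cont: "continuous_map (torus_topology l) euclidean (char_at k)"
proof (rule continuous_compose_quotient_map[OF quotient_map_torus_proj])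
  have "continuous_on (rvec l) (\<lambda>v. e2 (ipair l (m k) v))"
    by (intro continuous_on_e2 continuous_on_ipair continuous_on_id)
  then have "continuous_map (Euclidean_space l) euclidean (\<lambda>v. e2 (ipair l (m k) v))"
    by (simp add: Euclidean_space_top_of_set)
  then show "continuous_map (Euclidean_space l) euclidean (char_at k \<circ> torus_proj l)"
    by (rule continuous_map_eq) (simp add: topspace_Euclidean_rvec char_at_proj)
qed

text \<open>In the coordinates \<open>Z\<close> the action is entrywise multiplication by
  characters, hence continuous. Compactness makes \<open>Z\<close> an embedding, and its continuous
  inverse \<open>D\<close> carries this back to \<open>X\<close>.\<close>

lemma rot_cont: "continuous_map (prod_topology (torus_topology l) X) X (\<lambda>(c, x). rot c x)"
proof -
  define Z where "Z x = (\<lambda>k. if k < n then f k x else 0)" for x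
  let ?P = "prod_topology (torus_topology l) X"
  have Zc: "continuous_map X euclidean Z"
  proof -
    have "continuous_map X (product_topology (\<lambda>_. euclidean) UNIV) Z"
      unfolding continuous_map_componentwise_UNIV
    proof
      show "continuous_map X euclidean (\<lambda>x. Z x k)" for k
        using f_cont[of k] by (cases "k < n") (simp_all add: Z_def)
    qed
    then show ?thesis by (simp add: euclidean_product_topology)
  qed
  have Zi: "inj_on Z (topspace X)"
  proof
    fix x y assume xy: "x \<in> topspace X" "y \<in> topspace X" "Z x = Z y"
    have "f k x = f k y" if "k < n" for k using fun_cong[OF xy(3), of k] that by (simp add: Z_def)
    then show "x = y" using xy by (intro f_sep)
  qed
  have "embedding_map X euclidean Z"
    by (rule compact_continuous_injective_imp_embedding[OF comp _ Zc Zi]) simp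
  then have "homeomorphic_map X (top_of_set (Z ` topspace X)) Z" by (simp add: embedding_map_def)
  then obtain D where "homeomorphic_maps X (top_of_set (Z ` topspace X)) Z D" by (auto simp: homeomorphic_map_maps)
  then have Dc: "continuous_map (top_of_set (Z ` topspace X)) X D" and DZ: "\<And>x. x \<in> topspace X \<Longrightarrow> D (Z x) = x"
    by (auto simp: homeomorphic_maps_def)
  have tp: "fst p \<in> carrier (torus l)" "snd p \<in> topspace X" if "p \<in> topspace ?P" for p
    using that by (auto simp: topspace_torus_topology)
  have "continuous_map ?P euclidean (\<lambda>p. Z (rot (fst p) (snd p)))"
  proof -
    have "continuous_map ?P (product_topology (\<lambda>_. euclidean) UNIV) (\<lambda>p. Z (rot (fst p) (snd p)))"
      unfolding continuous_map_componentwise_UNIV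
    proof
      fix k
      show "continuous_map ?P euclidean (\<lambda>p. Z (rot (fst p) (snd p)) k)"
      proof (cases "k < n")
        case True
        have 1: "continuous_map ?P euclidean (\<lambda>p. char_at k (fst p))"
          using continuous_map_compose[OF continuous_map_fst char_at_cont] by (simp add: o_def)
        have 2: "continuous_map ?P euclidean (\<lambda>p. f k (snd p))"
          using continuous_map_compose[OF continuous_map_snd f_cont[OF True]] by (simp add: o_def)
        have mul: "continuous_map (prod_topology euclidean euclidean) euclidean (\<lambda>z. fst z * snd z :: complex)"
          by (auto intro!: continuous_intros)
        have "continuous_map ?P euclidean (\<lambda>p. char_at k (fst p) * f k (snd p))"
          using continuous_map_compose[OF continuous_map_pairedI[OF 1 2] mul] by (simp add: o_def)
        then show ?thesis
          by (rule continuous_map_eq) (use tp True in \<open>simp add: Z_def rot\<close>)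
      qed (simp add: Z_def)
    qed
    then show ?thesis by (simp add: euclidean_product_topology)
  qed
  then have "continuous_map ?P (top_of_set (Z ` topspace X)) (\<lambda>p. Z (rot (fst p) (snd p)))"
    using rot(1)[OF tp] by (simp add: continuous_map_in_subtopology image_subset_iff Pi_iff)
  from continuous_map_compose[OF this Dc]
  show ?thesis by (rule continuous_map_eq) (use rot(1)[OF tp] in \<open>auto simp: DZ split: prod.splits\<close>)
qed

lemma rot_finitely_many_orbit_types: "finitely_many_orbit_types l X rot"
proof -
  have stab: "stabilizer (torus l) rot x = {c \<in> carrier (torus l). \<forall>k\<in>{k. k < n \<and> f k x \<noteq> 0}. char_at k c = 1}"
    if x: "x \<in> topspace X" for x
  proof -
    have "rot c x = x \<longleftrightarrow> (\<forall>k<n. f k x \<noteq> 0 \<longrightarrow> char_at k c = 1)" if c: "c \<in> carrier (torus l)" for c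
    proof
      assume eq: "rot c x = x"
      show "\<forall>k<n. f k x \<noteq> 0 \<longrightarrow> char_at k c = 1"
        using rot(2)[OF c x] unfolding eq by auto
    next
      assume eq: "\<forall>k<n. f k x \<noteq> 0 \<longrightarrow> char_at k c = 1"
      show "rot c x = x" by (rule rot_eqI[OF c x x]) (use eq in force)
    qed
    then show ?thesis by (auto simp: stabilizer_def)
  qed
  have "{stabilizer (torus l) rot x | x. x \<in> topspace X} \<subseteq>
      (\<lambda>A. {c \<in> carrier (torus l). \<forall>k\<in>A. char_at k c = 1}) ` Pow {..<n}"
  proof safe
    fix x assume "x \<in> topspace X"
    from stab[OF this] show "stabilizer (torus l) rot x \<in>
        (\<lambda>A. {c \<in> carrier (torus l). \<forall>k\<in>A. char_at k c = 1}) ` Pow {..<n}"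
      by (rule image_eqI) auto
  qed
  then show ?thesis unfolding finitely_many_orbit_types_def
    by (rule finite_subset) simp
qed

lemma flow_one_parameter_subgroup: "one_parameter_subgroup \<Phi> l rot"
  unfolding one_parameter_subgroup_def
proof (intro bexI allI)
  \<comment> \<open>Entries from \<open>l\<close> on are unconstrained in \<open>\<omega>\<close>,
    but a vector of \<open>Euclidean_space l\<close> must vanish there.\<close>
  define \<omega>' where "\<omega>' i = (if i < l then \<omega> i else 0)" for i
  show \<omega>': "\<omega>' \<in> topspace (Euclidean_space l)" by (simp add: topspace_Euclidean_space \<omega>'_def)
  fix t
  have v: "(\<lambda>i. \<omega>' i * t) \<in> rvec l" by (simp add: rvec_def \<omega>'_def)
  have ip: "ipair l k (\<lambda>i. \<omega>' i * t) = ipair l k \<omega> * t" for k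
    by (simp add: ipair_def \<omega>'_def sum_distrib_right mult.assoc)
  show "\<Phi> t = rot (torus_proj l (\<lambda>i. \<omega>' i * t))"
  proof (rule extensionalityI[of _ "topspace X"])
    show "\<Phi> t \<in> extensional (topspace X)" using flow_Bij by (simp add: Bij_def)
    show "rot (torus_proj l (\<lambda>i. \<omega>' i * t)) \<in> extensional (topspace X)"
      using rot_Bij[OF torus_proj_closed[OF v]] by (simp add: Bij_def)
    show "\<Phi> t x = rot (torus_proj l (\<lambda>i. \<omega>' i * t)) x" if x: "x \<in> topspace X" for x
      by (rule rot_eqI[symmetric]) (use x v in \<open>simp_all add: torus_proj_closed flow_closed char_at_proj ip f_flow\<close>)
  qed
qed

end

lemma linearizable_imp_torus_action:
  assumes comp: "compact_space X" and flow: "C0_flow X \<Phi>" and lin: "linearizable_by_C0_embedding X \<Phi>"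
  shows "\<exists>l \<Theta>. C0_torus_action l X \<Theta> \<and> finitely_many_orbit_types l X \<Theta> \<and> one_parameter_subgroup \<Phi> l \<Theta>"
proof -
  obtain n and f :: "nat \<Rightarrow> 'a \<Rightarrow> complex" and \<nu> :: "nat \<Rightarrow> real" where
    f: "\<And>k. k < n \<Longrightarrow> continuous_map X euclidean (f k)"
    "\<And>k x t. k < n \<Longrightarrow> x \<in> topspace X \<Longrightarrow> f k (\<Phi> t x) = cis (\<nu> k * t) * f k x"
    "\<And>x y. x \<in> topspace X \<Longrightarrow> y \<in> topspace X \<Longrightarrow> (\<And>k. k < n \<Longrightarrow> f k x = f k y) \<Longrightarrow> x = y"
  proof (rule linearizable_imp_rotation_coordinates[OF comp lin flow], goal_cases)
    case (1 n f \<nu>)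
    show ?case by (rule 1(1)[of n f \<nu>]) (fact 1)+
  qed
  \<comment> \<open>Division by \<open>2 * pi\<close> converts angular speeds to the period-one
    normalisation of \<open>e2\<close>.\<close>
  obtain l \<omega> m where ind: "int_indep l \<omega>" and m: "\<And>k. k < n \<Longrightarrow> \<nu> k / (2 * pi) = ipair l (m k) \<omega>"
    using int_indep_frequencies[of n "\<lambda>k. \<nu> k / (2 * pi)"] by blast
  interpret rotation_coordinates X \<Phi> n l f m \<omega>
  proof
    show "f k (\<Phi> t x) = e2 (ipair l (m k) \<omega> * t) * f k x" if "k < n" "x \<in> topspace X" for k x t
      using f(2)[OF that] m[OF that(1)] by (simp add: e2_def flip: m[OF that(1)])
  qed (use comp flow f(1) ind in auto, rule f(3))
  have "C0_torus_action l X rot"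
    unfolding C0_torus_action_def continuous_action_def using rot_group_action rot_cont by blast
  then show ?thesis using rot_finitely_many_orbit_types flow_one_parameter_subgroup by blast
qed

theorem theorem2:
  fixes X :: "'a topology" and M :: "'m topology" and S :: "'m set"
    and \<Phi> :: "real \<Rightarrow> 'a \<Rightarrow> 'a"
  assumes "compact_space X"
    and "topological_manifold M" and "S \<subseteq> topspace M"
    and "X homeomorphic_space subtopology M S"
    and "C0_flow X \<Phi>"
  shows "linearizable_by_C0_embedding X \<Phi> \<longleftrightarrow>
    (\<exists>l \<Theta>. C0_torus_action l X \<Theta> \<and> finitely_many_orbit_types l X \<Theta> \<and>
      one_parameter_subgroup \<Phi> l \<Theta>)"
proof
  assume "linearizable_by_C0_embedding X \<Phi>"
  then show "\<exists>l \<Theta>. C0_torus_action l X \<Theta> \<and> finitely_many_orbit_types l X \<Theta> \<and>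
      one_parameter_subgroup \<Phi> l \<Theta>"
    by (rule linearizable_imp_torus_action[OF assms(1,5)])
next
  assume "\<exists>l \<Theta>. C0_torus_action l X \<Theta> \<and> finitely_many_orbit_types l X \<Theta> \<and>
      one_parameter_subgroup \<Phi> l \<Theta>"
  then obtain l \<Theta> where "C0_torus_action l X \<Theta>" "finitely_many_orbit_types l X \<Theta>"
    "one_parameter_subgroup \<Phi> l \<Theta>" by blast
  moreover obtain N E where "continuous_map X (Euclidean_space N) E" "inj_on E (topspace X)"
    by (rule compact_in_manifold_embeds[OF assms(1,2,4)])
  ultimately show "linearizable_by_C0_embedding X \<Phi>"
    by (intro torus_action_imp_linearizable[OF assms(1)])
qed


end
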